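(* The following is provable in ZF (without the Axiom of Choice): $AC_{fin}^{\omega}$ implies that if $(V,X)$ is a connected locally finite chordal graph (with vertex set $V$ and edge set $X$), then there is a total ordering $<$ of $V$ such that $\{w\in V : w<v,\ \{w,v\}\in X\}$ is a clique for each $v\in V$.
   Context: $AC_{fin}^{\omega}$: every denumerable (i.e. countably infinite) family of non-empty finite sets has a choice function. A graph is locally finite if every vertex has finite degree; it is connected if any two vertices are joined by a path of finite length; it is chordal if it does not contain an induced circuit $C_n$ of length $n$ for any $n\ge 4$. A clique is a set of vertices any two (distinct) of which are joined by an edge. *)

theory Defs
  imports Main
begin

text \<open>
  HOL has a choice operator, so "provable in ZF" is not rendered by a HOL theorem about HOL
  sets. Instead the first-order language of set theory, a natural deduction calculus
  and the axioms of ZF are defined explicitly, and the statement is a formula of that language.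
\<close>

section \<open>First-order logic with equality over the signature of set theory\<close>

text \<open>De Bruijn indices; the only terms are variables.\<close>

datatype form =
    Bot
  | Mem nat nat
  | Eq nat nat
  | Imp form form
  | All form

abbreviation Neg :: "form \<Rightarrow> form" where "Neg p \<equiv> Imp p Bot"
abbreviation Conj :: "form \<Rightarrow> form \<Rightarrow> form" where "Conj p q \<equiv> Neg (Imp p (Neg q))"
abbreviation Disj :: "form \<Rightarrow> form \<Rightarrow> form" where "Disj p q \<equiv> Imp (Neg p) q"
abbreviation Iff :: "form \<Rightarrow> form \<Rightarrow> form" where "Iff p q \<equiv> Conj (Imp p q) (Imp q p)"
abbreviation Ex :: "form \<Rightarrow> form" where "Ex p \<equiv> Neg (All (Neg p))"

fun free_vars :: "form \<Rightarrow> nat set" where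
  "free_vars Bot = {}"
| "free_vars (Mem i j) = {i, j}"
| "free_vars (Eq i j) = {i, j}"
| "free_vars (Imp p q) = free_vars p \<union> free_vars q"
| "free_vars (All p) = {i. Suc i \<in> free_vars p}"

definition sentence :: "form \<Rightarrow> bool" where
  "sentence p \<longleftrightarrow> free_vars p = {}"

definition lift :: "(nat \<Rightarrow> nat) \<Rightarrow> nat \<Rightarrow> nat" where
  "lift f i = (case i of 0 \<Rightarrow> 0 | Suc j \<Rightarrow> Suc (f j))"

fun ren :: "(nat \<Rightarrow> nat) \<Rightarrow> form \<Rightarrow> form" where
  "ren f Bot = Bot"
| "ren f (Mem i j) = Mem (f i) (f j)"
| "ren f (Eq i j) = Eq (f i) (f j)"
| "ren f (Imp p q) = Imp (ren f p) (ren f q)"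
| "ren f (All p) = All (ren (lift f) p)"

text \<open>\<open>inst t p\<close> is the instance of the body \<open>p\<close> of a quantifier at the variable \<open>t\<close>.\<close>

definition inst :: "nat \<Rightarrow> form \<Rightarrow> form" where
  "inst t = ren (\<lambda>i. case i of 0 \<Rightarrow> t | Suc j \<Rightarrow> j)"

text \<open>
  Classical natural deduction with equality. In \<open>allI\<close> the shift \<open>ren Suc\<close> of the
  hypotheses expresses the eigenvariable condition.
\<close>

inductive derivable :: "form set \<Rightarrow> form \<Rightarrow> bool" (infix "\<turnstile>" 50) where
  assm: "p \<in> \<Gamma> \<Longrightarrow> \<Gamma> \<turnstile> p"
| impI: "insert p \<Gamma> \<turnstile> q \<Longrightarrow> \<Gamma> \<turnstile> Imp p q"
| impE: "\<Gamma> \<turnstile> Imp p q \<Longrightarrow> \<Gamma> \<turnstile> p \<Longrightarrow> \<Gamma> \<turnstile> q"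
| raa: "insert (Neg p) \<Gamma> \<turnstile> Bot \<Longrightarrow> \<Gamma> \<turnstile> p"
| allI: "ren Suc ` \<Gamma> \<turnstile> p \<Longrightarrow> \<Gamma> \<turnstile> All p"
| allE: "\<Gamma> \<turnstile> All p \<Longrightarrow> \<Gamma> \<turnstile> inst t p"
| eqI: "\<Gamma> \<turnstile> Eq t t"
| eqE: "\<Gamma> \<turnstile> Eq s t \<Longrightarrow> \<Gamma> \<turnstile> inst s p \<Longrightarrow> \<Gamma> \<turnstile> inst t p"


section \<open>Notation for writing formulas\<close>

text \<open>
  A closed formula is written with HOL-bound variables that stand for de Bruijn levels: an
  \<open>fm\<close> maps the number \<open>d\<close> of enclosing quantifiers to a formula, and the quantifier
  entered at depth \<open>d\<close> binds the level \<open>d\<close>. At depth \<open>d\<close> the level \<open>x < d\<close> is the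
  index \<open>d - Suc x\<close>. The formula itself is obtained at depth 0.
\<close>

type_synonym fm = "nat \<Rightarrow> form"

definition fm_mem :: "nat \<Rightarrow> nat \<Rightarrow> fm" (infix "\<^bold>\<in>" 50) where
  "(x \<^bold>\<in> y) = (\<lambda>d. Mem (d - Suc x) (d - Suc y))"

definition fm_eq :: "nat \<Rightarrow> nat \<Rightarrow> fm" (infix "\<^bold>=" 50) where
  "(x \<^bold>= y) = (\<lambda>d. Eq (d - Suc x) (d - Suc y))"

definition fm_not :: "fm \<Rightarrow> fm" ("\<^bold>\<not> _" [40] 40) where
  "(\<^bold>\<not> P) = (\<lambda>d. Neg (P d))"

definition fm_and :: "fm \<Rightarrow> fm \<Rightarrow> fm" (infixr "\<^bold>\<and>" 35) where
  "(P \<^bold>\<and> Q) = (\<lambda>d. Conj (P d) (Q d))"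

definition fm_or :: "fm \<Rightarrow> fm \<Rightarrow> fm" (infixr "\<^bold>\<or>" 30) where
  "(P \<^bold>\<or> Q) = (\<lambda>d. Disj (P d) (Q d))"

definition fm_imp :: "fm \<Rightarrow> fm \<Rightarrow> fm" (infixr "\<^bold>\<longrightarrow>" 25) where
  "(P \<^bold>\<longrightarrow> Q) = (\<lambda>d. Imp (P d) (Q d))"

definition fm_iff :: "fm \<Rightarrow> fm \<Rightarrow> fm" (infixr "\<^bold>\<longleftrightarrow>" 25) where
  "(P \<^bold>\<longleftrightarrow> Q) = (\<lambda>d. Iff (P d) (Q d))"

definition fm_all :: "(nat \<Rightarrow> fm) \<Rightarrow> fm" (binder "\<^bold>\<forall>" 10) where
  "fm_all F = (\<lambda>d. All (F d (Suc d)))"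

definition fm_ex :: "(nat \<Rightarrow> fm) \<Rightarrow> fm" (binder "\<^bold>\<exists>" 10) where
  "fm_ex F = (\<lambda>d. Ex (F d (Suc d)))"

definition closed_form :: "fm \<Rightarrow> form" where
  "closed_form P = P 0"


section \<open>Basic set-theoretic notions as formulas\<close>

definition is_subset :: "nat \<Rightarrow> nat \<Rightarrow> fm" where
  "is_subset x y = (\<^bold>\<forall>z. z \<^bold>\<in> x \<^bold>\<longrightarrow> z \<^bold>\<in> y)"

definition is_empty :: "nat \<Rightarrow> fm" where
  "is_empty x = (\<^bold>\<forall>z. \<^bold>\<not> z \<^bold>\<in> x)"

text \<open>\<open>p = {x, y}\<close>\<close>

definition is_upair :: "nat \<Rightarrow> nat \<Rightarrow> nat \<Rightarrow> fm" where
  "is_upair p x y = (\<^bold>\<forall>z. z \<^bold>\<in> p \<^bold>\<longleftrightarrow> z \<^bold>= x \<^bold>\<or> z \<^bold>= y)"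

text \<open>Kuratowski pairs: \<open>p = {{x, x}, {x, y}}\<close>\<close>

definition is_pair :: "nat \<Rightarrow> nat \<Rightarrow> nat \<Rightarrow> fm" where
  "is_pair p x y = (\<^bold>\<forall>z. z \<^bold>\<in> p \<^bold>\<longleftrightarrow> is_upair z x x \<^bold>\<or> is_upair z x y)"

definition is_union :: "nat \<Rightarrow> nat \<Rightarrow> fm" where
  "is_union u F = (\<^bold>\<forall>x. x \<^bold>\<in> u \<^bold>\<longleftrightarrow> (\<^bold>\<exists>y. y \<^bold>\<in> F \<^bold>\<and> x \<^bold>\<in> y))"

definition is_power :: "nat \<Rightarrow> nat \<Rightarrow> fm" where
  "is_power P x = (\<^bold>\<forall>y. y \<^bold>\<in> P \<^bold>\<longleftrightarrow> is_subset y x)"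

text \<open>\<open>y = x \<union> {x}\<close>\<close>

definition is_succ :: "nat \<Rightarrow> nat \<Rightarrow> fm" where
  "is_succ y x = (\<^bold>\<forall>z. z \<^bold>\<in> y \<^bold>\<longleftrightarrow> z \<^bold>\<in> x \<^bold>\<or> z \<^bold>= x)"

definition is_inductive :: "nat \<Rightarrow> fm" where
  "is_inductive w = ((\<^bold>\<exists>z. is_empty z \<^bold>\<and> z \<^bold>\<in> w) \<^bold>\<and>
     (\<^bold>\<forall>x. x \<^bold>\<in> w \<^bold>\<longrightarrow> (\<^bold>\<exists>y. is_succ y x \<^bold>\<and> y \<^bold>\<in> w)))"

definition is_omega :: "nat \<Rightarrow> fm" where
  "is_omega w = (is_inductive w \<^bold>\<and> (\<^bold>\<forall>u. is_inductive u \<^bold>\<longrightarrow> is_subset w u))"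

text \<open>\<open>(x, y) \<in> r\<close>, also used for \<open>r(x) = y\<close> when \<open>r\<close> is a function\<close>

definition rel :: "nat \<Rightarrow> nat \<Rightarrow> nat \<Rightarrow> fm" where
  "rel r x y = (\<^bold>\<exists>p. is_pair p x y \<^bold>\<and> p \<^bold>\<in> r)"

definition is_relation :: "nat \<Rightarrow> nat \<Rightarrow> nat \<Rightarrow> fm" where
  "is_relation r A B =
     (\<^bold>\<forall>p. p \<^bold>\<in> r \<^bold>\<longrightarrow> (\<^bold>\<exists>x y. x \<^bold>\<in> A \<^bold>\<and> y \<^bold>\<in> B \<^bold>\<and> is_pair p x y))"

definition is_function :: "nat \<Rightarrow> nat \<Rightarrow> nat \<Rightarrow> fm" where
  "is_function f A B = (is_relation f A B \<^bold>\<and>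
     (\<^bold>\<forall>x. x \<^bold>\<in> A \<^bold>\<longrightarrow> (\<^bold>\<exists>y. rel f x y \<^bold>\<and> (\<^bold>\<forall>z. rel f x z \<^bold>\<longrightarrow> z \<^bold>= y))))"

definition is_injection :: "nat \<Rightarrow> nat \<Rightarrow> nat \<Rightarrow> fm" where
  "is_injection f A B = (is_function f A B \<^bold>\<and>
     (\<^bold>\<forall>x x' y. rel f x y \<^bold>\<and> rel f x' y \<^bold>\<longrightarrow> x \<^bold>= x'))"

definition is_bijection :: "nat \<Rightarrow> nat \<Rightarrow> nat \<Rightarrow> fm" where
  "is_bijection f A B = (is_injection f A B \<^bold>\<and>
     (\<^bold>\<forall>y. y \<^bold>\<in> B \<^bold>\<longrightarrow> (\<^bold>\<exists>x. rel f x y)))"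

definition is_finite :: "nat \<Rightarrow> fm" where
  "is_finite A = (\<^bold>\<exists>w n f. is_omega w \<^bold>\<and> n \<^bold>\<in> w \<^bold>\<and> is_bijection f n A)"

definition is_denumerable :: "nat \<Rightarrow> fm" where
  "is_denumerable A = (\<^bold>\<exists>w f. is_omega w \<^bold>\<and> is_bijection f w A)"


section \<open>The axioms of ZF\<close>

definition extensionality :: fm where
  "extensionality = (\<^bold>\<forall>x y. (\<^bold>\<forall>z. z \<^bold>\<in> x \<^bold>\<longleftrightarrow> z \<^bold>\<in> y) \<^bold>\<longrightarrow> x \<^bold>= y)"

definition foundation :: fm where
  "foundation = (\<^bold>\<forall>x. (\<^bold>\<exists>y. y \<^bold>\<in> x) \<^bold>\<longrightarrow>
     (\<^bold>\<exists>y. y \<^bold>\<in> x \<^bold>\<and> \<^bold>\<not> (\<^bold>\<exists>z. z \<^bold>\<in> x \<^bold>\<and> z \<^bold>\<in> y)))"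

definition pairing :: fm where
  "pairing = (\<^bold>\<forall>x y. \<^bold>\<exists>p. is_upair p x y)"

definition union_of_sets :: fm where
  "union_of_sets = (\<^bold>\<forall>F. \<^bold>\<exists>u. is_union u F)"

definition power_set :: fm where
  "power_set = (\<^bold>\<forall>x. \<^bold>\<exists>P. is_power P x)"

definition infinity :: fm where
  "infinity = (\<^bold>\<exists>w. is_inductive w)"

text \<open>
  Separation: \<open>\<forall>a. \<exists>b. \<forall>x. x \<in> b \<longleftrightarrow> x \<in> a \<and> \<phi>(x, a, \<dots>)\<close>. In \<open>\<phi>\<close> the index 0 is \<open>x\<close>,
  1 is \<open>a\<close>, and the remaining ones are parameters; the renaming makes room for \<open>b\<close>,
  which therefore does not occur in \<open>\<phi>\<close>.
\<close>

definition separation :: "form \<Rightarrow> form" where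
  "separation \<phi> = All (Ex (All (Iff (Mem 0 1) (Conj (Mem 0 2) (ren (lift Suc) \<phi>)))))"

text \<open>
  Replacement:
  \<open>\<forall>a. (\<forall>x\<in>a. \<forall>y z. \<phi>(y, x, a, \<dots>) \<and> \<phi>(z, x, a, \<dots>) \<longrightarrow> z = y)
     \<longrightarrow> (\<exists>b. \<forall>y. y \<in> b \<longleftrightarrow> (\<exists>x. x \<in> a \<and> \<phi>(y, x, a, \<dots>)))\<close>.
  In \<open>\<phi>\<close> the index 0 is \<open>y\<close>, 1 is \<open>x\<close>, 2 is \<open>a\<close>, and the remaining ones are parameters.
\<close>

definition replacement :: "form \<Rightarrow> form" where
  "replacement \<phi> = All (Imp
     (All (Imp (Mem 0 1) (All (All (Imp (Conj (ren Suc \<phi>) (ren (lift Suc) \<phi>)) (Eq 0 1))))))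
     (Ex (All (Iff (Mem 0 1)
        (Ex (Conj (Mem 0 3)
           (ren (\<lambda>i. case i of 0 \<Rightarrow> 1 | Suc 0 \<Rightarrow> 0 | Suc (Suc j) \<Rightarrow> Suc (Suc (Suc j))) \<phi>)))))))"

definition closures :: "form \<Rightarrow> form set" where
  "closures p = {q. \<exists>n. q = (All ^^ n) p \<and> sentence q}"

definition ZF :: "form set" where
  "ZF = closed_form ` {extensionality, foundation, pairing, union_of_sets, power_set, infinity}
     \<union> (\<Union>\<phi>. closures (separation \<phi>)) \<union> (\<Union>\<phi>. closures (replacement \<phi>))"


section \<open>Choice for denumerable families of finite sets\<close>

definition AC_fin_omega :: fm where
  "AC_fin_omega = (\<^bold>\<forall>F.
     is_denumerable F \<^bold>\<and> (\<^bold>\<forall>A. A \<^bold>\<in> F \<^bold>\<longrightarrow> is_finite A \<^bold>\<and> \<^bold>\<not> is_empty A) \<^bold>\<longrightarrow>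
     (\<^bold>\<exists>u f. is_union u F \<^bold>\<and> is_function f F u \<^bold>\<and> (\<^bold>\<forall>A x. rel f A x \<^bold>\<longrightarrow> x \<^bold>\<in> A)))"


section \<open>Graphs\<close>

definition is_graph :: "nat \<Rightarrow> nat \<Rightarrow> fm" where
  "is_graph V X = (\<^bold>\<forall>e. e \<^bold>\<in> X \<^bold>\<longrightarrow>
     (\<^bold>\<exists>v w. v \<^bold>\<in> V \<^bold>\<and> w \<^bold>\<in> V \<^bold>\<and> \<^bold>\<not> v \<^bold>= w \<^bold>\<and> is_upair e v w))"

text \<open>\<open>{v, w} \<in> X\<close>\<close>

definition edge :: "nat \<Rightarrow> nat \<Rightarrow> nat \<Rightarrow> fm" where
  "edge X v w = (\<^bold>\<exists>e. is_upair e v w \<^bold>\<and> e \<^bold>\<in> X)"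

definition is_locally_finite :: "nat \<Rightarrow> nat \<Rightarrow> fm" where
  "is_locally_finite V X = (\<^bold>\<forall>v. v \<^bold>\<in> V \<^bold>\<longrightarrow>
     (\<^bold>\<exists>N. (\<^bold>\<forall>w. w \<^bold>\<in> N \<^bold>\<longleftrightarrow> w \<^bold>\<in> V \<^bold>\<and> edge X w v) \<^bold>\<and> is_finite N))"

text \<open>
  A path of length \<open>n\<close> from \<open>a\<close> to \<open>b\<close> is an injective sequence \<open>p\<close> of vertices, indexed
  by \<open>{0, \<dots>, n} = n \<union> {n}\<close>, with \<open>p(0) = a\<close>, \<open>p(n) = b\<close> and consecutive vertices joined.
\<close>

definition is_path :: "nat \<Rightarrow> nat \<Rightarrow> nat \<Rightarrow> nat \<Rightarrow> nat \<Rightarrow> nat \<Rightarrow> fm" where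
  "is_path V X p n a b =
     ((\<^bold>\<exists>m. is_succ m n \<^bold>\<and> is_injection p m V) \<^bold>\<and>
      (\<^bold>\<exists>z. is_empty z \<^bold>\<and> rel p z a) \<^bold>\<and> rel p n b \<^bold>\<and>
      (\<^bold>\<forall>i j v w. i \<^bold>\<in> n \<^bold>\<and> is_succ j i \<^bold>\<and> rel p i v \<^bold>\<and> rel p j w \<^bold>\<longrightarrow> edge X v w))"

definition is_connected :: "nat \<Rightarrow> nat \<Rightarrow> fm" where
  "is_connected V X = (\<^bold>\<forall>a b. a \<^bold>\<in> V \<^bold>\<and> b \<^bold>\<in> V \<^bold>\<longrightarrow>
     (\<^bold>\<exists>w n p. is_omega w \<^bold>\<and> n \<^bold>\<in> w \<^bold>\<and> is_path V X p n a b))"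

text \<open>\<open>3 \<in> n\<close>, that is, \<open>n \<ge> 4\<close> for a natural number \<open>n\<close>\<close>

definition at_least_four :: "nat \<Rightarrow> fm" where
  "at_least_four n = (\<^bold>\<exists>n0 n1 n2 n3. is_empty n0 \<^bold>\<and> is_succ n1 n0 \<^bold>\<and> is_succ n2 n1 \<^bold>\<and>
     is_succ n3 n2 \<^bold>\<and> n3 \<^bold>\<in> n)"

text \<open>For \<open>i, j < n\<close>: \<open>i\<close> and \<open>j\<close> are neighbours in the circuit \<open>0, 1, \<dots>, n - 1, 0\<close>.\<close>

definition circuit_adjacent :: "nat \<Rightarrow> nat \<Rightarrow> nat \<Rightarrow> fm" where
  "circuit_adjacent n i j = (is_succ i j \<^bold>\<or> is_succ j i \<^bold>\<or>
     (is_empty i \<^bold>\<and> is_succ n j) \<^bold>\<or> (is_empty j \<^bold>\<and> is_succ n i))"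

definition is_induced_circuit :: "nat \<Rightarrow> nat \<Rightarrow> nat \<Rightarrow> nat \<Rightarrow> fm" where
  "is_induced_circuit V X n c = (is_injection c n V \<^bold>\<and>
     (\<^bold>\<forall>i j v w. i \<^bold>\<in> n \<^bold>\<and> j \<^bold>\<in> n \<^bold>\<and> rel c i v \<^bold>\<and> rel c j w \<^bold>\<longrightarrow>
        (edge X v w \<^bold>\<longleftrightarrow> circuit_adjacent n i j)))"

definition is_chordal :: "nat \<Rightarrow> nat \<Rightarrow> fm" where
  "is_chordal V X = (\<^bold>\<not> (\<^bold>\<exists>w n c. is_omega w \<^bold>\<and> n \<^bold>\<in> w \<^bold>\<and> at_least_four n \<^bold>\<and>
     is_induced_circuit V X n c))"

definition is_clique :: "nat \<Rightarrow> nat \<Rightarrow> nat \<Rightarrow> fm" where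
  "is_clique V X K = (is_subset K V \<^bold>\<and>
     (\<^bold>\<forall>v w. v \<^bold>\<in> K \<^bold>\<and> w \<^bold>\<in> K \<^bold>\<and> \<^bold>\<not> v \<^bold>= w \<^bold>\<longrightarrow> edge X v w))"

definition is_total_order :: "nat \<Rightarrow> nat \<Rightarrow> fm" where
  "is_total_order V r = (is_relation r V V \<^bold>\<and>
     (\<^bold>\<forall>x. \<^bold>\<not> rel r x x) \<^bold>\<and>
     (\<^bold>\<forall>x y z. rel r x y \<^bold>\<and> rel r y z \<^bold>\<longrightarrow> rel r x z) \<^bold>\<and>
     (\<^bold>\<forall>x y. x \<^bold>\<in> V \<^bold>\<and> y \<^bold>\<in> V \<^bold>\<and> \<^bold>\<not> x \<^bold>= y \<^bold>\<longrightarrow> rel r x y \<^bold>\<or> rel r y x))"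

text \<open>\<open>{w \<in> V. w < v \<and> {w, v} \<in> X}\<close> is a clique for each \<open>v \<in> V\<close>, where \<open><\<close> is \<open>r\<close>.\<close>

definition smaller_neighbours_cliques :: "nat \<Rightarrow> nat \<Rightarrow> nat \<Rightarrow> fm" where
  "smaller_neighbours_cliques V X r = (\<^bold>\<forall>v. v \<^bold>\<in> V \<^bold>\<longrightarrow>
     (\<^bold>\<exists>K. (\<^bold>\<forall>w. w \<^bold>\<in> K \<^bold>\<longleftrightarrow> w \<^bold>\<in> V \<^bold>\<and> rel r w v \<^bold>\<and> edge X w v) \<^bold>\<and> is_clique V X K))"

end

theory Submission
  imports Defs "HOL-Library.Countable_Set"
begin

text \<open>
  By completeness of the calculus it suffices to argue in an arbitrary model of ZF, where separation
  is available for all predicates definable with parameters. Let \<open>v0\<close> be a vertex. By local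
  finiteness the sets of vertices at distance exactly \<open>n\<close> from \<open>v0\<close>, the levels, are finite. Call an
  order of a level good if for every vertex \<open>v\<close> of that level, the neighbours of \<open>v\<close> on the previous
  level together with its smaller neighbours on the same level form a clique. Whether an order is
  good does not depend on the orders of other levels, so choosing from the finite nonempty sets of
  good orders and comparing vertices by level first gives the required order.

  A good order exists because every nonempty set \<open>A\<close> of vertices of a level \<open>n + 1\<close> contains a vertex
  whose neighbours in \<open>A\<close> and level \<open>n\<close> form a clique; it is made the last one. To find it, note that in
  a chordal graph two vertices which both have neighbours in each of two connected, disjoint sets
  without edges between them are joined, unless they lie in one of the sets. Hence a component of
  \<open>A\<close> has a clique as boundary, and in a minimal nonempty subset of \<open>A\<close> with this property
  every vertex will do.
\<close>

section \<open>Completeness\<close>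

text \<open>The model may be nonstandard: its \<open>om\<close> can contain elements that are no
  numerals, and its finite sets can be infinite from outside. HOL induction, recursion and
  finiteness therefore do not apply to it. Every induction and every least element goes through a
  set of the model, so each predicate involved needs a proof of definability, and recursion along
  \<open>om\<close> is replaced by least closed sets.

  The reason for the separation property: suppose that \<open>x\<close> and \<open>y\<close> are not
  joined. Induced paths that start at \<open>x\<close> and enter \<open>C\<close> in their first
  step can be prolonged through \<open>C\<close> to \<open>y\<close> and from there into
  \<open>D\<close>. No vertex of \<open>D\<close> met in this way is adjacent to \<open>x\<close>,
  since otherwise the path would close to an induced circuit of length at least 4. As
  \<open>D\<close> is connected, this excludes every vertex of \<open>D\<close>.

  For a component in level \<open>n + 1\<close> the second connected set is the ball of radius
  \<open>n - 1\<close>. There is none for \<open>n = 0\<close>, but then the boundary contains at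
  most the root.\<close>

lemma lift_simps [simp]: "lift f 0 = 0" "lift f (Suc n) = Suc (f n)"
  by (simp_all add: lift_def)

lemma lift_comp: "lift f \<circ> lift g = lift (f \<circ> g)"
  by (auto simp: fun_eq_iff lift_def split: nat.split)

lemma ren_ren: "ren f (ren g p) = ren (f \<circ> g) p"
  by (induction p arbitrary: f g) (simp_all add: lift_comp)

lemma ren_cong: "(\<And>i. i \<in> free_vars p \<Longrightarrow> f i = g i) \<Longrightarrow> ren f p = ren g p"
proof (induction p arbitrary: f g)
  case (All p)
  have "ren (lift f) p = ren (lift g) p"
  proof (rule All.IH)
    fix i assume "i \<in> free_vars p" then show "lift f i = lift g i"
      by (cases i) (auto intro: All.prems)
  qed
  then show ?case by simp
next
  case (Imp p q)
  have "ren f p = ren g p" "ren f q = ren g q"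
    by (rule Imp.IH; use Imp.prems in auto)+
  then show ?case by simp
qed auto

lemma ren_id: "ren (\<lambda>i. i) p = p"
proof (induction p)
  case (All p)
  have "lift (\<lambda>i. i) = (\<lambda>i. i)" by (auto simp: fun_eq_iff lift_def split: nat.split)
  with All show ?case by simp
qed auto

lemma ren_inst: "ren f (inst t p) = inst (f t) (ren (lift f) p)"
  unfolding inst_def ren_ren by (rule ren_cong) (simp split: nat.split)

lemma ren_lift_Suc: "ren (lift f) (ren Suc p) = ren Suc (ren f p)"
  unfolding ren_ren by (rule ren_cong) simp

text \<open>The quantifier case of the truth lemma for the term model, where an environment is a
  renaming.\<close>

lemma inst_ren_lift: "inst a (ren (lift f) p) = ren (case_nat a f) p"
  unfolding inst_def ren_ren by (rule ren_cong) (simp split: nat.split)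

lemma finite_free_vars: "finite (free_vars p)"
proof (induction p)
  case (All p)
  have "{i. Suc i \<in> free_vars p} \<subseteq> (\<lambda>i. i - 1) ` free_vars p" by force
  with All show ?case using finite_subset by fastforce
qed auto

lemma free_vars_All_pow: "free_vars ((All ^^ n) p) = {i. i + n \<in> free_vars p}"
  by (induction n) auto

lemma ex_closure: "\<exists>n. sentence ((All ^^ n) p)"
proof -
  obtain n where "\<forall>i\<in>free_vars p. i < n"
    using finite_nat_set_iff_bounded finite_free_vars by blast
  then show ?thesis
    by (intro exI[of _ n]) (auto simp: sentence_def free_vars_All_pow)
qed

section \<open>Structural properties of derivability\<close>

lemma weaken: "\<Gamma> \<turnstile> p \<Longrightarrow> \<Gamma> \<subseteq> \<Delta> \<Longrightarrow> \<Delta> \<turnstile> p"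
proof (induction arbitrary: \<Delta> rule: derivable.induct)
  case (impI p \<Gamma> q) then show ?case by (meson derivable.impI insert_mono)
next
  case (raa p \<Gamma>) then show ?case by (meson derivable.raa insert_mono)
next
  case (allI \<Gamma> p) then show ?case by (meson derivable.allI image_mono)
qed (blast intro: derivable.intros)+

text \<open>Exchanging an eigenvariable is a renaming of the whole derivation. Under
  \<open>allI\<close> the renaming becomes \<open>lift f\<close>, which commutes with the
  shift.\<close>

lemma derivable_ren: "\<Gamma> \<turnstile> p \<Longrightarrow> ren f ` \<Gamma> \<turnstile> ren f p"
proof (induction arbitrary: f rule: derivable.induct)
  case (impI p \<Gamma> q)
  then show ?case using derivable.impI[of "ren f p" "ren f ` \<Gamma>"] by simp
next
  case (raa p \<Gamma>)
  then show ?case using derivable.raa[of "ren f p" "ren f ` \<Gamma>"] by simp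
next
  case (allI \<Gamma> p)
  have "ren Suc ` ren f ` \<Gamma> = ren (lift f) ` ren Suc ` \<Gamma>"
    by (simp add: image_image ren_lift_Suc)
  then show ?case using derivable.allI[of "ren f ` \<Gamma>" "ren (lift f) p"] allI.IH[of "lift f"] by simp
next
  case (allE \<Gamma> p t)
  then show ?case by (metis derivable.allE ren.simps(5) ren_inst)
next
  case (eqE \<Gamma> s t p)
  then show ?case by (metis derivable.eqE ren.simps(3) ren_inst)
next
  case (impE \<Gamma> p q)
  then show ?case by (metis derivable.impE ren.simps(4))
qed (auto intro: derivable.intros)

text \<open>Needed because an inconsistency of the union of the Henkin stages must already show at
  one stage.\<close>

lemma derivable_finite: "\<Gamma> \<turnstile> p \<Longrightarrow> \<exists>\<Gamma>'. finite \<Gamma>' \<and> \<Gamma>' \<subseteq> \<Gamma> \<and> \<Gamma>' \<turnstile> p"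
proof (induction rule: derivable.induct)
  case (assm p \<Gamma>)
  then show ?case by (intro exI[of _ "{p}"]) (auto intro: derivable.assm)
next
  case (impI p \<Gamma> q)
  then obtain G where "finite G" "G \<subseteq> insert p \<Gamma>" "G \<turnstile> q" by blast
  then show ?case
    by (intro exI[of _ "G - {p}"]) (auto intro!: derivable.impI elim!: weaken)
next
  case (raa p \<Gamma>)
  then obtain G where "finite G" "G \<subseteq> insert (Neg p) \<Gamma>" "G \<turnstile> Bot" by blast
  then show ?case
    by (intro exI[of _ "G - {Neg p}"]) (auto intro!: derivable.raa elim!: weaken)
next
  case (impE \<Gamma> p q)
  then obtain G H where "finite G" "G \<subseteq> \<Gamma>" "G \<turnstile> Imp p q" "finite H" "H \<subseteq> \<Gamma>" "H \<turnstile> p" by blast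
  then show ?case
    by (intro exI[of _ "G \<union> H"]) (auto intro!: derivable.impE[of _ p q] elim!: weaken)
next
  case (eqE \<Gamma> s t p)
  then obtain G H where "finite G" "G \<subseteq> \<Gamma>" "G \<turnstile> Eq s t" "finite H" "H \<subseteq> \<Gamma>" "H \<turnstile> inst s p" by blast
  then show ?case
    by (intro exI[of _ "G \<union> H"]) (auto intro!: derivable.eqE[of _ s t p] elim!: weaken)
next
  case (allI \<Gamma> p)
  then obtain G where "finite G" "G \<subseteq> ren Suc ` \<Gamma>" "G \<turnstile> p" by blast
  then show ?case using derivable.allI finite_subset_image by metis
next
  case (allE \<Gamma> p t)
  then show ?case using derivable.allE by blast
next
  case (eqI \<Gamma> t)
  then show ?case using derivable.eqI by blast
qed

lemma cut: "insert p \<Gamma> \<turnstile> q \<Longrightarrow> \<Gamma> \<turnstile> p \<Longrightarrow> \<Gamma> \<turnstile> q"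
  using impE impI by blast

text \<open>By \<open>raa\<close> the instance at \<open>t\<close> is derivable. The renaming
  \<open>f\<close> turns \<open>t\<close> into index 0 and shifts everything else. As
  \<open>t\<close> is fresh, \<open>f\<close> maps the instance back to the body \<open>q\<close>
  and acts as the shift on the hypotheses, which gives the premise of \<open>allI\<close>.\<close>

lemma fresh_witness:
  assumes d: "insert (Neg (inst t q)) \<Gamma> \<turnstile> Bot"
    and t: "t \<notin> free_vars (All q)" "\<And>p. p \<in> \<Gamma> \<Longrightarrow> t \<notin> free_vars p"
  shows "\<Gamma> \<turnstile> All q"
proof (rule allI)
  define f where "f = (\<lambda>i. if i = t then 0 else Suc i)"
  have "ren f (inst t q) = ren (\<lambda>i. i) q"
    unfolding inst_def ren_ren by (rule ren_cong) (use t(1) in \<open>auto simp: f_def split: nat.splits\<close>)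
  moreover have "ren f p = ren Suc p" if "p \<in> \<Gamma>" for p
    by (rule ren_cong) (use t(2)[OF that] in \<open>auto simp: f_def\<close>)
  then have "ren f ` \<Gamma> = ren Suc ` \<Gamma>" by force
  ultimately show "ren Suc ` \<Gamma> \<turnstile> q"
    using derivable_ren[OF raa[OF d], of f] by (simp add: ren_id)
qed

section \<open>The Henkin extension of a consistent set of sentences\<close>

instance form :: countable
  by countable_datatype

definition fresh :: "form set \<Rightarrow> nat" where
  "fresh \<Gamma> = (SOME t. t \<notin> \<Union>(free_vars ` \<Gamma>))"

definition add_witness :: "form set \<Rightarrow> form \<Rightarrow> form set" where
  "add_witness \<Gamma> p = (if \<exists>q. p = Neg (All q)
     then insert (Neg (inst (fresh \<Gamma>) (THE q. p = Neg (All q)))) \<Gamma> else \<Gamma>)"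

text \<open>Each stage adds at most two formulas, so that from sentences onwards a fresh variable
  for the witness is always available.\<close>

fun henkin :: "form set \<Rightarrow> nat \<Rightarrow> form set" where
  "henkin \<Gamma> 0 = \<Gamma>"
| "henkin \<Gamma> (Suc n) = (let p = from_nat n; \<Delta> = insert p (henkin \<Gamma> n) in
     if \<Delta> \<turnstile> Bot then henkin \<Gamma> n else add_witness \<Delta> p)"

lemma add_witness_All [simp]:
  "add_witness \<Gamma> (Neg (All q)) = insert (Neg (inst (fresh \<Gamma>) q)) \<Gamma>"
  by (simp add: add_witness_def)

lemma add_witness_cases: "add_witness \<Gamma> p = \<Gamma> \<or>
   (\<exists>q. p = Neg (All q) \<and> add_witness \<Gamma> p = insert (Neg (inst (fresh \<Gamma>) q)) \<Gamma>)"
  by (cases "\<exists>q. p = Neg (All q)") (auto simp: add_witness_def)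

lemma add_witness_consistent:
  assumes fin: "finite (\<Union>(free_vars ` \<Gamma>))" and p: "p \<in> \<Gamma>" and c: "\<not> \<Gamma> \<turnstile> Bot"
  shows "\<not> add_witness \<Gamma> p \<turnstile> Bot"
proof
  assume "add_witness \<Gamma> p \<turnstile> Bot"
  with add_witness_cases[of \<Gamma> p] c obtain q where q: "p = Neg (All q)"
    and d: "insert (Neg (inst (fresh \<Gamma>) q)) \<Gamma> \<turnstile> Bot" by auto
  have "\<exists>t. t \<notin> \<Union>(free_vars ` \<Gamma>)" using fin ex_new_if_finite infinite_UNIV_nat by blast
  then have "fresh \<Gamma> \<notin> \<Union>(free_vars ` \<Gamma>)" unfolding fresh_def by (rule someI_ex)
  then have "\<Gamma> \<turnstile> All q" using p q by (intro fresh_witness[OF d]) auto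
  then show False using c p q assm impE by blast
qed

lemma henkin_invariant:
  assumes "\<Union>(free_vars ` \<Gamma>) = {}" "\<not> \<Gamma> \<turnstile> Bot"
  shows "finite (\<Union>(free_vars ` henkin \<Gamma> n)) \<and> \<not> henkin \<Gamma> n \<turnstile> Bot"
proof (induction n)
  case 0
  then show ?case using assms by (metis finite.emptyI henkin.simps(1))
next
  case (Suc n)
  let ?p = "from_nat n :: form" and ?D = "insert (from_nat n) (henkin \<Gamma> n)"
  have f: "finite (\<Union>(free_vars ` ?D))" using Suc finite_free_vars by simp
  show ?case
  proof (cases "?D \<turnstile> Bot")
    case True then show ?thesis using Suc by (simp add: Let_def)
  next
    case False
    have "finite (\<Union>(free_vars ` add_witness ?D ?p))"
      using add_witness_cases[of ?D ?p] f finite_free_vars by (metis UN_insert finite_UnI)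
    then show ?thesis using False add_witness_consistent[OF f _ False] by (simp add: Let_def)
  qed
qed

lemma henkin_mono: "m \<le> n \<Longrightarrow> henkin \<Gamma> m \<subseteq> henkin \<Gamma> n"
proof (rule lift_Suc_mono_le[of "henkin \<Gamma>"])
  fix n show "henkin \<Gamma> n \<subseteq> henkin \<Gamma> (Suc n)"
    using add_witness_cases[of "insert (from_nat n) (henkin \<Gamma> n)" "from_nat n"]
    by (auto simp: Let_def)
qed auto

lemma henkin_set:
  assumes "\<Union>(free_vars ` \<Gamma>) = {}" "\<not> \<Gamma> \<turnstile> Bot"
  obtains \<Delta> where "\<Gamma> \<subseteq> \<Delta>" "\<not> \<Delta> \<turnstile> Bot" "\<And>p. p \<in> \<Delta> \<or> Neg p \<in> \<Delta>" "\<And>p. \<Delta> \<turnstile> p \<Longrightarrow> p \<in> \<Delta>"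
    "\<And>q. Neg (All q) \<in> \<Delta> \<Longrightarrow> \<exists>t. Neg (inst t q) \<in> \<Delta>"
proof -
  define D where "D = (\<Union>n. henkin \<Gamma> n)"
  have cons: "\<not> D \<turnstile> Bot"
  proof
    assume "D \<turnstile> Bot"
    then obtain G where G: "finite G" "G \<subseteq> D" "G \<turnstile> Bot" using derivable_finite by blast
    have "\<exists>n. G \<subseteq> henkin \<Gamma> n" using G(1,2)
    proof (induction G)
      case (insert p G)
      then obtain m n where "p \<in> henkin \<Gamma> m" "G \<subseteq> henkin \<Gamma> n" by (auto simp: D_def)
      then have "insert p G \<subseteq> henkin \<Gamma> (max m n)"
        using henkin_mono[of m "max m n" \<Gamma>] henkin_mono[of n "max m n" \<Gamma>] by auto
      then show ?case by blast
    qed simp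
    then show False using G(3) weaken henkin_invariant[OF assms] by blast
  qed
  \<comment> \<open>\<open>p\<close> is treated at stage \<open>to_nat p\<close>: either it is
    added, with its witness if it asks for one, or it is inconsistent with that stage and hence with
    \<open>D\<close>.\<close>
  have step: "insert p D \<turnstile> Bot \<or> p \<in> add_witness (insert p (henkin \<Gamma> (to_nat p))) p
       \<and> add_witness (insert p (henkin \<Gamma> (to_nat p))) p \<subseteq> D" for p
  proof (cases "insert p (henkin \<Gamma> (to_nat p)) \<turnstile> Bot")
    case True
    then show ?thesis by (auto simp: D_def elim!: weaken)
  next
    case False
    then have "henkin \<Gamma> (Suc (to_nat p)) = add_witness (insert p (henkin \<Gamma> (to_nat p))) p"
      by (simp add: Let_def)
    then show ?thesis using add_witness_cases[of "insert p (henkin \<Gamma> (to_nat p))" p]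
      unfolding D_def by blast
  qed
  have max: "p \<in> D" if "\<not> insert p D \<turnstile> Bot" for p using step that by blast
  have closed: "p \<in> D" if "D \<turnstile> p" for p using max that cons cut by blast
  show ?thesis
  proof
    show "\<Gamma> \<subseteq> D" unfolding D_def by (metis UN_upper UNIV_I henkin.simps(1))
    show "p \<in> D \<or> Neg p \<in> D" for p using max closed impI by blast
    show "\<exists>t. Neg (inst t q) \<in> D" if "Neg (All q) \<in> D" for q
    proof -
      have "\<not> insert (Neg (All q)) D \<turnstile> Bot" using that cons by (simp add: insert_absorb)
      then show ?thesis using step[of "Neg (All q)"] by auto
    qed
  qed (use cons closed in auto)
qed

section \<open>Satisfaction and the term model\<close>

fun sat :: "('a \<Rightarrow> 'a \<Rightarrow> bool) \<Rightarrow> ('a \<Rightarrow> 'a \<Rightarrow> bool) \<Rightarrow> (nat \<Rightarrow> 'a) \<Rightarrow> form \<Rightarrow> bool" where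
  "sat R Q e Bot \<longleftrightarrow> False"
| "sat R Q e (Mem i j) \<longleftrightarrow> R (e i) (e j)"
| "sat R Q e (Eq i j) \<longleftrightarrow> Q (e i) (e j)"
| "sat R Q e (Imp p q) \<longleftrightarrow> (sat R Q e p \<longrightarrow> sat R Q e q)"
| "sat R Q e (All p) \<longleftrightarrow> (\<forall>a. sat R Q (case_nat a e) p)"

lemma case_nat_comp_lift: "(\<lambda>i. case_nat a e (lift f i)) = case_nat a (\<lambda>i. e (f i))"
  by (auto simp: fun_eq_iff split: nat.split)

lemma sat_ren: "sat R Q e (ren f p) = sat R Q (\<lambda>i. e (f i)) p"
  by (induction p arbitrary: e f) (simp_all add: case_nat_comp_lift)

text \<open>Quantifiers transfer because every element has the form \<open>h x\<close>. This allows
  the congruence that interprets equality to be divided out.\<close>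

lemma sat_surj:
  assumes "surj h" "\<And>x y. R' (h x) (h y) = R x y" "\<And>x y. Q' (h x) (h y) = Q x y"
  shows "sat R' Q' (\<lambda>i. h (e i)) p = sat R Q e p"
proof (induction p arbitrary: e)
  case (All p)
  have "case_nat (h a) (\<lambda>i. h (e i)) = (\<lambda>i. h (case_nat a e i))" for a
    by (auto simp: fun_eq_iff split: nat.split)
  then have "sat R' Q' (case_nat (h a) (\<lambda>i. h (e i))) p = sat R Q (case_nat a e) p" for a
    using All by simp
  then show ?case using \<open>surj h\<close> by simp (metis surj_def)
qed (use assms in auto)

lemma sat_All_pow: "(\<And>e. sat R Q e ((All ^^ n) p)) \<Longrightarrow> sat R Q e p"
proof (induction n arbitrary: p e)
  case (Suc n)
  then have "sat R Q e' (All p)" for e' by (metis funpow_Suc_right comp_apply)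
  then have "sat R Q (case_nat (e 0) (\<lambda>i. e (Suc i))) p" by simp
  moreover have "case_nat (e 0) (\<lambda>i. e (Suc i)) = e" by (auto simp: fun_eq_iff split: nat.split)
  ultimately show ?case by simp
qed simp

text \<open>Variables are the only terms, so the carrier is \<open>nat\<close>. Equality is
  interpreted by the equations in the maximal set \<open>D\<close>, which form a congruence but not
  necessarily the identity.\<close>

lemma term_model:
  assumes "\<Union>(free_vars ` \<Gamma>) = {}" "\<not> \<Gamma> \<turnstile> Bot"
  obtains R Q :: "nat \<Rightarrow> nat \<Rightarrow> bool" where "equivp Q"
    "\<And>x x' y y'. Q x x' \<Longrightarrow> Q y y' \<Longrightarrow> R x y = R x' y'" "\<And>p e. p \<in> \<Gamma> \<Longrightarrow> sat R Q e p"
proof -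
  obtain D where D: "\<Gamma> \<subseteq> D" "\<not> D \<turnstile> Bot" "\<And>p. p \<in> D \<or> Neg p \<in> D" "\<And>p. D \<turnstile> p \<Longrightarrow> p \<in> D"
    "\<And>q. Neg (All q) \<in> D \<Longrightarrow> \<exists>t. Neg (inst t q) \<in> D"
    using henkin_set[OF assms] by blast
  define R where "R = (\<lambda>i j. Mem i j \<in> D)"
  define Q where "Q = (\<lambda>i j. Eq i j \<in> D)"
  have Neg: "Neg p \<in> D \<longleftrightarrow> p \<notin> D" for p using D(2,3) assm impE by blast
  have Imp: "Imp p q \<in> D \<longleftrightarrow> (p \<in> D \<longrightarrow> q \<in> D)" for p q
  proof
    assume "p \<in> D \<longrightarrow> q \<in> D"
    then consider "q \<in> D" | "Neg p \<in> D" using Neg by blast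
    then show "Imp p q \<in> D"
    proof cases
      case 1 then show ?thesis by (intro D(4) impI assm) auto
    next
      case 2
      have "insert (Neg q) (insert p D) \<turnstile> Bot" using 2 impE[of _ p Bot] by (simp add: assm)
      then show ?thesis using D(4) impI raa by blast
    qed
  qed (use D(4) assm impE in blast)
  have All: "All p \<in> D \<longleftrightarrow> (\<forall>t. inst t p \<in> D)" for p
    using D(4,5) Neg assm allE by metis
  have sat: "sat R Q e p \<longleftrightarrow> ren e p \<in> D" for e p
  proof (induction p arbitrary: e)
    case Bot then show ?case using D(2) assm by auto
  qed (simp_all add: R_def Q_def Imp All inst_ren_lift)
  have subst: "inst s p \<in> D \<Longrightarrow> inst t p \<in> D" if "Q s t" for s t p
    using that D(4) eqE[of D s t p] assm unfolding Q_def by metis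
  have refl: "Q x x" for x using D(4) eqI by (simp add: Q_def)
  \<comment> \<open>In the formulas given to \<open>subst\<close>, index 0 marks the place of the
    exchange; any other variable is written with a successor, which instantiation removes.\<close>
  have sym: "Q y x" if "Q x y" for x y
    using subst[OF that, of "Eq 0 (Suc x)"] refl[of x] by (simp add: inst_def Q_def)
  have trans: "Q x z" if "Q x y" "Q y z" for x y z
    using subst[OF that(2), of "Eq (Suc x) 0"] that by (simp add: inst_def Q_def)
  have R: "R x' y'" if "R x y" "Q x x'" "Q y y'" for x y x' y'
    using subst[OF that(2), of "Mem 0 (Suc y)"] subst[OF that(3), of "Mem (Suc x') 0"] that
    by (simp add: inst_def R_def)
  show ?thesis
  proof (rule that[of Q R])
    show "equivp Q" using refl sym trans by (intro equivpI reflpI sympI transpI) blast+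
    show "R x y = R x' y'" if "Q x x'" "Q y y'" for x y x' y' using that R sym by blast
    show "sat R Q e p" if "p \<in> \<Gamma>" for p e
    proof -
      have "ren e p = ren (\<lambda>i. i) p" using that assms(1) by (intro ren_cong) blast
      then show ?thesis using sat that D(1) ren_id by fastforce
    qed
  qed
qed

text \<open>The normal model has to live on the whole type \<open>nat\<close>, so the theory must not have finite models.\<close>

theorem completeness:
  assumes sent: "\<And>q. q \<in> \<Gamma> \<Longrightarrow> sentence q" "sentence p"
    and inf: "\<And>(R :: nat \<Rightarrow> nat \<Rightarrow> bool) Q. equivp Q \<Longrightarrow>
      (\<And>x x' y y'. Q x x' \<Longrightarrow> Q y y' \<Longrightarrow> R x y = R x' y') \<Longrightarrow>
      (\<And>q e. q \<in> \<Gamma> \<Longrightarrow> sat R Q e q) \<Longrightarrow> infinite (range (\<lambda>x. {y. Q x y}))"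
    and valid: "\<And>(R :: nat \<Rightarrow> nat \<Rightarrow> bool) e. (\<And>q e. q \<in> \<Gamma> \<Longrightarrow> sat R (=) e q) \<Longrightarrow> sat R (=) e p"
  shows "\<Gamma> \<turnstile> p"
proof (rule ccontr)
  assume "\<not> \<Gamma> \<turnstile> p"
  then have cons: "\<not> insert (Neg p) \<Gamma> \<turnstile> Bot" using raa by blast
  have closed: "\<Union>(free_vars ` insert (Neg p) \<Gamma>) = {}"
    using sent by (auto simp: sentence_def)
  show False
  proof (rule term_model[OF closed cons])
    fix R Q :: "nat \<Rightarrow> nat \<Rightarrow> bool"
    assume Q: "equivp Q"
      and R: "\<And>x x' y y'. Q x x' \<Longrightarrow> Q y y' \<Longrightarrow> R x y = R x' y'"
      and sat: "\<And>q e. q \<in> insert (Neg p) \<Gamma> \<Longrightarrow> sat R Q e q"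
    define C where "C = range (\<lambda>x. {y. Q x y})"
    have "infinite C" unfolding C_def by (rule inf[of Q R, OF Q R sat]) auto
    then have bij: "bij_betw (to_nat_on C) C UNIV"
      by (intro to_nat_on_infinite) (auto simp: C_def)
    define h where "h x = to_nat_on C {y. Q x y}" for x
    have h: "h x = h y \<longleftrightarrow> Q x y" for x y
    proof -
      have "h x = h y \<longleftrightarrow> {z. Q x z} = {z. Q y z}"
        unfolding h_def by (rule inj_on_eq_iff[OF bij_betw_imp_inj_on[OF bij]]) (simp_all add: C_def)
      moreover have "Q x = Q y \<longleftrightarrow> Q x y" using Q unfolding equivp_def by blast
      ultimately show ?thesis by (metis Collect_inj)
    qed
    have "surj h" using bij unfolding bij_betw_def h_def C_def by (auto simp: image_image)
    define R' where "R' a b = R (inv h a) (inv h b)" for a b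
    have inv: "Q (inv h (h x)) x" for x
      using h \<open>surj h\<close> by (metis surj_f_inv_f)
    have R': "R' (h x) (h y) = R x y" for x y
      unfolding R'_def using R inv by blast
    have transfer: "sat R' (=) e q = sat R Q (inv h \<circ> e) q" for e q
    proof -
      have "(\<lambda>i. h ((inv h \<circ> e) i)) = e" using \<open>surj h\<close> by (simp add: surj_f_inv_f fun_eq_iff)
      then show ?thesis using sat_surj[of h R' R "(=)" Q "inv h \<circ> e" q, OF \<open>surj h\<close> R' h] by metis
    qed
    have "sat R' (=) e p" for e by (rule valid) (use transfer sat in auto)
    then show False using transfer sat[of "Neg p"] by auto
  qed
qed

section \<open>Semantics of the formula notation\<close>

text \<open>The value at depth \<open>d\<close> of the variable with level \<open>x\<close>: levels
  count quantifiers from outside, the environment from inside. The side conditions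
  \<open>x < d\<close> in later rules say that the level is already bound.\<close>

definition look :: "(nat \<Rightarrow> 'a) \<Rightarrow> nat \<Rightarrow> nat \<Rightarrow> 'a" where
  "look e d x = e (d - Suc x)"

lemma look_new [simp]: "look (case_nat a e) (Suc d) d = a"
  by (simp add: look_def)

lemma look_old [simp]: "x < d \<Longrightarrow> look (case_nat a e) (Suc d) x = look e d x"
  by (cases "d - x") (auto simp: look_def, metis Suc_diff_Suc diff_Suc_Suc nat.inject)

lemma sat_fm [simp]:
  "sat R Q e ((x \<^bold>\<in> y) d) \<longleftrightarrow> R (look e d x) (look e d y)"
  "sat R Q e ((x \<^bold>= y) d) \<longleftrightarrow> Q (look e d x) (look e d y)"
  "sat R Q e ((\<^bold>\<not> A) d) \<longleftrightarrow> \<not> sat R Q e (A d)"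
  "sat R Q e ((A \<^bold>\<and> B) d) \<longleftrightarrow> sat R Q e (A d) \<and> sat R Q e (B d)"
  "sat R Q e ((A \<^bold>\<or> B) d) \<longleftrightarrow> sat R Q e (A d) \<or> sat R Q e (B d)"
  "sat R Q e ((A \<^bold>\<longrightarrow> B) d) \<longleftrightarrow> (sat R Q e (A d) \<longrightarrow> sat R Q e (B d))"
  "sat R Q e ((A \<^bold>\<longleftrightarrow> B) d) \<longleftrightarrow> (sat R Q e (A d) \<longleftrightarrow> sat R Q e (B d))"
  "sat R Q e (fm_all F d) \<longleftrightarrow> (\<forall>a. sat R Q (case_nat a e) (F d (Suc d)))"
  "sat R Q e (fm_ex F d) \<longleftrightarrow> (\<exists>a. sat R Q (case_nat a e) (F d (Suc d)))"
  by (auto simp: look_def fm_mem_def fm_eq_def fm_not_def fm_and_def fm_or_def fm_imp_def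
      fm_iff_def fm_all_def fm_ex_def)

lemma sat_derived:
  "sat R Q e (Iff p q) \<longleftrightarrow> (sat R Q e p \<longleftrightarrow> sat R Q e q)"
  "sat R Q e (Ex p) \<longleftrightarrow> (\<exists>a. sat R Q (case_nat a e) p)"
  by auto

lemma sat_separation:
  "sat R Q e (separation \<phi>) \<longleftrightarrow>
     (\<forall>a. \<exists>b. \<forall>x. R x b \<longleftrightarrow> R x a \<and> sat R Q (case_nat x (case_nat a e)) \<phi>)"
  unfolding separation_def sat.simps(5) sat_derived(2) sat_derived(1)
  by (simp add: sat_ren case_nat_comp_lift)

lemmas fm_defs = fm_mem_def fm_eq_def fm_not_def fm_and_def fm_or_def fm_imp_def fm_iff_def
  fm_all_def fm_ex_def

section \<open>ZF: a set of sentences without finite models\<close>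

lemma sentence_ZF:
  assumes "q \<in> ZF"
  shows "sentence q"
proof -
  have "free_vars (closed_form extensionality) = {}"
    by (simp add: closed_form_def extensionality_def fm_defs)
  moreover have "free_vars (closed_form foundation) = {}"
    by (simp add: closed_form_def foundation_def fm_defs)
  moreover have "free_vars (closed_form pairing) = {}"
    by (simp add: closed_form_def pairing_def is_upair_def fm_defs)
  moreover have "free_vars (closed_form union_of_sets) = {}"
    by (simp add: closed_form_def union_of_sets_def is_union_def fm_defs)
  moreover have "free_vars (closed_form power_set) = {}"
    by (simp add: closed_form_def power_set_def is_power_def is_subset_def fm_defs)
  moreover have "free_vars (closed_form infinity) = {}"
    by (simp add: closed_form_def infinity_def is_inductive_def is_empty_def is_succ_def fm_defs)
  ultimately show ?thesis
    using assms by (auto simp: ZF_def closures_def sentence_def)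
qed

text \<open>Schemes enter ZF only through closed universal closures. Such a closure exists as a
  formula has finitely many free variables, and its leading quantifiers can be stripped.\<close>

lemma sat_closures:
  assumes "\<And>q e. q \<in> closures p \<Longrightarrow> sat R Q e q"
  shows "sat R Q e p"
proof -
  obtain n where "(All ^^ n) p \<in> closures p" using ex_closure by (auto simp: closures_def)
  then show ?thesis using assms sat_All_pow by blast
qed

text \<open>For any finitely many elements some set contains them all, and Russell's paradox
  produces an element different from them.\<close>

lemma ZF_models_infinite:
  fixes R Q :: "'a \<Rightarrow> 'a \<Rightarrow> bool"
  assumes Q: "equivp Q" and R: "\<And>x x' y y'. Q x x' \<Longrightarrow> Q y y' \<Longrightarrow> R x y = R x' y'"
    and sat: "\<And>q e. q \<in> ZF \<Longrightarrow> sat R Q e q"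
  shows "infinite (range (\<lambda>x. {y. Q x y}))"
proof
  assume fin: "finite (range (\<lambda>x. {y. Q x y}))"
  have refl: "Q x x" for x using Q by (rule equivp_reflp)
  have "sat R Q (\<lambda>_. undefined) (closed_form pairing)"
    "sat R Q (\<lambda>_. undefined) (closed_form union_of_sets)" by (rule sat; simp add: ZF_def)+
  then have pair: "\<exists>p. \<forall>z. R z p \<longleftrightarrow> Q z x \<or> Q z y"
    and union: "\<exists>u. \<forall>x. R x u \<longleftrightarrow> (\<exists>y. R y F \<and> R x y)" for x y F
    by (simp_all add: closed_form_def pairing_def is_upair_def union_of_sets_def is_union_def)
  have "sat R Q (\<lambda>_. undefined) (separation (Neg (Mem 0 0)))"
    by (rule sat_closures, rule sat) (auto simp: ZF_def)
  then have russell: "\<exists>b. \<forall>x. R x b \<longleftrightarrow> R x a \<and> \<not> R x x" for a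
    by (simp add: sat_separation)
  have upper: "\<exists>u. \<forall>x\<in>S. R x u" if "finite S" for S
    using that
  proof induction
    case (insert x S)
    then obtain u where u: "\<forall>x\<in>S. R x u" by blast
    obtain s where s: "\<forall>z. R z s \<longleftrightarrow> Q z x \<or> Q z x" using pair by blast
    obtain p where p: "\<forall>z. R z p \<longleftrightarrow> Q z u \<or> Q z s" using pair by blast
    obtain v where v: "\<forall>x. R x v \<longleftrightarrow> (\<exists>y. R y p \<and> R x y)" using union by blast
    have "R y v" if "y \<in> insert x S" for y using that u s p v refl by blast
    then show ?case by blast
  qed simp
  obtain S where S: "finite S" "range (\<lambda>x. {y. Q x y}) = (\<lambda>x. {y. Q x y}) ` S"
    using finite_subset_image[OF fin order_refl] by blast
  obtain u where u: "\<forall>x\<in>S. R x u" using upper[OF S(1)] by blast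
  obtain r where r: "\<forall>x. R x r \<longleftrightarrow> R x u \<and> \<not> R x x" using russell by blast
  have "{y. Q r y} \<in> (\<lambda>x. {y. Q x y}) ` S" using S(2) by blast
  then obtain x where x: "x \<in> S" "{y. Q r y} = {y. Q x y}" by blast
  then have "Q x r" using refl by blast
  then have "R r u" using R[OF _ refl] u x(1) by blast
  then show False using r by blast
qed

section \<open>Definable predicates and functions of a structure\<close>

text \<open>\<open>mix e c\<close> holds variables at even and parameters at odd positions.\<close>

definition mix :: "(nat \<Rightarrow> 'a) \<Rightarrow> (nat \<Rightarrow> 'a) \<Rightarrow> nat \<Rightarrow> 'a" where
  "mix e c i = (if even i then e (i div 2) else c (i div 2))"

lemma mix_eqI: "(\<And>k. f (2 * k) = e k) \<Longrightarrow> (\<And>k. f (Suc (2 * k)) = c k) \<Longrightarrow> f = mix e c"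
  by (rule ext, rename_tac i, case_tac "even i") (auto simp: mix_def elim!: oddE evenE)

lemma mix_simps [simp]: "mix e c (2 * k) = e k" "mix e c (Suc (2 * k)) = c k"
  by (simp_all add: mix_def)

locale mem_structure =
  fixes E :: "'a \<Rightarrow> 'a \<Rightarrow> bool" (infix "\<epsilon>" 50)
begin

text \<open>Definability with parameters in the environment style of \<open>sat\<close>: a predicate
  of any arity takes a sequence, and under a binder it becomes
  \<open>Q (\<lambda>i. e (Suc i)) (e 0)\<close>. The rules \<open>dfn_intros\<close> thus follow
  the shape of a predicate, and no formula has to be written down.\<close>

definition dfn :: "((nat \<Rightarrow> 'a) \<Rightarrow> bool) \<Rightarrow> bool" where
  "dfn P \<longleftrightarrow> (\<exists>\<phi> c. \<forall>e. P e \<longleftrightarrow> sat (\<epsilon>) (=) (mix e c) \<phi>)"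

definition dfun :: "((nat \<Rightarrow> 'a) \<Rightarrow> 'a) \<Rightarrow> bool" where
  "dfun s \<longleftrightarrow> dfn (\<lambda>e. e 0 = s (\<lambda>i. e (Suc i)))"

named_theorems dfn_intros

lemma dfnI: "(\<And>e. P e \<longleftrightarrow> sat (\<epsilon>) (=) (mix e c) \<phi>) \<Longrightarrow> dfn P"
  by (auto simp: dfn_def)

lemma dfnE:
  assumes "dfn P"
  obtains \<phi> c where "\<And>e. P e \<longleftrightarrow> sat (\<epsilon>) (=) (mix e c) \<phi>"
  using assms by (auto simp: dfn_def)

lemma dfn_cong:
  assumes "dfn P" "\<And>e. P e = Q e"
  shows "dfn Q"
  using assms by (simp add: dfn_def)

lemma dfn_const [dfn_intros]: "dfn (\<lambda>e. B)"
  by (rule dfnI[where \<phi> = "if B then Imp Bot Bot else Bot"]) simp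

lemma dfn_imp [dfn_intros]:
  assumes "dfn P" "dfn Q"
  shows "dfn (\<lambda>e. P e \<longrightarrow> Q e)"
proof -
  obtain p c where p: "\<And>e. P e \<longleftrightarrow> sat (\<epsilon>) (=) (mix e c) p" using assms(1) dfnE by blast
  obtain q d where q: "\<And>e. Q e \<longleftrightarrow> sat (\<epsilon>) (=) (mix e d) q" using assms(2) dfnE by blast
  \<comment> \<open>The two parameter sequences are interleaved. Parameter \<open>k\<close> sits at
    \<open>i = 2k + 1\<close> in its own formula and moves to \<open>4k + 1 = 2i - 1\<close> or
    \<open>4k + 3 = 2i + 1\<close>.\<close>
  have "(\<lambda>i. mix e (mix c d) (if even i then i else 2 * i - 1)) = mix e c"
    "(\<lambda>i. mix e (mix c d) (if even i then i else 2 * i + 1)) = mix e d" for e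
    by (intro mix_eqI; simp add: mix_def)+
  then show ?thesis
    by (intro dfnI[where c = "mix c d" and \<phi> = "Imp (ren (\<lambda>i. if even i then i else 2 * i - 1) p)
        (ren (\<lambda>i. if even i then i else 2 * i + 1) q)"]) (simp add: sat_ren p q)
qed

lemma dfn_not [dfn_intros]: "dfn P \<Longrightarrow> dfn (\<lambda>e. \<not> P e)"
  using dfn_imp[of P "\<lambda>_. False"] dfn_const by simp

lemma dfn_and [dfn_intros]: "dfn P \<Longrightarrow> dfn Q \<Longrightarrow> dfn (\<lambda>e. P e \<and> Q e)"
  by (rule dfn_cong[of "\<lambda>e. \<not> (P e \<longrightarrow> \<not> Q e)"], intro dfn_not dfn_imp) auto

lemma dfn_or [dfn_intros]: "dfn P \<Longrightarrow> dfn Q \<Longrightarrow> dfn (\<lambda>e. P e \<or> Q e)"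
  by (rule dfn_cong[of "\<lambda>e. \<not> P e \<longrightarrow> Q e"], intro dfn_not dfn_imp) auto

lemma dfn_iff [dfn_intros]: "dfn P \<Longrightarrow> dfn Q \<Longrightarrow> dfn (\<lambda>e. P e \<longleftrightarrow> Q e)"
  by (rule dfn_cong[of "\<lambda>e. (P e \<longrightarrow> Q e) \<and> (Q e \<longrightarrow> P e)"], intro dfn_and dfn_imp) auto

lemma dfn_all [dfn_intros]:
  assumes "dfn (\<lambda>e. Q (\<lambda>i. e (Suc i)) (e 0))"
  shows "dfn (\<lambda>e. \<forall>x. Q e x)"
proof -
  obtain p c where p: "\<And>e. Q (\<lambda>i. e (Suc i)) (e 0) \<longleftrightarrow> sat (\<epsilon>) (=) (mix e c) p"
    using assms dfnE by blast
  \<comment> \<open>The quantifier takes index 0 and pushes the mixed environment up by one.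
    Argument \<open>k + 1\<close> of the body, at position \<open>2k + 2\<close>, is argument
    \<open>k\<close> outside, now found at \<open>2k + 1\<close>; parameters move from
    \<open>i\<close> to \<open>i + 1\<close>.\<close>
  have "(\<lambda>i. case_nat x (mix e c) (if i = 0 then 0 else if even i then i - 1 else i + 1))
    = mix (case_nat x e) c" for x e
    by (rule mix_eqI; rename_tac k; case_tac k) (simp_all add: mix_def)
  moreover have "Q e x \<longleftrightarrow> sat (\<epsilon>) (=) (mix (case_nat x e) c) p" for e x
    using p[of "case_nat x e"] by simp
  ultimately show ?thesis
    by (intro dfnI[where c = c and
        \<phi> = "All (ren (\<lambda>i. if i = 0 then 0 else if even i then i - 1 else i + 1) p)"])
      (simp add: sat_ren)
qed

lemma dfn_ex [dfn_intros]: "dfn (\<lambda>e. Q (\<lambda>i. e (Suc i)) (e 0)) \<Longrightarrow> dfn (\<lambda>e. \<exists>x. Q e x)"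
  by (rule dfn_cong[of "\<lambda>e. \<not> (\<forall>x. \<not> Q e x)"], intro dfn_not dfn_all) auto

lemma dfn_subst:
  assumes "dfn P"
  shows "dfn (\<lambda>e. P (\<lambda>i. if A i then e (f i) else d i))"
proof -
  obtain p c where p: "\<And>e. P e \<longleftrightarrow> sat (\<epsilon>) (=) (mix e c) p" using assms(1) dfnE by blast
  \<comment> \<open>Fixed arguments and old parameters are both read from the new parameter sequence
    \<open>mix d c\<close>, whose entry \<open>i\<close> is found at \<open>2i + 1\<close>.\<close>
  define g where "g = (\<lambda>i. if even i then if A (i div 2) then 2 * f (i div 2) else 2 * i + 1
    else 2 * i + 1)"
  have "(\<lambda>i. mix e (mix d c) (g i)) = mix (\<lambda>i. if A i then e (f i) else d i) c" for e
    by (rule mix_eqI) (simp_all add: g_def mix_def)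
  then show ?thesis
    by (intro dfnI[where c = "mix d c" and \<phi> = "ren g p"]) (simp add: sat_ren p)
qed

lemma dfn_rename: "dfn P \<Longrightarrow> dfn (\<lambda>e. P (\<lambda>i. e (f i)))"
  using dfn_subst[of P "\<lambda>_. True"] by simp

lemma dfn_param:
  assumes "dfn (\<lambda>e. Q (\<lambda>i. e (Suc i)) (e 0))"
  shows "dfn (\<lambda>e. Q d (e 0))"
  using dfn_subst[OF assms, of "\<lambda>i. i = 0" "\<lambda>i. i" "case_nat undefined d"] by simp

lemma dfn_mem_var: "dfn (\<lambda>e. e i \<epsilon> e j)"
  by (rule dfnI[where \<phi> = "Mem (2 * i) (2 * j)"]) (simp add: mix_def)

lemma dfn_eq_var: "dfn (\<lambda>e. e i = e j)"
  by (rule dfnI[where \<phi> = "Eq (2 * i) (2 * j)"]) (simp add: mix_def)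

lemma dfun_var [dfn_intros]: "dfun (\<lambda>e. e i)"
  unfolding dfun_def by (rule dfn_eq_var)

lemma dfun_const [dfn_intros]: "dfun (\<lambda>e. c)"
  unfolding dfun_def
  using dfn_subst[OF dfn_eq_var[of 0 1], of "\<lambda>i. i = 0" "\<lambda>i. i" "\<lambda>_. c"] by simp

lemma dfun_rename: "dfun s \<Longrightarrow> dfun (\<lambda>e. s (\<lambda>i. e (f i)))"
  unfolding dfun_def using dfn_rename[of _ "case_nat 0 (\<lambda>i. Suc (f i))"] by fastforce

lemma dfn_bind:
  assumes "dfun s" "dfn (\<lambda>e. Q (\<lambda>i. e (Suc i)) (e 0))"
  shows "dfn (\<lambda>e. Q e (s e))"
proof -
  have "dfn (\<lambda>e. \<exists>x. x = s e \<and> Q e x)"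
    using assms by (intro dfn_ex dfn_and) (simp_all add: dfun_def)
  then show ?thesis by simp
qed

lemma dfn_app1:
  assumes "dfn (\<lambda>e. P (e 0))" "dfun s"
  shows "dfn (\<lambda>e. P (s e))"
  by (rule dfn_bind[OF assms(2)]) (rule assms(1))

lemma dfn_app2:
  assumes "dfn (\<lambda>e. R (e 0) (e (Suc 0)))" "dfun s" "dfun t"
  shows "dfn (\<lambda>e. R (s e) (t e))"
  \<comment> \<open>The value bound last becomes index 0, hence the exchange of the two
    indices.\<close>
  by (rule dfn_bind[OF assms(2)], rule dfn_bind[OF dfun_rename[OF assms(3)]])
    (use dfn_rename[OF assms(1), of "\<lambda>i. if i = 0 then Suc 0 else 0"] in simp)

lemma dfn_app3:
  assumes "dfn (\<lambda>e. R (e 0) (e (Suc 0)) (e (Suc (Suc 0))))" "dfun s" "dfun t" "dfun u"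
  shows "dfn (\<lambda>e. R (s e) (t e) (u e))"
  by (rule dfn_bind[OF assms(2)], rule dfn_bind[OF dfun_rename[OF assms(3)]],
      rule dfn_bind[OF dfun_rename[OF assms(4)]])
    (use dfn_rename[OF assms(1), of "\<lambda>i. if i = 0 then Suc (Suc 0) else if i = 1 then 1 else 0"]
      in simp)

lemma dfun_app1:
  assumes "dfun (\<lambda>e. f (e 0))" "dfun s"
  shows "dfun (\<lambda>e. f (s e))"
  unfolding dfun_def
  by (rule dfn_app2[where R = "\<lambda>x y. x = f y", OF assms(1)[unfolded dfun_def] dfun_var dfun_rename[OF assms(2)]])

lemma dfun_app2:
  assumes "dfun (\<lambda>e. f (e 0) (e (Suc 0)))" "dfun s" "dfun t"
  shows "dfun (\<lambda>e. f (s e) (t e))"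
  unfolding dfun_def
  by (rule dfn_app3[where R = "\<lambda>x y z. x = f y z", OF assms(1)[unfolded dfun_def] dfun_var
        dfun_rename[OF assms(2)] dfun_rename[OF assms(3)]])

lemma dfn_mem [dfn_intros]: "dfun s \<Longrightarrow> dfun t \<Longrightarrow> dfn (\<lambda>e. s e \<epsilon> t e)"
  by (rule dfn_app2[where R = "(\<epsilon>)", OF dfn_mem_var])

lemma dfn_eq [dfn_intros]: "dfun s \<Longrightarrow> dfun t \<Longrightarrow> dfn (\<lambda>e. s e = t e)"
  by (rule dfn_app2[where R = "(=)", OF dfn_eq_var])

end

section \<open>Set theory inside a model\<close>

locale zf_model = mem_structure +
  assumes ZF: "\<And>q e. q \<in> ZF \<Longrightarrow> sat (\<epsilon>) (=) e q"
begin

lemma extensionality: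
  assumes "\<And>z. z \<epsilon> x \<longleftrightarrow> z \<epsilon> y"
  shows "x = y"
proof -
  have "sat (\<epsilon>) (=) (\<lambda>_. undefined) (closed_form extensionality)"
    by (rule ZF) (simp add: ZF_def)
  then show ?thesis using assms by (simp add: closed_form_def extensionality_def)
qed

lemma separation:
  assumes "dfn (\<lambda>e. P (e 0))"
  shows "\<exists>b. \<forall>x. x \<epsilon> b \<longleftrightarrow> x \<epsilon> a \<and> P x"
proof -
  obtain \<phi> c where p: "\<And>e. P (e 0) \<longleftrightarrow> sat (\<epsilon>) (=) (mix e c) \<phi>" using assms dfnE by blast
  \<comment> \<open>In the axiom index 0 is the element \<open>x\<close>, index 1 the set
    \<open>a\<close>, and \<open>k + 2\<close> the parameter \<open>c k\<close>. All argument
    positions go to 0, since \<open>P\<close> looks at one argument.\<close>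
  define f where "f i = (if even i then 0 else Suc (Suc (i div 2)))" for i :: nat
  have "(\<lambda>i. case_nat x (case_nat a c) (f i)) = mix (\<lambda>_. x) c" for x
    by (rule mix_eqI) (simp_all add: f_def)
  then have "sat (\<epsilon>) (=) (case_nat x (case_nat a c)) (ren f \<phi>) \<longleftrightarrow> P x" for x
    using p[of "\<lambda>_. x"] by (simp add: sat_ren)
  moreover have "sat (\<epsilon>) (=) c (separation (ren f \<phi>))"
    by (rule sat_closures, rule ZF) (auto simp: ZF_def)
  ultimately show ?thesis unfolding sat_separation by metis
qed

definition coll :: "('a \<Rightarrow> bool) \<Rightarrow> 'a" where
  "coll P = (THE b. \<forall>x. x \<epsilon> b \<longleftrightarrow> P x)"

lemma coll_eq:
  assumes "\<exists>b. \<forall>x. x \<epsilon> b \<longleftrightarrow> P x"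
  shows "a = coll P \<longleftrightarrow> (\<forall>x. x \<epsilon> a \<longleftrightarrow> P x)"
proof -
  have "\<exists>!b. \<forall>x. x \<epsilon> b \<longleftrightarrow> P x" using assms extensionality by blast
  then have "\<forall>x. x \<epsilon> coll P \<longleftrightarrow> P x" unfolding coll_def by (rule theI')
  then show ?thesis using extensionality by blast
qed

lemma mem_coll: "\<exists>b. \<forall>x. x \<epsilon> b \<longleftrightarrow> P x \<Longrightarrow> x \<epsilon> coll P \<longleftrightarrow> P x"
  using coll_eq by blast

text \<open>Once the set exists, \<open>a = coll (Q e)\<close> only says that \<open>a\<close> has
  exactly the elements satisfying \<open>Q e\<close>, which is definable if \<open>Q\<close>
  is.\<close>

lemma dfun_coll:
  assumes "\<And>e. \<exists>b. \<forall>x. x \<epsilon> b \<longleftrightarrow> Q e x" "dfn (\<lambda>e. Q (\<lambda>i. e (Suc i)) (e 0))"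
  shows "dfun (\<lambda>e. coll (Q e))"
  unfolding dfun_def coll_eq[OF assms(1)]
  by (intro dfn_intros)
    (use dfn_rename[OF assms(2), of "case_nat 0 (\<lambda>i. Suc (Suc i))"] in simp)

definition sep :: "'a \<Rightarrow> ('a \<Rightarrow> bool) \<Rightarrow> 'a" where
  "sep a P = coll (\<lambda>x. x \<epsilon> a \<and> P x)"

lemma mem_sep: "dfn (\<lambda>e. P (e 0)) \<Longrightarrow> x \<epsilon> sep a P \<longleftrightarrow> x \<epsilon> a \<and> P x"
  unfolding sep_def by (rule mem_coll) (rule separation)

lemma dfun_sep [dfn_intros]:
  assumes "dfun s" "dfn (\<lambda>e. Q (\<lambda>i. e (Suc i)) (e 0))"
  shows "dfun (\<lambda>e. sep (s e) (Q e))"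
  unfolding sep_def
proof (rule dfun_coll)
  show "\<exists>b. \<forall>x. x \<epsilon> b \<longleftrightarrow> x \<epsilon> s e \<and> Q e x" for e
    by (rule separation) (rule dfn_param[OF assms(2)])
  show "dfn (\<lambda>e. e 0 \<epsilon> s (\<lambda>i. e (Suc i)) \<and> Q (\<lambda>i. e (Suc i)) (e 0))"
    by (intro dfn_and dfn_mem dfun_var dfun_rename[OF assms(1)] assms(2))
qed

lemma separation_subset:
  assumes "dfn (\<lambda>e. P (e 0))" "\<And>x. P x \<Longrightarrow> x \<epsilon> a"
  shows "\<exists>b. \<forall>x. x \<epsilon> b \<longleftrightarrow> P x"
  using separation[OF assms(1), of a] assms(2) by blast

section \<open>Pairs, unions, power sets and products\<close>

definition upair :: "'a \<Rightarrow> 'a \<Rightarrow> 'a" where "upair a b = coll (\<lambda>x. x = a \<or> x = b)"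
definition cup :: "'a \<Rightarrow> 'a" where "cup F = coll (\<lambda>x. \<exists>y. y \<epsilon> F \<and> x \<epsilon> y)"
definition sub :: "'a \<Rightarrow> 'a \<Rightarrow> bool" where "sub a b \<longleftrightarrow> (\<forall>z. z \<epsilon> a \<longrightarrow> z \<epsilon> b)"
definition pow :: "'a \<Rightarrow> 'a" where "pow a = coll (\<lambda>x. sub x a)"

lemma ex_upair: "\<exists>p. \<forall>z. z \<epsilon> p \<longleftrightarrow> z = x \<or> z = y"
proof -
  have "sat (\<epsilon>) (=) (\<lambda>_. undefined) (closed_form pairing)" by (rule ZF) (simp add: ZF_def)
  then show ?thesis by (simp add: closed_form_def pairing_def is_upair_def)
qed

lemma ex_cup: "\<exists>u. \<forall>x. x \<epsilon> u \<longleftrightarrow> (\<exists>y. y \<epsilon> F \<and> x \<epsilon> y)"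
proof -
  have "sat (\<epsilon>) (=) (\<lambda>_. undefined) (closed_form union_of_sets)" by (rule ZF) (simp add: ZF_def)
  then show ?thesis by (simp add: closed_form_def union_of_sets_def is_union_def)
qed

lemma ex_pow: "\<exists>p. \<forall>y. y \<epsilon> p \<longleftrightarrow> sub y x"
proof -
  have "sat (\<epsilon>) (=) (\<lambda>_. undefined) (closed_form power_set)" by (rule ZF) (simp add: ZF_def)
  then show ?thesis by (simp add: closed_form_def power_set_def is_power_def is_subset_def sub_def)
qed

lemma dfn_sub [dfn_intros]: "dfun s \<Longrightarrow> dfun t \<Longrightarrow> dfn (\<lambda>e. sub (s e) (t e))"
  by (rule dfn_app2[where R = sub]) (unfold sub_def, intro dfn_intros)

lemma upair_iff [simp]: "x \<epsilon> upair a b \<longleftrightarrow> x = a \<or> x = b"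
  unfolding upair_def by (rule mem_coll) (rule ex_upair)

lemma cup_iff: "x \<epsilon> cup F \<longleftrightarrow> (\<exists>y. y \<epsilon> F \<and> x \<epsilon> y)"
  unfolding cup_def by (rule mem_coll) (rule ex_cup)

lemma pow_iff [simp]: "x \<epsilon> pow a \<longleftrightarrow> sub x a"
  unfolding pow_def by (rule mem_coll) (rule ex_pow)

lemma dfun_upair [dfn_intros]: "dfun s \<Longrightarrow> dfun t \<Longrightarrow> dfun (\<lambda>e. upair (s e) (t e))"
  by (rule dfun_app2[where f = upair], unfold upair_def, rule dfun_coll, rule ex_upair) (intro dfn_intros)

lemma dfun_cup [dfn_intros]: "dfun s \<Longrightarrow> dfun (\<lambda>e. cup (s e))"
  by (rule dfun_app1[where f = cup], unfold cup_def, rule dfun_coll, rule ex_cup) (intro dfn_intros)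

lemma dfun_pow [dfn_intros]: "dfun s \<Longrightarrow> dfun (\<lambda>e. pow (s e))"
  by (rule dfun_app1[where f = pow], unfold pow_def, rule dfun_coll, rule ex_pow) (intro dfn_intros)

definition emp :: 'a where "emp = coll (\<lambda>x. False)"
definition pr :: "'a \<Rightarrow> 'a \<Rightarrow> 'a" where "pr a b = upair (upair a a) (upair a b)"
definition un :: "'a \<Rightarrow> 'a \<Rightarrow> 'a" where "un a b = cup (upair a b)"
definition ins :: "'a \<Rightarrow> 'a \<Rightarrow> 'a" where "ins x a = un a (upair x x)"
definition diff :: "'a \<Rightarrow> 'a \<Rightarrow> 'a" where "diff a b = sep a (\<lambda>x. \<not> x \<epsilon> b)"
definition prd :: "'a \<Rightarrow> 'a \<Rightarrow> 'a" where
  "prd A B = sep (pow (pow (un A B))) (\<lambda>p. \<exists>a b. a \<epsilon> A \<and> b \<epsilon> B \<and> p = pr a b)"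

abbreviation suc :: "'a \<Rightarrow> 'a" where "suc n \<equiv> ins n n"

lemma emp_iff [simp]: "\<not> x \<epsilon> emp"
  using mem_coll[of "\<lambda>_. False"] separation[of "\<lambda>_. False"] unfolding emp_def
  by (auto intro: dfn_const)

lemma eq_emp: "(\<And>x. \<not> x \<epsilon> a) \<Longrightarrow> a = emp"
  by (rule extensionality) simp

lemma un_iff [simp]: "x \<epsilon> un a b \<longleftrightarrow> x \<epsilon> a \<or> x \<epsilon> b"
  by (auto simp: un_def cup_iff)

lemma ins_iff [simp]: "y \<epsilon> ins x a \<longleftrightarrow> y \<epsilon> a \<or> y = x"
  by (simp add: ins_def)

lemma diff_iff [simp]: "x \<epsilon> diff a b \<longleftrightarrow> x \<epsilon> a \<and> \<not> x \<epsilon> b"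
  unfolding diff_def by (rule mem_sep) (intro dfn_intros)

lemma upair_eq: "upair a b = upair c d \<longleftrightarrow> a = c \<and> b = d \<or> a = d \<and> b = c"
proof
  assume "upair a b = upair c d"
  then have "x = a \<or> x = b \<longleftrightarrow> x = c \<or> x = d" for x by (metis upair_iff)
  then show "a = c \<and> b = d \<or> a = d \<and> b = c" by metis
qed (auto intro: extensionality)

lemma pr_eq [simp]: "pr a b = pr c d \<longleftrightarrow> a = c \<and> b = d"
  by (auto simp: pr_def upair_eq)

lemma dfun_pr [dfn_intros]: "dfun s \<Longrightarrow> dfun t \<Longrightarrow> dfun (\<lambda>e. pr (s e) (t e))"
  unfolding pr_def by (intro dfn_intros)

lemma dfun_un [dfn_intros]: "dfun s \<Longrightarrow> dfun t \<Longrightarrow> dfun (\<lambda>e. un (s e) (t e))"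
  unfolding un_def by (intro dfn_intros)

lemma dfun_ins [dfn_intros]: "dfun s \<Longrightarrow> dfun t \<Longrightarrow> dfun (\<lambda>e. ins (s e) (t e))"
  unfolding ins_def by (intro dfn_intros)

lemma dfun_diff [dfn_intros]: "dfun s \<Longrightarrow> dfun t \<Longrightarrow> dfun (\<lambda>e. diff (s e) (t e))"
  by (rule dfun_app2[where f = diff], unfold diff_def) (intro dfn_intros)

lemma dfun_prd [dfn_intros]: "dfun s \<Longrightarrow> dfun t \<Longrightarrow> dfun (\<lambda>e. prd (s e) (t e))"
  by (rule dfun_app2[where f = prd], unfold prd_def) (intro dfn_intros)

lemma prd_iff: "p \<epsilon> prd A B \<longleftrightarrow> (\<exists>a b. a \<epsilon> A \<and> b \<epsilon> B \<and> p = pr a b)"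
proof -
  have "p \<epsilon> prd A B \<longleftrightarrow> p \<epsilon> pow (pow (un A B)) \<and> (\<exists>a b. a \<epsilon> A \<and> b \<epsilon> B \<and> p = pr a b)"
    unfolding prd_def by (subst mem_sep) (intro dfn_intros, rule refl)
  then show ?thesis by (auto simp: pr_def sub_def)
qed

lemma pr_prd_iff [simp]: "pr a b \<epsilon> prd A B \<longleftrightarrow> a \<epsilon> A \<and> b \<epsilon> B"
  by (auto simp: prd_iff)

lemma sub_antisym: "sub a b \<Longrightarrow> sub b a \<Longrightarrow> a = b"
  by (rule extensionality) (auto simp: sub_def)


section \<open>Natural numbers of a model\<close>

definition indset :: "'a \<Rightarrow> bool" where
  "indset w \<longleftrightarrow> emp \<epsilon> w \<and> (\<forall>x. x \<epsilon> w \<longrightarrow> suc x \<epsilon> w)"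

definition om :: 'a where "om = coll (\<lambda>x. \<forall>u. indset u \<longrightarrow> x \<epsilon> u)"

lemma dfn_indset [dfn_intros]: "dfun s \<Longrightarrow> dfn (\<lambda>e. indset (s e))"
  by (rule dfn_app1[where P = indset], unfold indset_def) (intro dfn_intros)

lemma is_empty_iff [simp]: "x < d \<Longrightarrow> sat (\<epsilon>) (=) e (is_empty x d) \<longleftrightarrow> look e d x = emp"
  using eq_emp by (auto simp: is_empty_def)

lemma is_succ_iff [simp]:
  "x < d \<Longrightarrow> y < d \<Longrightarrow> sat (\<epsilon>) (=) e (is_succ y x d) \<longleftrightarrow> look e d y = suc (look e d x)"
  using extensionality[of "look e d y" "suc (look e d x)"] by (auto simp: is_succ_def)

lemma is_inductive_iff [simp]:
  "x < d \<Longrightarrow> sat (\<epsilon>) (=) e (is_inductive x d) \<longleftrightarrow> indset (look e d x)"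
  by (simp add: is_inductive_def indset_def)

lemma om_iff: "x \<epsilon> om \<longleftrightarrow> (\<forall>u. indset u \<longrightarrow> x \<epsilon> u)"
proof -
  have "sat (\<epsilon>) (=) (\<lambda>_. undefined) (closed_form infinity)" by (rule ZF) (simp add: ZF_def)
  then obtain w where "indset w" by (auto simp: closed_form_def infinity_def)
  then show ?thesis unfolding om_def
    by (intro mem_coll separation_subset[of _ w]) (intro dfn_intros, blast)
qed

lemma emp_om [simp]: "emp \<epsilon> om" and suc_om: "n \<epsilon> om \<Longrightarrow> suc n \<epsilon> om"
  by (auto simp: om_iff indset_def)

text \<open>Separation forms the set of numbers with property \<open>P\<close>; it is inductive and
  so contains \<open>om\<close>. For undefinable \<open>P\<close>, such as being a standard number,
  induction can fail.\<close>

lemma om_induct [consumes 1, case_names dfn emp suc]: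
  assumes "n \<epsilon> om" and d: "dfn (\<lambda>e. P (e 0))" and "P emp" "\<And>n. n \<epsilon> om \<Longrightarrow> P n \<Longrightarrow> P (suc n)"
  shows "P n"
proof -
  have "indset (sep om P)"
    using assms(3,4) by (auto simp: indset_def mem_sep[OF d] suc_om)
  then show ?thesis using assms(1) om_iff mem_sep[OF d] by blast
qed

lemma om_trans:
  assumes "n \<epsilon> om" "m \<epsilon> n" "k \<epsilon> m"
  shows "k \<epsilon> n"
proof -
  have "\<forall>m k. m \<epsilon> n \<longrightarrow> k \<epsilon> m \<longrightarrow> k \<epsilon> n"
    using assms(1) by (induction n rule: om_induct) (intro dfn_intros, auto)
  then show ?thesis using assms by blast
qed

lemma om_elem:
  assumes "n \<epsilon> om" "m \<epsilon> n"
  shows "m \<epsilon> om"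
proof -
  have "\<forall>m. m \<epsilon> n \<longrightarrow> m \<epsilon> om"
    using assms(1) by (induction n rule: om_induct) (intro dfn_intros, auto)
  then show ?thesis using assms by blast
qed

lemma om_irrefl: "n \<epsilon> om \<Longrightarrow> \<not> n \<epsilon> n"
proof (induction n rule: om_induct)
  case (suc n)
  then show ?case by (metis ins_iff om_trans)
qed (intro dfn_intros, simp)

lemma om_asym: "n \<epsilon> om \<Longrightarrow> m \<epsilon> n \<Longrightarrow> \<not> n \<epsilon> m"
  using om_trans om_irrefl by blast

lemma om_cases:
  assumes "n \<epsilon> om"
  obtains "n = emp" | m where "m \<epsilon> om" "n = suc m"
proof -
  have "n = emp \<or> (\<exists>m. m \<epsilon> om \<and> n = suc m)"
    using assms by (induction n rule: om_induct) (intro dfn_intros, auto)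
  then show ?thesis using that by blast
qed

lemma suc_eq_iff: "m \<epsilon> om \<Longrightarrow> n \<epsilon> om \<Longrightarrow> suc m = suc n \<longleftrightarrow> m = n"
  by (metis ins_iff om_asym)

lemma suc_neq_emp [simp]: "ins x a \<noteq> emp" "emp \<noteq> ins x a"
  by (metis emp_iff ins_iff)+

lemma emp_mem_suc: "n \<epsilon> om \<Longrightarrow> emp \<epsilon> suc n"
  by (induction n rule: om_induct) (intro dfn_intros, auto)

lemma suc_mem_suc:
  assumes "n \<epsilon> om" "m \<epsilon> n"
  shows "suc m \<epsilon> suc n"
proof -
  have "\<forall>m. m \<epsilon> n \<longrightarrow> suc m \<epsilon> suc n"
    using assms(1) by (induction n rule: om_induct) (intro dfn_intros, auto)
  then show ?thesis using assms by blast
qed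

lemma suc_mem_suc_iff: "m \<epsilon> om \<Longrightarrow> n \<epsilon> om \<Longrightarrow> suc m \<epsilon> suc n \<longleftrightarrow> m \<epsilon> n"
  by (metis ins_iff om_trans suc_mem_suc)

lemma om_linear:
  assumes "m \<epsilon> om" "n \<epsilon> om"
  shows "m \<epsilon> n \<or> m = n \<or> n \<epsilon> m"
  using assms
proof (induction m rule: om_induct)
  case dfn then show ?case by (intro dfn_intros)
next
  case emp then show ?case by (metis emp_mem_suc om_cases ins_iff)
next
  case (suc m) then show ?case by (metis ins_iff suc_mem_suc)
qed

lemma om_strong_induct:
  assumes "n \<epsilon> om" and d: "dfn (\<lambda>e. P (e 0))"
    and step: "\<And>n. n \<epsilon> om \<Longrightarrow> (\<And>m. m \<epsilon> n \<Longrightarrow> P m) \<Longrightarrow> P n"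
  shows "P n"
proof -
  have "\<forall>m. m \<epsilon> n \<longrightarrow> P m" using assms(1)
  proof (induction n rule: om_induct)
    case dfn show ?case by (intro dfn_intros dfn_app1[of P, OF d])
  qed (use step in auto)
  then show ?thesis using step assms(1) by blast
qed

lemma om_least:
  assumes "n \<epsilon> om" "P n" and d: "dfn (\<lambda>e. P (e 0))"
  obtains m where "m \<epsilon> om" "P m" "\<And>k. k \<epsilon> m \<Longrightarrow> \<not> P k"
proof (rule ccontr)
  assume "\<not> thesis"
  then have no: "\<not> (m \<epsilon> om \<and> P m \<and> (\<forall>k. k \<epsilon> m \<longrightarrow> \<not> P k))" for m using that by blast
  have "\<not> P n"
    by (rule om_strong_induct[OF assms(1), of "\<lambda>n. \<not> P n"]) (intro dfn_intros d, use no in blast)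
  then show False using assms by blast
qed


section \<open>Relations, functions and finite sets of a model\<close>

definition app :: "'a \<Rightarrow> 'a \<Rightarrow> 'a \<Rightarrow> bool" where "app f x y \<longleftrightarrow> pr x y \<epsilon> f"

definition isfun :: "'a \<Rightarrow> 'a \<Rightarrow> 'a \<Rightarrow> bool" where
  "isfun f A B \<longleftrightarrow> sub f (prd A B) \<and>
     (\<forall>x. x \<epsilon> A \<longrightarrow> (\<exists>y. app f x y \<and> (\<forall>z. app f x z \<longrightarrow> z = y)))"

definition isinj :: "'a \<Rightarrow> 'a \<Rightarrow> 'a \<Rightarrow> bool" where
  "isinj f A B \<longleftrightarrow> isfun f A B \<and> (\<forall>x x' y. app f x y \<and> app f x' y \<longrightarrow> x = x')"

definition isbij :: "'a \<Rightarrow> 'a \<Rightarrow> 'a \<Rightarrow> bool" where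
  "isbij f A B \<longleftrightarrow> isinj f A B \<and> (\<forall>y. y \<epsilon> B \<longrightarrow> (\<exists>x. app f x y))"

definition fin :: "'a \<Rightarrow> bool" where "fin A \<longleftrightarrow> (\<exists>n f. n \<epsilon> om \<and> isbij f n A)"

lemma dfn_app [dfn_intros]:
  "dfun f \<Longrightarrow> dfun s \<Longrightarrow> dfun t \<Longrightarrow> dfn (\<lambda>e. app (f e) (s e) (t e))"
  unfolding app_def by (intro dfn_intros)

lemma dfn_isfun [dfn_intros]:
  "dfun f \<Longrightarrow> dfun s \<Longrightarrow> dfun t \<Longrightarrow> dfn (\<lambda>e. isfun (f e) (s e) (t e))"
  by (rule dfn_app3[where R = isfun], unfold isfun_def) (intro dfn_intros)

lemma dfn_isinj [dfn_intros]:
  "dfun f \<Longrightarrow> dfun s \<Longrightarrow> dfun t \<Longrightarrow> dfn (\<lambda>e. isinj (f e) (s e) (t e))"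
  by (rule dfn_app3[where R = isinj], unfold isinj_def) (intro dfn_intros)

lemma dfn_isbij [dfn_intros]:
  "dfun f \<Longrightarrow> dfun s \<Longrightarrow> dfun t \<Longrightarrow> dfn (\<lambda>e. isbij (f e) (s e) (t e))"
  by (rule dfn_app3[where R = isbij], unfold isbij_def) (intro dfn_intros)

lemma dfn_fin [dfn_intros]: "dfun s \<Longrightarrow> dfn (\<lambda>e. fin (s e))"
  by (rule dfn_app1[where P = fin], unfold fin_def) (intro dfn_intros)

lemma app_emp [simp]: "\<not> app emp x y"
  by (simp add: app_def)

lemma app_ins [simp]: "app (ins (pr a b) f) x y \<longleftrightarrow> app f x y \<or> x = a \<and> y = b"
  by (auto simp: app_def)

lemma sub_prd: "sub f (prd A B) \<longleftrightarrow>
    (\<forall>p. p \<epsilon> f \<longrightarrow> (\<exists>x y. x \<epsilon> A \<and> y \<epsilon> B \<and> p = pr x y))"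
  by (auto simp: sub_def prd_iff)

lemma isfun_dom: "isfun f A B \<Longrightarrow> app f x y \<Longrightarrow> x \<epsilon> A \<and> y \<epsilon> B"
  by (auto simp: isfun_def sub_def app_def)

lemma isfun_unique: "isfun f A B \<Longrightarrow> app f x y \<Longrightarrow> app f x z \<Longrightarrow> y = z"
  using isfun_dom by (metis isfun_def)

lemma isfun_total: "isfun f A B \<Longrightarrow> x \<epsilon> A \<Longrightarrow> \<exists>y. app f x y"
  by (auto simp: isfun_def)

lemma isfunI:
  assumes "sub f (prd A B)" "\<And>x. x \<epsilon> A \<Longrightarrow> \<exists>y. app f x y"
    "\<And>x y z. app f x y \<Longrightarrow> app f x z \<Longrightarrow> y = z"
  shows "isfun f A B"
  using assms unfolding isfun_def by blast

lemma isinj_unique: "isinj f A B \<Longrightarrow> app f x y \<Longrightarrow> app f x' y \<Longrightarrow> x = x'"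
  by (auto simp: isinj_def)

definition restr :: "'a \<Rightarrow> 'a \<Rightarrow> 'a" where
  "restr f A = sep f (\<lambda>p. \<exists>x y. p = pr x y \<and> x \<epsilon> A)"

lemma dfun_restr [dfn_intros]: "dfun s \<Longrightarrow> dfun t \<Longrightarrow> dfun (\<lambda>e. restr (s e) (t e))"
  by (rule dfun_app2[where f = restr], unfold restr_def) (intro dfn_intros)

lemma mem_restr: "p \<epsilon> restr f A \<longleftrightarrow> p \<epsilon> f \<and> (\<exists>x y. p = pr x y \<and> x \<epsilon> A)"
  unfolding restr_def by (rule mem_sep) (intro dfn_intros)

lemma app_restr [simp]: "app (restr f A) x y \<longleftrightarrow> app f x y \<and> x \<epsilon> A"
  by (auto simp: app_def mem_restr)

section \<open>Finite sets of the model\<close>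

lemma fin_emp: "fin emp"
  unfolding fin_def isbij_def isinj_def isfun_def
  by (intro exI[of _ emp]) (simp add: sub_def)

lemma isinj_ins:
  assumes f: "isinj f n A" and n: "\<not> n \<epsilon> n" and x: "\<not> x \<epsilon> A"
  shows "isinj (ins (pr n x) f) (suc n) (ins x A)"
proof -
  have f': "isfun f n A" using f by (simp add: isinj_def)
  have "isfun (ins (pr n x) f) (suc n) (ins x A)"
  proof (rule isfunI)
    show "sub (ins (pr n x) f) (prd (suc n) (ins x A))"
      using f' unfolding isfun_def sub_prd by auto
    show "\<exists>y. app (ins (pr n x) f) z y" if "z \<epsilon> suc n" for z
      using that isfun_total[OF f'] by auto
    show "y = y'" if "app (ins (pr n x) f) z y" "app (ins (pr n x) f) z y'" for z y y'
      using that isfun_unique[OF f'] isfun_dom[OF f'] n by auto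
  qed
  moreover have "z = z'" if "app (ins (pr n x) f) z y" "app (ins (pr n x) f) z' y" for z z' y
    using that isinj_unique[OF f] isfun_dom[OF f'] x by auto
  ultimately show ?thesis unfolding isinj_def by blast
qed

lemma fin_ins:
  assumes "fin A"
  shows "fin (ins x A)"
proof (cases "x \<epsilon> A")
  case True
  then have "ins x A = A" by (intro extensionality) auto
  then show ?thesis using assms by simp
next
  case False
  obtain n f where n: "n \<epsilon> om" and f: "isbij f n A" using assms by (auto simp: fin_def)
  have "isinj (ins (pr n x) f) (suc n) (ins x A)"
    using f False om_irrefl[OF n] by (intro isinj_ins) (simp_all add: isbij_def)
  moreover have "\<exists>z. app (ins (pr n x) f) z y" if "y \<epsilon> ins x A" for y
    using f that by (auto simp: isbij_def)
  ultimately show ?thesis using suc_om[OF n] unfolding fin_def isbij_def by blast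
qed

text \<open>Induction on \<open>n\<close> for all sets in bijection with \<open>n\<close> at once:
  the image of the last number is taken out of the set and put back at the end.\<close>

lemma fin_induct [consumes 1, case_names dfn emp ins]:
  assumes "fin A" and d: "dfn (\<lambda>e. P (e 0))" and emp: "P emp"
    and ins: "\<And>x A. fin A \<Longrightarrow> P A \<Longrightarrow> P (ins x A)"
  shows "P A"
proof -
  have "\<forall>A f. isbij f n A \<longrightarrow> P A" if "n \<epsilon> om" for n using that
  proof (induction n rule: om_induct)
    case dfn show ?case by (intro dfn_intros dfn_app1[of P, OF d])
  next
    case emp
    have "A = emp" if "isbij f emp A" for A f
      by (rule eq_emp) (use that isfun_dom emp_iff in \<open>unfold isbij_def isinj_def, metis\<close>)
    then show ?case using \<open>P emp\<close> by blast
  next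
    case (suc n)
    show ?case
    proof (intro HOL.allI HOL.impI)
      fix A f assume f: "isbij f (suc n) A"
      then have inj: "isinj f (suc n) A" and fn: "isfun f (suc n) A"
        and surj: "\<And>y. y \<epsilon> A \<Longrightarrow> \<exists>x. app f x y" by (auto simp: isbij_def isinj_def)
      obtain x where x: "app f n x" using isfun_total[OF fn] by auto
      let ?A = "diff A (upair x x)" and ?f = "restr f n"
      have n: "\<not> n \<epsilon> n" using om_irrefl suc by blast
      have "isfun ?f n ?A"
      proof (rule isfunI)
        show "sub ?f (prd n ?A)"
          using isfun_dom[OF fn] isinj_unique[OF inj _ x] n unfolding sub_prd mem_restr
          by (auto simp: app_def)
      qed (use isfun_total[OF fn] isfun_unique[OF fn] in auto)
      moreover have "\<exists>z. app ?f z y" if "y \<epsilon> ?A" for y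
        using that surj[of y] isfun_dom[OF fn] isfun_unique[OF fn x] by auto
      ultimately have bij: "isbij ?f n ?A" using isinj_unique[OF inj]
        unfolding isbij_def isinj_def by (auto simp only: app_restr)
      then have "P ?A" "fin ?A" using suc by (auto simp: fin_def)
      then have "P (ins x ?A)" using ins by blast
      moreover have "ins x ?A = A" using isfun_dom[OF fn x] by (intro extensionality) auto
      ultimately show "P A" by simp
    qed
  qed
  then show ?thesis using assms(1) by (auto simp: fin_def)
qed

lemma fin_sub:
  assumes "fin A" "sub B A"
  shows "fin B"
proof -
  have "\<forall>B. sub B A \<longrightarrow> fin B" using assms(1)
  proof (induction A rule: fin_induct)
    case dfn show ?case by (intro dfn_intros)
  next
    case emp
    then show ?case using fin_emp eq_emp by (metis emp_iff sub_def)
  next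
    case (ins x A)
    show ?case
    proof (intro HOL.allI HOL.impI)
      fix B assume B: "sub B (ins x A)"
      let ?B = "diff B (upair x x)"
      have "sub ?B A" using B by (auto simp: sub_def)
      then have "fin ?B" using ins by blast
      moreover have "B = ?B \<or> B = ins x ?B"
        by (cases "x \<epsilon> B") (auto intro!: extensionality)
      ultimately show "fin B" using fin_ins by metis
    qed
  qed
  then show ?thesis using assms(2) by blast
qed

lemma fin_un:
  assumes "fin A" "fin B"
  shows "fin (un A B)"
  using assms(1)
proof (induction A rule: fin_induct)
  case dfn show ?case by (intro dfn_intros)
next
  case emp
  have "un emp B = B" by (rule extensionality) simp
  then show ?case using assms by simp
next
  case (ins x A)
  have "un (ins x A) B = ins x (un A B)" by (rule extensionality) auto
  then show ?case using ins fin_ins by simp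
qed

text \<open>Finite unions without an indexed family: each fibre of \<open>R\<close> needs some
  finite bound, and the induction joins the bounds one at a time, so that no uniform selection is
  made.\<close>

lemma fin_UN:
  assumes "fin A" and d: "dfn (\<lambda>e. R (e 0) (e (Suc 0)))"
    and f: "\<And>x. x \<epsilon> A \<Longrightarrow> \<exists>C. fin C \<and> (\<forall>y. R x y \<longrightarrow> y \<epsilon> C)"
    and B: "\<And>y. y \<epsilon> B \<Longrightarrow> \<exists>x. x \<epsilon> A \<and> R x y"
  shows "fin B"
proof -
  have "(\<forall>x. x \<epsilon> A \<longrightarrow> (\<exists>C. fin C \<and> (\<forall>y. R x y \<longrightarrow> y \<epsilon> C))) \<longrightarrow>
    (\<exists>C. fin C \<and> (\<forall>x y. x \<epsilon> A \<and> R x y \<longrightarrow> y \<epsilon> C))" using assms(1)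
  proof (induction A rule: fin_induct)
    case dfn show ?case by (intro dfn_intros dfn_app2[of R, OF d])
  next
    case emp then show ?case using fin_emp by auto
  next
    case (ins x A)
    show ?case
    proof
      assume a: "\<forall>z. z \<epsilon> ins x A \<longrightarrow> (\<exists>C. fin C \<and> (\<forall>y. R z y \<longrightarrow> y \<epsilon> C))"
      then obtain C D where "fin C" "\<forall>y. R x y \<longrightarrow> y \<epsilon> C" "fin D" "\<forall>z y. z \<epsilon> A \<and> R z y \<longrightarrow> y \<epsilon> D"
        using ins(2) by (metis ins_iff)
      then show "\<exists>C. fin C \<and> (\<forall>z y. z \<epsilon> ins x A \<and> R z y \<longrightarrow> y \<epsilon> C)"
        using fin_un[of C D] by (intro exI[of _ "un C D"]) auto
    qed
  qed
  then obtain C where "fin C" "\<forall>x y. x \<epsilon> A \<and> R x y \<longrightarrow> y \<epsilon> C" using f by blast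
  then show ?thesis using fin_sub[of C B] B unfolding sub_def by blast
qed

lemma fin_image:
  assumes "fin A" and d: "dfn (\<lambda>e. e 0 = g (e (Suc 0)))"
    and B: "\<And>y. y \<epsilon> B \<Longrightarrow> \<exists>x. x \<epsilon> A \<and> y = g x"
  shows "fin B"
proof (rule fin_UN[OF assms(1), of "\<lambda>x y. y = g x"])
  show "dfn (\<lambda>e. e (Suc 0) = g (e 0))"
    using dfn_rename[OF d, of "\<lambda>i. if i = 0 then 1 else 0"] by simp
  show "\<exists>C. fin C \<and> (\<forall>y. y = g x \<longrightarrow> y \<epsilon> C)" for x
    using fin_ins[OF fin_emp, of "g x"] by (intro exI[of _ "ins (g x) emp"]) simp
qed (use B in auto)

lemma fin_pow:
  assumes "fin A"
  shows "fin (pow A)"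
  using assms
proof (induction A rule: fin_induct)
  case dfn show ?case by (intro dfn_intros)
next
  case emp
  have "sub (pow emp) (ins emp emp)" using eq_emp by (auto simp: sub_def)
  then show ?case using fin_sub fin_ins fin_emp by blast
next
  case (ins x A)
  show ?case
  proof (rule fin_UN[OF ins(2), of "\<lambda>y z. z = y \<or> z = ins x y"])
    show "dfn (\<lambda>e. e (Suc 0) = e 0 \<or> e (Suc 0) = ins x (e 0))" by (intro dfn_intros)
    show "\<exists>C. fin C \<and> (\<forall>z. z = y \<or> z = ins x y \<longrightarrow> z \<epsilon> C)" for y
      using fin_ins[OF fin_ins[OF fin_emp, of y], of "ins x y"] by (metis ins_iff)
    fix z assume z: "z \<epsilon> pow (ins x A)"
    have "z = diff z (upair x x) \<or> z = ins x (diff z (upair x x))"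
      by (cases "x \<epsilon> z") (auto intro!: extensionality)
    moreover have "diff z (upair x x) \<epsilon> pow A" using z by (auto simp: sub_def)
    ultimately show "\<exists>y. y \<epsilon> pow A \<and> (z = y \<or> z = ins x y)" by blast
  qed
qed

lemma fin_prd:
  assumes "fin A" "fin B"
  shows "fin (prd A B)"
proof (rule fin_UN[OF assms(1), of "\<lambda>a p. p \<epsilon> prd (upair a a) B"])
  show "dfn (\<lambda>e. e (Suc 0) \<epsilon> prd (upair (e 0) (e 0)) B)" by (intro dfn_intros)
  show "\<exists>C. fin C \<and> (\<forall>p. p \<epsilon> prd (upair a a) B \<longrightarrow> p \<epsilon> C)" for a
  proof -
    have "fin (prd (upair a a) B)"
      by (rule fin_image[OF assms(2), of "pr a"]) (intro dfn_intros, auto simp: prd_iff)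
    then show ?thesis by blast
  qed
qed (auto simp: prd_iff)

lemma fin_minimal:
  assumes "fin A" and d: "dfn (\<lambda>e. P (e 0))" and "sub B A" "P B"
  obtains C where "P C" "sub C A" "\<And>D. P D \<Longrightarrow> sub D C \<Longrightarrow> D = C"
proof -
  text \<open>A family of subsets of \<open>ins x A\<close> all containing \<open>x\<close> is handled by removing \<open>x\<close>.\<close>
  have "\<forall>F. (\<exists>B. B \<epsilon> F \<and> sub B A) \<longrightarrow>
    (\<exists>C. C \<epsilon> F \<and> sub C A \<and> (\<forall>D. D \<epsilon> F \<longrightarrow> sub D C \<longrightarrow> D = C))" using assms(1)
  proof (induction A rule: fin_induct)
    case dfn show ?case by (intro dfn_intros)
  next
    case emp
    then show ?case by (metis emp_iff eq_emp sub_def)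
  next
    case (ins x A)
    show ?case
    proof (intro HOL.allI HOL.impI)
      fix F assume ex: "\<exists>B. B \<epsilon> F \<and> sub B (ins x A)"
      show "\<exists>C. C \<epsilon> F \<and> sub C (ins x A) \<and> (\<forall>D. D \<epsilon> F \<longrightarrow> sub D C \<longrightarrow> D = C)"
      proof (cases "\<exists>B. B \<epsilon> F \<and> sub B A")
        case True
        then obtain C where "C \<epsilon> F \<and> sub C A \<and> (\<forall>D. D \<epsilon> F \<longrightarrow> sub D C \<longrightarrow> D = C)"
          using ins(2) by blast
        then show ?thesis by (intro exI[of _ C]) (auto simp: sub_def)
      next
        case False
        define G where "G = sep (pow A) (\<lambda>B. ins x B \<epsilon> F)"
        have G: "B \<epsilon> G \<longleftrightarrow> sub B A \<and> ins x B \<epsilon> F" for B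
          unfolding G_def by (subst mem_sep) (intro dfn_intros, simp)
        have rem: "diff B (upair x x) \<epsilon> G \<and> B = ins x (diff B (upair x x))"
          if "B \<epsilon> F" "sub B (ins x A)" for B
        proof -
          have "x \<epsilon> B" using False that by (auto simp: sub_def)
          then have "B = ins x (diff B (upair x x))" by (intro extensionality) auto
          then show ?thesis using that unfolding G by (auto simp: sub_def)
        qed
        obtain B where "B \<epsilon> F" "sub B (ins x A)" using ex by blast
        then have "\<exists>B. B \<epsilon> G \<and> sub B A" using rem G by blast
        then obtain C where C: "C \<epsilon> G" "sub C A" "\<And>D. D \<epsilon> G \<Longrightarrow> sub D C \<Longrightarrow> D = C"
          using ins(2) by blast
        have "D = ins x C" if D: "D \<epsilon> F" "sub D (ins x C)" for D
        proof -
          have "sub D (ins x A)" using D(2) C(2) by (auto simp: sub_def)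
          then have r: "diff D (upair x x) \<epsilon> G" "D = ins x (diff D (upair x x))"
            using rem[OF D(1)] by auto
          have "diff D (upair x x) = C" using D(2) by (intro C(3) r(1)) (auto simp: sub_def)
          then show ?thesis using r(2) by simp
        qed
        moreover have "ins x C \<epsilon> F" "sub (ins x C) (ins x A)"
          using C G by (auto simp: sub_def)
        ultimately show ?thesis by blast
      qed
    qed
  qed
  \<comment> \<open>\<open>P\<close> enters only now, as a set of subsets of \<open>A\<close>. The
    induction has to vary the family, and quantifying over sets of the model keeps its statement
    definable.\<close>
  then have "(\<exists>B. B \<epsilon> sep (pow A) P \<and> sub B A) \<longrightarrow> (\<exists>C. C \<epsilon> sep (pow A) P \<and> sub C A \<and>
      (\<forall>D. D \<epsilon> sep (pow A) P \<longrightarrow> sub D C \<longrightarrow> D = C))" by blast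
  then obtain C where C: "P C" "sub C A" "\<And>D. sub D A \<Longrightarrow> P D \<Longrightarrow> sub D C \<Longrightarrow> D = C"
    using assms(3,4) unfolding mem_sep[OF d] by auto
  have "D = C" if "P D" "sub D C" for D
    using that C(2) by (intro C(3)) (auto simp: sub_def)
  then show ?thesis using that C by blast
qed

end

section \<open>Induced paths and connected sets\<close>

locale graph_model = zf_model +
  fixes V X
  assumes graph: "\<And>e. e \<epsilon> X \<Longrightarrow> \<exists>v w. v \<epsilon> V \<and> w \<epsilon> V \<and> v \<noteq> w \<and> e = upair v w"
    and chordal: "\<not> (\<exists>n c. n \<epsilon> om \<and> suc (suc (suc emp)) \<epsilon> n \<and> isinj c n V \<and>
      (\<forall>i j v w. i \<epsilon> n \<and> j \<epsilon> n \<and> app c i v \<and> app c j w \<longrightarrow> (upair v w \<epsilon> X \<longleftrightarrow>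
        i = suc j \<or> j = suc i \<or> i = emp \<and> n = suc j \<or> j = emp \<and> n = suc i)))"
begin

section \<open>Adjacency and induced paths\<close>

abbreviation adj :: "'a \<Rightarrow> 'a \<Rightarrow> bool" where "adj v w \<equiv> upair v w \<epsilon> X"

lemma adj_sym: "adj v w \<Longrightarrow> adj w v"
  by (metis upair_eq)

lemma adj_V: "adj v w \<Longrightarrow> v \<epsilon> V \<and> w \<epsilon> V \<and> v \<noteq> w"
  using graph by (metis upair_eq)

lemma adj_irrefl [simp]: "\<not> adj v v"
  using adj_V by blast

definition induced_path :: "'a \<Rightarrow> 'a \<Rightarrow> bool" where
  "induced_path p n \<longleftrightarrow> n \<epsilon> om \<and> isinj p n V \<and>
     (\<forall>i j v w. app p i v \<and> app p j w \<longrightarrow> (adj v w \<longleftrightarrow> i = suc j \<or> j = suc i))"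

lemma dfn_induced_path [dfn_intros]: "dfun s \<Longrightarrow> dfun t \<Longrightarrow> dfn (\<lambda>e. induced_path (s e) (t e))"
  by (rule dfn_app2[where R = induced_path], unfold induced_path_def) (intro dfn_intros)

text \<open>The path is cut after index \<open>i\<close> before \<open>w\<close> is appended;
  attaching \<open>w\<close> to the first vertex adjacent to it avoids chords.\<close>

definition ext :: "'a \<Rightarrow> 'a \<Rightarrow> 'a \<Rightarrow> 'a" where
  "ext p i w = ins (pr (suc i) w) (restr p (suc i))"

lemma app_ext: "app (ext p i w) j v \<longleftrightarrow> app p j v \<and> (j \<epsilon> i \<or> j = i) \<or> j = suc i \<and> v = w"
  by (simp add: ext_def)

lemma isinj_restr:
  assumes "isinj p n A" "sub m n" "\<And>i v. i \<epsilon> m \<Longrightarrow> app p i v \<Longrightarrow> v \<epsilon> B"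
  shows "isinj (restr p m) m B"
proof -
  have f: "isfun p n A" using assms(1) by (simp add: isinj_def)
  have "isfun (restr p m) m B"
  proof (rule isfunI)
    have "\<exists>x y. x \<epsilon> m \<and> y \<epsilon> B \<and> q = pr x y" if "q \<epsilon> restr p m" for q
      using that assms(3) unfolding mem_restr app_def by blast
    then show "sub (restr p m) (prd m B)" unfolding sub_prd by blast
    show "\<exists>y. app (restr p m) x y" if "x \<epsilon> m" for x
      using isfun_total[OF f] assms(2) that by (auto simp: sub_def)
  qed (use isfun_unique[OF f] in auto)
  then show ?thesis using assms(1) unfolding isinj_def app_restr by blast
qed

lemma induced_path_restr:
  assumes "induced_path p n" "i \<epsilon> n"
  shows "induced_path (restr p (suc i)) (suc i)"
proof -
  have n: "n \<epsilon> om" and inj: "isinj p n V" using assms by (auto simp: induced_path_def)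
  have "sub (suc i) n" using assms(2) om_trans[OF n] by (auto simp: sub_def)
  then have "isinj (restr p (suc i)) (suc i) V"
    using inj isfun_dom[of p n V] by (intro isinj_restr[OF inj]) (auto simp: isinj_def)
  moreover have "suc i \<epsilon> om" using om_elem[OF n assms(2)] suc_om by blast
  ultimately show ?thesis using assms(1) unfolding induced_path_def by simp
qed

lemma isinj_ext:
  assumes "induced_path p n" "i \<epsilon> n" "w \<epsilon> V" "\<And>j. \<not> app p j w"
  shows "isinj (ext p i w) (suc (suc i)) V"
proof -
  have n: "n \<epsilon> om" and inj: "isinj p n V" using assms by (auto simp: induced_path_def)
  have "sub (suc i) n" using assms(2) om_trans[OF n] by (auto simp: sub_def)
  \<comment> \<open>\<open>w\<close> leaves the codomain, as \<open>isinj_ins\<close> demands, and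
    is put back below.\<close>
  then have "isinj (restr p (suc i)) (suc i) (diff V (upair w w))"
    using inj isfun_dom[of p n V] assms(4) by (intro isinj_restr[OF inj]) (auto simp: isinj_def)
  then have "isinj (ext p i w) (suc (suc i)) (ins w (diff V (upair w w)))"
    unfolding ext_def using om_irrefl[OF suc_om[OF om_elem[OF n assms(2)]]]
    by (rule isinj_ins) simp
  moreover have "ins w (diff V (upair w w)) = V" using assms(3) by (intro extensionality) auto
  ultimately show ?thesis by simp
qed

lemma induced_path_ext:
  assumes p: "induced_path p n" and i: "i \<epsilon> n" and w: "\<And>j. \<not> app p j w" and u: "app p i u" "adj u w"
    and least: "\<And>j v. j \<epsilon> i \<Longrightarrow> app p j v \<Longrightarrow> \<not> adj v w"
  shows "induced_path (ext p i w) (suc (suc i))"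
proof -
  have n: "n \<epsilon> om" and fn: "isfun p n V" and
    ip: "\<And>j k v w. app p j v \<Longrightarrow> app p k w \<Longrightarrow> adj v w \<longleftrightarrow> j = suc k \<or> k = suc j"
    using p by (auto simp: induced_path_def isinj_def)
  have om: "i \<epsilon> om" "suc i \<epsilon> om" "suc (suc i) \<epsilon> om"
    using om_elem[OF n i] suc_om by blast+
  have new: "(adj v w \<longleftrightarrow> j = i) \<and> j \<noteq> suc (suc i) \<and> (suc i = suc j \<longleftrightarrow> j = i)"
    if "app p j v" "j \<epsilon> i \<or> j = i" for j v
  proof -
    have "j \<epsilon> om" using that(2) om om_elem by blast
    moreover have "adj v w" if "j = i" using u \<open>app p j v\<close> isfun_unique[OF fn] that by blast
    moreover have "j \<noteq> suc (suc i)" using that(2) om om_irrefl om_asym by (metis ins_iff)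
    ultimately show ?thesis using least that om suc_eq_iff om_irrefl by metis
  qed
  have "adj v v' \<longleftrightarrow> j = suc k \<or> k = suc j"
    if jk: "app (ext p i w) j v" "app (ext p i w) k v'" for j k v v'
  proof -
    consider "app p j v" "app p k v'" | "app p j v" "j \<epsilon> i \<or> j = i" "k = suc i" "v' = w"
      | "app p k v'" "k \<epsilon> i \<or> k = i" "j = suc i" "v = w" | "j = suc i" "k = suc i" "v = w" "v' = w"
      using jk unfolding app_ext by blast
    then show ?thesis
    proof cases
      case 1 then show ?thesis using ip by blast
    next
      case 2 then show ?thesis using new[of j v] by auto
    next
      case 3 then show ?thesis using new[of k v'] adj_sym by auto
    next
      case 4 then show ?thesis using om om_irrefl by (metis adj_irrefl ins_iff)
    qed
  qed
  then show ?thesis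
    unfolding induced_path_def using isinj_ext[OF p i _ w] adj_V[OF u(2)] om by blast
qed

text \<open>Among the entries up to \<open>i\<close>, \<open>w\<close> is adjacent to those at 0 and
  \<open>i\<close> only, so the cut path closes up through \<open>w\<close>. The induced circuit has
  \<open>i + 2\<close> vertices, at least four because \<open>i\<close> is at least 2.\<close>

lemma no_circuit:
  assumes p: "induced_path p n" and i: "i \<epsilon> n" "suc emp \<epsilon> i" and w: "\<And>j. \<not> app p j w"
    and u: "app p i u" "adj u w" and x: "app p emp x" "adj x w"
    and least: "\<And>j v. j \<epsilon> i \<Longrightarrow> j \<noteq> emp \<Longrightarrow> app p j v \<Longrightarrow> \<not> adj v w"
  shows False
proof -
  have n: "n \<epsilon> om" and fn: "isfun p n V" and
    ip: "\<And>j k v w. app p j v \<Longrightarrow> app p k w \<Longrightarrow> adj v w \<longleftrightarrow> j = suc k \<or> k = suc j"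
    using p by (auto simp: induced_path_def isinj_def)
  have om: "i \<epsilon> om" "suc i \<epsilon> om" "suc (suc i) \<epsilon> om"
    using om_elem[OF n i(1)] suc_om by blast+
  have old: "(adj v w \<longleftrightarrow> j = i \<or> j = emp) \<and> j \<noteq> suc i \<and> j \<noteq> suc (suc i) \<and> (suc i = suc j \<longleftrightarrow> j = i)
     \<and> suc (suc i) \<noteq> suc j"
    if "app p j v" "j \<epsilon> i \<or> j = i" for j v
  proof -
    have j: "j \<epsilon> om" using that(2) om om_elem by blast
    have "adj v w" if "j = i" using u \<open>app p j v\<close> isfun_unique[OF fn] that by blast
    moreover have "adj v w" if "j = emp" using x \<open>app p j v\<close> isfun_unique[OF fn] that by blast
    moreover have "j \<noteq> suc i" "j \<noteq> suc (suc i)" using that(2) om om_irrefl om_asym by (metis ins_iff)+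
    ultimately show ?thesis using least that om suc_eq_iff j by metis
  qed
  have circuit: "adj v v' \<longleftrightarrow>
      j = suc k \<or> k = suc j \<or> j = emp \<and> suc (suc i) = suc k \<or> k = emp \<and> suc (suc i) = suc j"
    if jk: "app (ext p i w) j v" "app (ext p i w) k v'" for j k v v'
  proof -
    consider "app p j v" "app p k v'" "j \<epsilon> i \<or> j = i" "k \<epsilon> i \<or> k = i"
      | "app p j v" "j \<epsilon> i \<or> j = i" "k = suc i" "v' = w"
      | "app p k v'" "k \<epsilon> i \<or> k = i" "j = suc i" "v = w" | "j = suc i" "k = suc i" "v = w" "v' = w"
      using jk unfolding app_ext by blast
    then show ?thesis
    proof cases
      case 1 then show ?thesis using ip old[of j v] old[of k v'] by blast
    next
      case 2 then show ?thesis using old[of j v] by auto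
    next
      case 3 then show ?thesis using old[of k v'] adj_sym by auto
    next
      case 4
      have "suc i \<noteq> suc (suc i)" using om om_irrefl by (metis ins_iff)
      with 4 show ?thesis by simp
    qed
  qed
  have "\<forall>j k v v'. j \<epsilon> suc (suc i) \<and> k \<epsilon> suc (suc i) \<and> app (ext p i w) j v \<and> app (ext p i w) k v' \<longrightarrow>
      (adj v v' \<longleftrightarrow>
        j = suc k \<or> k = suc j \<or> j = emp \<and> suc (suc i) = suc k \<or> k = emp \<and> suc (suc i) = suc j)"
    by (intro HOL.allI HOL.impI, elim conjE, rule circuit)
  moreover have "suc (suc (suc emp)) \<epsilon> suc (suc i)"
    using suc_mem_suc[OF om(2) suc_mem_suc[OF om(1) i(2)]] .
  moreover have "isinj (ext p i w) (suc (suc i)) V"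
    using isinj_ext[OF p i(1) _ w] adj_V[OF u(2)] by blast
  ultimately show False
    by (intro chordal[THEN notE, of False] exI[of _ "suc (suc i)"] exI[of _ "ext p i w"] conjI om(3))
qed

text \<open>The second vertex must lie in \<open>C\<close> so that vertices without neighbours in
  \<open>C\<close> are not adjacent to it; this rules out triangles when the path is closed.\<close>

definition reach :: "'a \<Rightarrow> 'a \<Rightarrow> 'a \<Rightarrow> bool" where
  "reach C x w \<longleftrightarrow> (\<exists>p n u. induced_path p (suc n) \<and> n \<epsilon> om \<and> app p emp x \<and> app p (suc emp) u \<and> u \<epsilon> C \<and>
     app p n w)"

lemma dfn_reach [dfn_intros]:
  "dfun f \<Longrightarrow> dfun s \<Longrightarrow> dfun t \<Longrightarrow> dfn (\<lambda>e. reach (f e) (s e) (t e))"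
  by (rule dfn_app3[where R = reach], unfold reach_def) (intro dfn_intros)

lemma induced_path_single:
  assumes "x \<epsilon> V"
  shows "induced_path (ins (pr emp x) emp) (suc emp)"
proof -
  have "isinj emp emp (diff V (upair x x))"
    unfolding isinj_def isfun_def by (simp add: sub_def)
  then have "isinj (ins (pr emp x) emp) (suc emp) (ins x (diff V (upair x x)))"
    by (rule isinj_ins) simp_all
  moreover have "ins x (diff V (upair x x)) = V" using assms by (intro extensionality) auto
  ultimately show ?thesis unfolding induced_path_def using suc_om[OF emp_om] by auto
qed

lemma reach_start:
  assumes "w \<epsilon> C" "adj x w"
  shows "reach C x w"
proof -
  let ?p = "ins (pr emp x) emp"
  have "induced_path (ext ?p emp w) (suc (suc emp))"
    using assms(2) adj_V[OF assms(2)]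
    by (intro induced_path_ext[where u = x and n = "suc emp"] induced_path_single) auto
  then show ?thesis unfolding reach_def
    by (intro exI[of _ "ext ?p emp w"] exI[of _ "suc emp"] exI[of _ w])
      (use assms suc_om[OF emp_om] in \<open>simp add: app_ext\<close>)
qed

text \<open>If \<open>w'\<close> lies on the path, the path is cut there. Otherwise it is cut at the
  first vertex adjacent to \<open>w'\<close>. In both cases the cut is not at \<open>x\<close>, so
  the second vertex survives.\<close>

lemma reach_step:
  assumes "reach C x w" "adj w w'" "w' \<noteq> x" "\<not> adj x w'"
  shows "reach C x w'"
proof -
  obtain p n u where p: "induced_path p (suc n)" "n \<epsilon> om" "app p emp x" "app p (suc emp) u" "u \<epsilon> C" "app p n w"
    using assms(1) by (auto simp: reach_def)
  have fn: "isfun p (suc n) V" using p by (auto simp: induced_path_def isinj_def)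
  have om: "i \<epsilon> om" if "i \<epsilon> suc n" for i using that om_elem[OF suc_om[OF p(2)]] by blast
  have pos: "suc emp \<epsilon> suc i" if "i \<epsilon> om" "i \<noteq> emp" for i
    using that suc_mem_suc emp_mem_suc om_cases by metis
  show ?thesis
  proof (cases "\<exists>i. app p i w'")
    case True
    then obtain i where i: "app p i w'" by blast
    then have n: "i \<epsilon> suc n" using isfun_dom[OF fn] by blast
    have "i \<noteq> emp" using i p(3) isfun_unique[OF fn] assms(3) by blast
    then have "suc emp \<epsilon> suc i" using pos om n by blast
    then show ?thesis unfolding reach_def
      by (intro exI[of _ "restr p (suc i)"] exI[of _ i] exI[of _ u])
        (use induced_path_restr[OF p(1) n] i p om n emp_mem_suc[of i] in \<open>simp\<close>)
  next
    case False
    have ex: "\<exists>v. app p n v \<and> adj v w'" using p assms by blast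
    have d: "dfn (\<lambda>e. \<exists>v. app p (e 0) v \<and> adj v w')" by (intro dfn_intros)
    obtain i where i: "i \<epsilon> om" "\<exists>v. app p i v \<and> adj v w'"
      "\<And>k. k \<epsilon> i \<Longrightarrow> \<not> (\<exists>v. app p k v \<and> adj v w')"
      by (rule om_least[where P = "\<lambda>i. \<exists>v. app p i v \<and> adj v w'", OF p(2) ex d]) (rule that)
    obtain v where v: "app p i v" "adj v w'" using i by blast
    have n: "i \<epsilon> suc n" using v isfun_dom[OF fn] by blast
    have "i \<noteq> emp" using v p(3) isfun_unique[OF fn] assms(4) by blast
    then have "suc emp \<epsilon> suc i" using pos i by blast
    moreover have "induced_path (ext p i w') (suc (suc i))"
      using v i False by (intro induced_path_ext[OF p(1) n]) blast+
    ultimately show ?thesis unfolding reach_def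
      by (intro exI[of _ "ext p i w'"] exI[of _ "suc i"] exI[of _ u])
        (use p i suc_om emp_mem_suc[OF i(1)] in \<open>auto simp: app_ext\<close>)
  qed
qed

text \<open>Suppose \<open>x\<close> is adjacent to \<open>w'\<close>. On the path,
  \<open>w'\<close> would be the second vertex, which is in \<open>C\<close>. Off the path, it
  closes a circuit at the first index \<open>i > 0\<close> adjacent to it, and \<open>i\<close> is
  at least 2 because the vertex at index 1 lies in \<open>C\<close>.\<close>

lemma reach_nonadjacent:
  assumes "reach C x w" "adj w w'" "w' \<noteq> x" "\<not> w' \<epsilon> C" "\<And>c. c \<epsilon> C \<Longrightarrow> \<not> adj c w'"
  shows "\<not> adj x w'"
proof
  assume x: "adj x w'"
  obtain p n u where p: "induced_path p (suc n)" "n \<epsilon> om" "app p emp x" "app p (suc emp) u" "u \<epsilon> C" "app p n w"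
    using assms(1) by (auto simp: reach_def)
  have fn: "isfun p (suc n) V" and
    ip: "\<And>j k v w. app p j v \<Longrightarrow> app p k w \<Longrightarrow> adj v w \<longleftrightarrow> j = suc k \<or> k = suc j"
    using p by (auto simp: induced_path_def isinj_def)
  show False
  proof (cases "\<exists>i. app p i w'")
    case True
    then obtain i where i: "app p i w'" by blast
    then have "i = suc emp" using ip[OF p(3) i] x by auto
    then show False using i p(4,5) assms(4) isfun_unique[OF fn] by blast
  next
    case False
    have "suc emp \<epsilon> suc n" using isfun_dom[OF fn p(4)] by blast
    then have "n \<noteq> emp" by auto
    then have ex: "n \<noteq> emp \<and> (\<exists>v. app p n v \<and> adj v w')" using p assms by blast
    have d: "dfn (\<lambda>e. e 0 \<noteq> emp \<and> (\<exists>v. app p (e 0) v \<and> adj v w'))" by (intro dfn_intros)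
    obtain i where i: "i \<epsilon> om" "i \<noteq> emp \<and> (\<exists>v. app p i v \<and> adj v w')"
      "\<And>k. k \<epsilon> i \<Longrightarrow> \<not> (k \<noteq> emp \<and> (\<exists>v. app p k v \<and> adj v w'))"
      by (rule om_least[where P = "\<lambda>i. i \<noteq> emp \<and> (\<exists>v. app p i v \<and> adj v w')", OF p(2) ex d])
        (rule that)
    obtain v where v: "app p i v" "adj v w'" using i by blast
    have "i \<noteq> suc emp" using v p(4,5) isfun_unique[OF fn] assms(5) by blast
    then have "suc emp \<epsilon> i"
      using i by (metis emp_mem_suc ins_iff om_cases suc_mem_suc)
    then show False
      using no_circuit[OF p(1) _ _ _ v p(3) x] isfun_dom[OF fn v(1)] i(3) False by blast
  qed
qed

section \<open>Connected sets and the separation property\<close>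

definition conn :: "'a \<Rightarrow> bool" where
  "conn W \<longleftrightarrow> (\<forall>T. (\<exists>a. a \<epsilon> W \<and> a \<epsilon> T) \<and>
     (\<forall>u v. u \<epsilon> T \<and> u \<epsilon> W \<and> v \<epsilon> W \<and> adj u v \<longrightarrow> v \<epsilon> T) \<longrightarrow> sub W T)"

text \<open>With closed sets in place of paths, connectedness is itself an induction principle for
  definable properties that pass along the edges inside \<open>W\<close>.\<close>

lemma connD:
  assumes "conn W" "dfn (\<lambda>e. P (e 0))" "a \<epsilon> W" "P a"
    "\<And>u v. P u \<Longrightarrow> u \<epsilon> W \<Longrightarrow> v \<epsilon> W \<Longrightarrow> adj u v \<Longrightarrow> P v" "w \<epsilon> W"
  shows "P w"
proof -
  have "(\<exists>a. a \<epsilon> W \<and> a \<epsilon> sep W P) \<and>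
     (\<forall>u v. u \<epsilon> sep W P \<and> u \<epsilon> W \<and> v \<epsilon> W \<and> adj u v \<longrightarrow> v \<epsilon> sep W P)"
    using assms(3,4,5) unfolding mem_sep[OF assms(2)] by blast
  then have "sub W (sep W P)" using assms(1) unfolding conn_def by blast
  then show ?thesis using assms(6) mem_sep[OF assms(2)] by (auto simp: sub_def)
qed

text \<open>If \<open>T\<close> is closed and omits the root, then the complement of \<open>T\<close> is closed and contains it.\<close>

lemma conn_root:
  assumes c: "c \<epsilon> W" and r: "\<And>T. c \<epsilon> T \<Longrightarrow>
      (\<And>u v. u \<epsilon> T \<Longrightarrow> u \<epsilon> W \<Longrightarrow> v \<epsilon> W \<Longrightarrow> adj u v \<Longrightarrow> v \<epsilon> T) \<Longrightarrow> sub W T"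
  shows "conn W"
  unfolding conn_def
proof (intro HOL.allI HOL.impI, elim conjE exE)
  fix T a assume a: "a \<epsilon> W" "a \<epsilon> T"
    and T: "\<forall>u v. u \<epsilon> T \<and> u \<epsilon> W \<and> v \<epsilon> W \<and> adj u v \<longrightarrow> v \<epsilon> T"
  have "c \<epsilon> T"
  proof (rule ccontr)
    assume "\<not> c \<epsilon> T"
    then have "sub W (diff W T)" using c T adj_sym by (intro r) (simp, auto)
    then show False using a by (auto simp: sub_def)
  qed
  then show "sub W T" using T by (intro r) blast+
qed

lemma separator_clique:
  assumes C: "conn C" and D: "conn D" and V: "x \<epsilon> V" "y \<epsilon> V"
    and disj: "\<And>c. c \<epsilon> C \<Longrightarrow> \<not> c \<epsilon> D" and anti: "\<And>c d. c \<epsilon> C \<Longrightarrow> d \<epsilon> D \<Longrightarrow> \<not> adj c d"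
    and x: "\<not> x \<epsilon> C" "\<not> x \<epsilon> D" and y: "\<not> y \<epsilon> C" "\<not> y \<epsilon> D" "x \<noteq> y"
    and xC: "c \<epsilon> C" "adj x c" and yC: "c' \<epsilon> C" "adj y c'"
    and xD: "d \<epsilon> D" "adj x d" and yD: "d' \<epsilon> D" "adj y d'"
  shows "adj x y"
proof (rule ccontr)
  assume no: "\<not> adj x y"
  \<comment> \<open>Within \<open>C\<close>, neighbours of \<open>x\<close> are reached directly and
    all other vertices by \<open>reach_step\<close>.\<close>
  have "reach C x c'"
  proof (rule connD[OF C, where P = "reach C x"])
    show "dfn (\<lambda>e. reach C x (e 0))" by (intro dfn_intros)
    show "reach C x v" if "reach C x u" "u \<epsilon> C" "v \<epsilon> C" "adj u v" for u v
      using that reach_step reach_start x by (cases "adj x v") blast+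
  qed (use xC yC reach_start in auto)
  then have "reach C x y" using reach_step yC adj_sym y no by blast
  have "\<not> adj x d' \<and> reach C x d'"
    using reach_nonadjacent[OF \<open>reach C x y\<close> yD(2)] reach_step[OF \<open>reach C x y\<close> yD(2)] disj anti x yD
    by blast
  \<comment> \<open>Along each edge of \<open>D\<close>, \<open>reach_nonadjacent\<close> comes
    first, since \<open>reach_step\<close> leads only to vertices not adjacent to \<open>x\<close>.
    The result at \<open>d\<close> contradicts \<open>xD\<close>.\<close>
  have "\<not> adj x d \<and> reach C x d"
  proof (rule connD[OF D, where P = "\<lambda>w. \<not> adj x w \<and> reach C x w"])
    show "dfn (\<lambda>e. \<not> adj x (e 0) \<and> reach C x (e 0))" by (intro dfn_intros)
    show "\<not> adj x v \<and> reach C x v"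
      if "\<not> adj x u \<and> reach C x u" "u \<epsilon> D" "v \<epsilon> D" "adj u v" for u v
    proof -
      have "v \<noteq> x" "\<not> v \<epsilon> C" using that x disj by blast+
      then have "\<not> adj x v" using reach_nonadjacent that anti by blast
      then show ?thesis using reach_step that \<open>v \<noteq> x\<close> by blast
    qed
    show "\<not> adj x d' \<and> reach C x d'" by fact
  qed (use xD yD in auto)
  then show False using xD by blast
qed

section \<open>Components, cliques and boundaries\<close>

definition comp :: "'a \<Rightarrow> 'a \<Rightarrow> 'a" where
  "comp S c = sep S (\<lambda>x. \<forall>T. c \<epsilon> T \<and> (\<forall>u v. u \<epsilon> T \<and> v \<epsilon> S \<and> adj u v \<longrightarrow> v \<epsilon> T) \<longrightarrow> x \<epsilon> T)"

lemma mem_comp: "x \<epsilon> comp S c \<longleftrightarrow> x \<epsilon> S \<and>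
    (\<forall>T. c \<epsilon> T \<and> (\<forall>u v. u \<epsilon> T \<and> v \<epsilon> S \<and> adj u v \<longrightarrow> v \<epsilon> T) \<longrightarrow> x \<epsilon> T)"
  unfolding comp_def by (subst mem_sep) (intro dfn_intros, rule refl)

lemma comp_refl: "c \<epsilon> S \<Longrightarrow> c \<epsilon> comp S c"
  by (simp add: mem_comp)

lemma comp_step: "u \<epsilon> comp S c \<Longrightarrow> v \<epsilon> S \<Longrightarrow> adj u v \<Longrightarrow> v \<epsilon> comp S c"
  unfolding mem_comp by blast

lemma conn_comp:
  assumes "c \<epsilon> S"
  shows "conn (comp S c)"
proof (rule conn_root[OF comp_refl[OF assms]])
  fix T assume T: "c \<epsilon> T"
    "\<And>u v. u \<epsilon> T \<Longrightarrow> u \<epsilon> comp S c \<Longrightarrow> v \<epsilon> comp S c \<Longrightarrow> adj u v \<Longrightarrow> v \<epsilon> T"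
  \<comment> \<open>The intersection of \<open>T\<close> with the component: \<open>T\<close> is
    closed only along edges inside the component, while \<open>mem_comp\<close> asks for a set
    closed within \<open>S\<close>.\<close>
  define T' where "T' = diff T (diff T (comp S c))"
  have T': "x \<epsilon> T' \<longleftrightarrow> x \<epsilon> T \<and> x \<epsilon> comp S c" for x by (auto simp: T'_def)
  have "c \<epsilon> T' \<and> (\<forall>u v. u \<epsilon> T' \<and> v \<epsilon> S \<and> adj u v \<longrightarrow> v \<epsilon> T')"
    using T comp_refl[OF assms] comp_step unfolding T' by blast
  then have "x \<epsilon> T'" if "x \<epsilon> comp S c" for x using that mem_comp by blast
  then show "sub (comp S c) T" using T' by (auto simp: sub_def)
qed

definition clique :: "'a \<Rightarrow> bool" where
  "clique K \<longleftrightarrow> (\<forall>u v. u \<epsilon> K \<and> v \<epsilon> K \<and> u \<noteq> v \<longrightarrow> adj u v)"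

lemma dfn_clique [dfn_intros]: "dfun s \<Longrightarrow> dfn (\<lambda>e. clique (s e))"
  by (rule dfn_app1[where P = clique], unfold clique_def) (intro dfn_intros)

definition bd :: "'a \<Rightarrow> 'a \<Rightarrow> 'a" where
  "bd U C = sep U (\<lambda>x. \<not> x \<epsilon> C \<and> (\<exists>c. c \<epsilon> C \<and> adj c x))"

lemma mem_bd: "x \<epsilon> bd U C \<longleftrightarrow> x \<epsilon> U \<and> \<not> x \<epsilon> C \<and> (\<exists>c. c \<epsilon> C \<and> adj c x)"
  unfolding bd_def by (subst mem_sep) (intro dfn_intros, rule refl)

lemma dfun_bd [dfn_intros]: "dfun s \<Longrightarrow> dfun t \<Longrightarrow> dfun (\<lambda>e. bd (s e) (t e))"
  by (rule dfun_app2[where f = bd], unfold bd_def) (intro dfn_intros)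

text \<open>If \<open>r\<close> were not joined to \<open>c\<close>, the component of \<open>c\<close> among the non-neighbours of \<open>r\<close> in \<open>C\<close> would be
  smaller than \<open>C\<close>; its boundary consists of neighbours of \<open>r\<close> and is therefore again a clique.\<close>

lemma minimal_clique_boundary:
  assumes U: "sub C U" "sub U V" and cl: "clique (bd U C)"
    and min: "\<And>C'. sub C' C \<Longrightarrow> C' \<noteq> emp \<Longrightarrow> clique (bd U C') \<Longrightarrow> C' = C"
    and r: "r \<epsilon> C \<or> r \<epsilon> bd U C" and c: "c \<epsilon> C" "r \<noteq> c"
    and k: "\<And>k. k \<epsilon> bd U C \<Longrightarrow> k = r \<or> adj r k"
  shows "adj r c"
proof (rule ccontr)
  assume no: "\<not> adj r c"
  define S where "S = sep C (\<lambda>x. x \<noteq> r \<and> \<not> adj r x)"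
  have S: "x \<epsilon> S \<longleftrightarrow> x \<epsilon> C \<and> x \<noteq> r \<and> \<not> adj r x" for x
    unfolding S_def by (subst mem_sep) (intro dfn_intros, rule refl)
  have cS: "c \<epsilon> S" using S c no by blast
  let ?C = "comp S c"
  have sub: "x \<epsilon> S" if "x \<epsilon> ?C" for x using that mem_comp by blast
  have near: "adj r x" if "x \<epsilon> bd U ?C" for x
  proof -
    from that obtain c' where x: "x \<epsilon> U" "\<not> x \<epsilon> ?C" "c' \<epsilon> ?C" "adj c' x" by (auto simp: mem_bd)
    have c': "c' \<epsilon> C" "\<not> adj r c'" using sub[OF x(3)] S by blast+
    then have "x \<noteq> r" using x(4) adj_sym by blast
    show ?thesis
    proof (cases "x \<epsilon> C")
      case True
      then show ?thesis using comp_step[OF x(3) _ x(4)] x(2) S \<open>x \<noteq> r\<close> by blast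
    next
      case False
      then have "x \<epsilon> bd U C" using x c' mem_bd by blast
      then show ?thesis using k \<open>x \<noteq> r\<close> by blast
    qed
  qed
  \<comment> \<open>\<open>{r}\<close> is the second connected set for
    \<open>separator_clique\<close>; the component of \<open>c\<close> avoids \<open>r\<close> and
    its neighbours.\<close>
  have r_conn: "conn (upair r r)" unfolding conn_def sub_def by auto
  have "clique (bd U ?C)"
    unfolding clique_def
  proof (intro HOL.allI HOL.impI, elim conjE)
    fix x y assume x: "x \<epsilon> bd U ?C" and y: "y \<epsilon> bd U ?C" and "x \<noteq> y"
    from x obtain c1 where x': "x \<epsilon> U" "\<not> x \<epsilon> ?C" "c1 \<epsilon> ?C" "adj c1 x" by (auto simp: mem_bd)
    from y obtain c2 where y': "y \<epsilon> U" "\<not> y \<epsilon> ?C" "c2 \<epsilon> ?C" "adj c2 y" by (auto simp: mem_bd)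
    show "adj x y"
    proof (rule separator_clique[OF conn_comp[OF cS] r_conn,
          where c = c1 and c' = c2 and d = r and d' = r])
      show "adj x r" "adj y r" using near x y adj_sym by blast+
      show "adj x c1" "adj y c2" using x' y' adj_sym by blast+
      show "\<not> x \<epsilon> upair r r" "\<not> y \<epsilon> upair r r" using near[OF x] near[OF y] by auto
      show "\<not> adj c' d" if "c' \<epsilon> ?C" "d \<epsilon> upair r r" for c' d
        using that sub[OF that(1)] S adj_sym by auto
      show "\<not> c' \<epsilon> upair r r" if "c' \<epsilon> ?C" for c' using sub[OF that] S by auto
    qed (use x' y' \<open>x \<noteq> y\<close> U in \<open>auto simp: sub_def\<close>)
  qed
  moreover have "sub ?C C" using sub S by (auto simp: sub_def)
  moreover have "?C \<noteq> emp" using comp_refl[OF cS] by auto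
  ultimately have "?C = C" using min by blast
  \<comment> \<open>Now \<open>C\<close> contains neither \<open>r\<close> nor a neighbour of
    \<open>r\<close>, contrary to both alternatives for \<open>r\<close>.\<close>
  then have all: "x \<noteq> r \<and> \<not> adj r x" if "x \<epsilon> C" for x using that sub S by metis
  then show False using r mem_bd adj_sym by blast
qed

text \<open>For minimal \<open>C\<close>, the sets \<open>C\<close> and \<open>bd U C\<close>
  together form a clique, which contains all neighbours in \<open>U\<close> of a vertex of
  \<open>C\<close>. Fact \<open>1\<close> joins the boundary to \<open>C\<close> and thereby
  supplies the hypothesis on \<open>k\<close> in the proof of \<open>2\<close>.\<close>

lemma simplicial_vertex:
  assumes A: "fin A" "sub A U" "sub U V" and C: "sub C A" "C \<noteq> emp" "clique (bd U C)"
  obtains v where "v \<epsilon> A" "\<And>x y. x \<epsilon> U \<Longrightarrow> y \<epsilon> U \<Longrightarrow> adj x v \<Longrightarrow> adj y v \<Longrightarrow> x \<noteq> y \<Longrightarrow> adj x y"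
proof -
  have ex: "C \<noteq> emp \<and> clique (bd U C)" using C by blast
  have d: "dfn (\<lambda>e. e 0 \<noteq> emp \<and> clique (bd U (e 0)))" by (intro dfn_intros)
  obtain C where C': "C \<noteq> emp \<and> clique (bd U C)" "sub C A"
    and min: "\<And>C'. C' \<noteq> emp \<and> clique (bd U C') \<Longrightarrow> sub C' C \<Longrightarrow> C' = C"
    by (rule fin_minimal[where P = "\<lambda>C. C \<noteq> emp \<and> clique (bd U C)", OF A(1) d C(1) ex]) (rule that)
  then have C: "sub C A" "C \<noteq> emp" "clique (bd U C)" by blast+
  have CU: "sub C U" using C(1) A(2) by (auto simp: sub_def)
  have min': "\<And>C'. sub C' C \<Longrightarrow> C' \<noteq> emp \<Longrightarrow> clique (bd U C') \<Longrightarrow> C' = C"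
    using min by blast
  have 1: "adj r c" if r: "r \<epsilon> bd U C" and c: "c \<epsilon> C" for r c
  proof (rule minimal_clique_boundary[OF CU A(3) C(3) min' _ c])
    show "r \<noteq> c" using r c mem_bd by blast
    show "k = r \<or> adj r k" if "k \<epsilon> bd U C" for k using that r C(3) unfolding clique_def by blast
  qed (use r in simp_all)
  have 2: "adj r c" if r: "r \<epsilon> C" and c: "c \<epsilon> C" "r \<noteq> c" for r c
  proof (rule minimal_clique_boundary[OF CU A(3) C(3) min' _ c])
    show "k = r \<or> adj r k" if "k \<epsilon> bd U C" for k using 1[OF that r] adj_sym by blast
  qed (use r in simp_all)
  obtain v where v: "v \<epsilon> C" using C(2) eq_emp by blast
  show ?thesis
  proof
    show "v \<epsilon> A" using v C(1) by (auto simp: sub_def)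
    fix x y assume xy: "x \<epsilon> U" "y \<epsilon> U" "adj x v" "adj y v" "x \<noteq> y"
    have "x \<epsilon> C \<or> x \<epsilon> bd U C" "y \<epsilon> C \<or> y \<epsilon> bd U C" using xy v adj_sym mem_bd by blast+
    then show "adj x y" using 1 2 xy(5) C(3) adj_sym unfolding clique_def by blast
  qed
qed

end

section \<open>Distance levels of a locally finite connected graph\<close>

locale rooted_graph = graph_model +
  fixes v0
  assumes root: "v0 \<epsilon> V"
    and connected: "\<And>b. b \<epsilon> V \<Longrightarrow> \<exists>n p. n \<epsilon> om \<and> isinj p (suc n) V \<and> app p emp v0 \<and> app p n b \<and>
      (\<forall>i v w. i \<epsilon> n \<and> app p i v \<and> app p (suc i) w \<longrightarrow> adj v w)"
    and locally_finite: "\<And>v. v \<epsilon> V \<Longrightarrow> \<exists>N. (\<forall>w. w \<epsilon> N \<longleftrightarrow> w \<epsilon> V \<and> adj w v) \<and> fin N"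
begin

text \<open>\<open>within n v\<close>: the distance of \<open>v\<close> from \<open>v0\<close> is at most \<open>n\<close>. The relation is the least
  subset of \<open>om \<times> V\<close> with the obvious closure property, which avoids recursion over \<open>om\<close>.\<close>

definition ball_closed :: "'a \<Rightarrow> bool" where
  "ball_closed T \<longleftrightarrow> pr emp v0 \<epsilon> T \<and> (\<forall>n v w. n \<epsilon> om \<and> pr n v \<epsilon> T \<and> w \<epsilon> V \<and> (w = v \<or> adj v w) \<longrightarrow>
     pr (suc n) w \<epsilon> T)"

lemma dfn_ball_closed [dfn_intros]: "dfun s \<Longrightarrow> dfn (\<lambda>e. ball_closed (s e))"
  by (rule dfn_app1[where P = ball_closed], unfold ball_closed_def) (intro dfn_intros)

definition within_rel :: 'a where
  "within_rel = sep (prd om V) (\<lambda>p. \<forall>T. ball_closed T \<longrightarrow> p \<epsilon> T)"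

abbreviation within :: "'a \<Rightarrow> 'a \<Rightarrow> bool" where "within n v \<equiv> pr n v \<epsilon> within_rel"

lemma within_iff: "within n v \<longleftrightarrow> n \<epsilon> om \<and> v \<epsilon> V \<and> (\<forall>T. ball_closed T \<longrightarrow> pr n v \<epsilon> T)"
  unfolding within_rel_def by (subst mem_sep) (intro dfn_intros, simp)

lemma within_dom: "within n v \<Longrightarrow> n \<epsilon> om \<and> v \<epsilon> V"
  by (simp add: within_iff)

lemma within_emp: "within emp v0"
  by (simp add: within_iff root ball_closed_def)

lemma within_step: "within n v \<Longrightarrow> w \<epsilon> V \<Longrightarrow> w = v \<or> adj v w \<Longrightarrow> within (suc n) w"
  using suc_om unfolding within_iff ball_closed_def by blast

lemma within_induct:
  assumes "within n v" and d: "dfn (\<lambda>e. P (e 0) (e (Suc 0)))" and "P emp v0"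
    and step: "\<And>n v w. n \<epsilon> om \<Longrightarrow> within n v \<Longrightarrow> P n v \<Longrightarrow> w \<epsilon> V \<Longrightarrow> w = v \<or> adj v w \<Longrightarrow> P (suc n) w"
  shows "P n v"
proof -
  define T where "T = sep within_rel (\<lambda>p. \<exists>n v. p = pr n v \<and> P n v)"
  have T: "pr n v \<epsilon> T \<longleftrightarrow> within n v \<and> P n v" for n v
    unfolding T_def by (subst mem_sep) (intro dfn_intros dfn_app2[of P, OF d], simp)
  have "ball_closed T"
    unfolding ball_closed_def T using assms(3) step within_emp within_step by blast
  then show ?thesis using assms(1) T unfolding within_iff by blast
qed

lemma within_cases:
  assumes "within n v"
  shows "n = emp \<and> v = v0 \<or> (\<exists>m u. n = suc m \<and> within m u \<and> (v = u \<or> adj u v))"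
  by (rule within_induct[OF assms], intro dfn_intros) auto

lemma within_emp_iff: "within emp v \<longleftrightarrow> v = v0"
  using within_cases within_emp by fastforce

lemma within_sucD: "within (suc n) w \<Longrightarrow> n \<epsilon> om \<Longrightarrow> \<exists>v. within n v \<and> (w = v \<or> adj v w)"
  using within_cases[of "suc n" w] within_dom suc_eq_iff by fastforce

lemma within_mono:
  assumes "within m v" "m \<epsilon> n" "n \<epsilon> om"
  shows "within n v"
proof -
  have "m \<epsilon> n \<longrightarrow> within n v" using assms(3)
  proof (induction n rule: om_induct)
    case (suc n) then show ?case using within_step[of n v v] within_dom[OF assms(1)] assms(1) by auto
  qed (intro dfn_intros, simp)
  then show ?thesis using assms(2) by blast
qed

lemma within_total:
  assumes "v \<epsilon> V"
  shows "\<exists>n. within n v"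
proof -
  obtain n p where p: "n \<epsilon> om" "isinj p (suc n) V" "app p emp v0" "app p n v"
    "\<And>i v w. i \<epsilon> n \<Longrightarrow> app p i v \<Longrightarrow> app p (suc i) w \<Longrightarrow> adj v w"
    using connected[OF assms] by blast
  have fn: "isfun p (suc n) V" using p by (simp add: isinj_def)
  have "i \<epsilon> suc n \<longrightarrow> (\<forall>u. app p i u \<longrightarrow> within i u)" if "i \<epsilon> om" for i
    using that
  proof (induction i rule: om_induct)
    case dfn show ?case by (intro dfn_intros)
  next
    case emp show ?case using isfun_unique[OF fn p(3)] within_emp by blast
  next
    case (suc i)
    show ?case
    proof (intro HOL.impI HOL.allI)
      fix u assume i: "suc i \<epsilon> suc n" and u: "app p (suc i) u"
      have "i \<epsilon> n" using i suc_mem_suc_iff suc(1) p(1) by blast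
      then obtain w where w: "app p i w" using isfun_total[OF fn] by auto
      then have "within i w" using suc \<open>i \<epsilon> n\<close> by auto
      then show "within (suc i) u"
        using within_step p(5)[OF \<open>i \<epsilon> n\<close> w u] isfun_dom[OF fn u] by blast
    qed
  qed
  then show ?thesis using p(1,4) by auto
qed

section \<open>Levels and balls\<close>

definition level :: "'a \<Rightarrow> 'a \<Rightarrow> bool" where
  "level n v \<longleftrightarrow> within n v \<and> (\<forall>m. m \<epsilon> n \<longrightarrow> \<not> within m v)"

lemma dfn_level [dfn_intros]: "dfun s \<Longrightarrow> dfun t \<Longrightarrow> dfn (\<lambda>e. level (s e) (t e))"
  by (rule dfn_app2[where R = level], unfold level_def) (intro dfn_intros)

lemma level_dom: "level n v \<Longrightarrow> n \<epsilon> om \<and> v \<epsilon> V"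
  using within_dom by (auto simp: level_def)

lemma level_exists:
  assumes "v \<epsilon> V"
  shows "\<exists>n. level n v"
proof -
  obtain n where n: "within n v" using within_total[OF assms] by blast
  have d: "dfn (\<lambda>e. within (e 0) v)" by (intro dfn_intros)
  show ?thesis
    by (rule om_least[where P = "\<lambda>n. within n v", OF conjunct1[OF within_dom[OF n]] n d])
      (auto simp: level_def)
qed

lemma level_unique: "level m v \<Longrightarrow> level n v \<Longrightarrow> m = n"
  using om_linear within_dom unfolding level_def by blast

text \<open>An edge raises the distance from the root by at most one.\<close>

lemma level_adj:
  assumes "level m u" "level n v" "adj u v" "m \<epsilon> n"
  shows "n = suc m"
proof -
  have "within m u" using assms(1) by (simp add: level_def)
  then have "within (suc m) v" using within_step level_dom assms(2,3) by blast
  then have "\<not> suc m \<epsilon> n" using assms(2) by (auto simp: level_def)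
  then show ?thesis using suc_mem_suc[of n m] assms level_dom by auto
qed

definition lev :: "'a \<Rightarrow> 'a" where "lev n = sep V (level n)"
definition ball :: "'a \<Rightarrow> 'a" where "ball n = sep V (within n)"
text \<open>Empty for \<open>n = emp\<close>, so that level 0 is covered without a predecessor
  function on \<open>om\<close>.\<close>

definition prev :: "'a \<Rightarrow> 'a" where "prev n = sep V (\<lambda>v. \<exists>m. n = suc m \<and> level m v)"

lemma mem_lev: "v \<epsilon> lev n \<longleftrightarrow> level n v"
  unfolding lev_def by (subst mem_sep) (intro dfn_intros, use level_dom in blast)

lemma mem_ball: "v \<epsilon> ball n \<longleftrightarrow> within n v"
  unfolding ball_def by (subst mem_sep) (intro dfn_intros, use within_dom in blast)

lemma mem_prev: "v \<epsilon> prev n \<longleftrightarrow> (\<exists>m. n = suc m \<and> level m v)"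
  unfolding prev_def by (subst mem_sep) (intro dfn_intros, use level_dom in blast)

lemma dfun_lev [dfn_intros]: "dfun s \<Longrightarrow> dfun (\<lambda>e. lev (s e))"
  by (rule dfun_app1[where f = lev], unfold lev_def) (intro dfn_intros)

lemma dfun_ball [dfn_intros]: "dfun s \<Longrightarrow> dfun (\<lambda>e. ball (s e))"
  by (rule dfun_app1[where f = ball], unfold ball_def) (intro dfn_intros)

lemma dfun_prev [dfn_intros]: "dfun s \<Longrightarrow> dfun (\<lambda>e. prev (s e))"
  by (rule dfun_app1[where f = prev], unfold prev_def) (intro dfn_intros)

text \<open>The next ball is covered by the neighbourhoods of the vertices of the last one; local
  finiteness bounds each of them, and \<open>fin_UN\<close> joins the bounds without choice.\<close>

lemma fin_ball:
  assumes "n \<epsilon> om"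
  shows "fin (ball n)"
  using assms
proof (induction n rule: om_induct)
  case dfn show ?case by (intro dfn_intros)
next
  case emp
  have "sub (ball emp) (ins v0 emp)" by (simp add: sub_def mem_ball within_emp_iff)
  then show ?case using fin_sub fin_ins fin_emp by blast
next
  case (suc n)
  show ?case
  proof (rule fin_UN[OF suc(2), of "\<lambda>v w. w = v \<or> adj v w"])
    show "dfn (\<lambda>e. e (Suc 0) = e 0 \<or> adj (e 0) (e (Suc 0)))" by (intro dfn_intros)
    show "\<exists>C. fin C \<and> (\<forall>w. w = v \<or> adj v w \<longrightarrow> w \<epsilon> C)" if v: "v \<epsilon> ball n" for v
    proof -
      obtain N where "\<And>w. w \<epsilon> N \<longleftrightarrow> w \<epsilon> V \<and> adj w v" "fin N"
        using locally_finite v mem_ball within_dom by metis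
      then show ?thesis using adj_V adj_sym by (intro exI[of _ "ins v N"]) (auto intro: fin_ins)
    qed
    show "\<exists>v. v \<epsilon> ball n \<and> (w = v \<or> adj v w)" if "w \<epsilon> ball (suc n)" for w
      using that within_sucD suc(1) mem_ball by blast
  qed
qed

lemma fin_lev: "n \<epsilon> om \<Longrightarrow> fin (lev n)"
  by (rule fin_sub[OF fin_ball]) (auto simp: sub_def mem_lev mem_ball level_def)

text \<open>The induction runs on the rooted statement that \<open>conn_root\<close> asks for: a set
  containing \<open>v0\<close> first swallows the smaller ball and then its neighbours.\<close>

lemma conn_ball:
  assumes "n \<epsilon> om"
  shows "conn (ball n)"
proof -
  have "\<forall>T. v0 \<epsilon> T \<and> (\<forall>u v. u \<epsilon> T \<and> u \<epsilon> ball n \<and> v \<epsilon> ball n \<and> adj u v \<longrightarrow> v \<epsilon> T) \<longrightarrow> sub (ball n) T"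
    using assms
  proof (induction n rule: om_induct)
    case dfn show ?case by (intro dfn_intros)
  next
    case emp show ?case by (simp add: sub_def mem_ball within_emp_iff)
  next
    case (suc n)
    show ?case
    proof (intro HOL.allI HOL.impI, elim conjE)
      fix T assume T: "v0 \<epsilon> T"
        "\<forall>u v. u \<epsilon> T \<and> u \<epsilon> ball (suc n) \<and> v \<epsilon> ball (suc n) \<and> adj u v \<longrightarrow> v \<epsilon> T"
      have mono: "v \<epsilon> ball (suc n)" if "v \<epsilon> ball n" for v
        using that within_mono[of n v "suc n"] suc_om[OF suc(1)] by (simp add: mem_ball)
      have "sub (ball n) T" using suc(2) T mono by blast
      then have "w \<epsilon> T" if "w \<epsilon> ball (suc n)" for w
        using that within_sucD[of n w] suc(1) T(2) mono unfolding mem_ball sub_def by metis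
      then show "sub (ball (suc n)) T" by (simp add: sub_def)
    qed
  qed
  moreover have "v0 \<epsilon> ball n"
  proof -
    have "n = emp \<or> emp \<epsilon> n" using emp_mem_suc om_cases[OF assms] by metis
    then show ?thesis using within_emp within_mono assms mem_ball by blast
  qed
  ultimately show ?thesis by (intro conn_root[of v0]) blast+
qed

section \<open>Orders of the levels\<close>

text \<open>\<open>L\<close> holds vertices that count as earlier than all of \<open>A\<close>. With
  \<open>L = prev n\<close> this is a good order of a level; with \<open>L = emp\<close> and
  \<open>A = V\<close> it is the order wanted in the end.\<close>

definition good :: "'a \<Rightarrow> 'a \<Rightarrow> 'a \<Rightarrow> bool" where
  "good L A r \<longleftrightarrow> sub r (prd A A) \<and> (\<forall>x. \<not> app r x x) \<and>
     (\<forall>x y z. app r x y \<and> app r y z \<longrightarrow> app r x z) \<and>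
     (\<forall>x y. x \<epsilon> A \<and> y \<epsilon> A \<and> x \<noteq> y \<longrightarrow> app r x y \<or> app r y x) \<and>
     (\<forall>v x y. v \<epsilon> A \<and> (x \<epsilon> L \<or> app r x v) \<and> (y \<epsilon> L \<or> app r y v) \<and> adj x v \<and> adj y v \<and> x \<noteq> y \<longrightarrow> adj x y)"

lemma dfn_good [dfn_intros]:
  "dfun f \<Longrightarrow> dfun s \<Longrightarrow> dfun t \<Longrightarrow> dfn (\<lambda>e. good (f e) (s e) (t e))"
  by (rule dfn_app3[where R = good], unfold good_def) (intro dfn_intros)

text \<open>A boundary vertex cannot lie in \<open>A\<close>, where the component would absorb it,
  so it is on the level before \<open>n\<close>. Unless that is level 0, it also has a neighbour in
  the ball of the next smaller radius, and \<open>separator_clique\<close> applies to this ball and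
  the component.\<close>

lemma boundary_component_clique:
  assumes A: "sub A (lev n)" "a \<epsilon> A"
  shows "clique (bd (un (prev n) A) (comp A a))"
  unfolding clique_def
proof (intro HOL.allI HOL.impI, elim conjE)
  let ?C = "comp A a" and ?U = "un (prev n) A"
  have C: "c \<epsilon> A \<and> level n c" if "c \<epsilon> ?C" for c
    using that A(1) mem_comp mem_lev by (auto simp: sub_def)
  have bd: "\<exists>c m. level m x \<and> n = suc m \<and> c \<epsilon> ?C \<and> adj x c \<and> \<not> x \<epsilon> ?C" if x: "x \<epsilon> bd ?U ?C" for x
  proof -
    obtain c where c: "x \<epsilon> ?U" "\<not> x \<epsilon> ?C" "c \<epsilon> ?C" "adj c x"
      using x unfolding mem_bd by blast
    then have "\<not> x \<epsilon> A" using comp_step by blast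
    then obtain m where "n = suc m" "level m x" using c(1) mem_prev by auto
    then show ?thesis using c adj_sym by blast
  qed
  fix x y assume "x \<epsilon> bd ?U ?C" "y \<epsilon> bd ?U ?C" and xy: "x \<noteq> y"
  then obtain m c c' where x: "level m x" "n = suc m" "c \<epsilon> ?C" "adj x c" "\<not> x \<epsilon> ?C"
    and y: "level m y" "c' \<epsilon> ?C" "adj y c'" "\<not> y \<epsilon> ?C"
    using bd suc_eq_iff level_dom by metis
  have m: "m \<epsilon> om" using x level_dom by blast
  then show "adj x y"
  proof (cases rule: om_cases)
    \<comment> \<open>Level 0 is \<open>v0\<close> alone, so two distinct boundary vertices cannot
      exist.\<close>
    case 1
    then show ?thesis using x y xy within_emp_iff by (auto simp: level_def)
  next
    case (2 k)
    have down: "\<exists>d. d \<epsilon> ball k \<and> adj z d" if "level m z" for z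
    proof -
      have "within (suc k) z" "\<not> within k z" using that 2 by (auto simp: level_def)
      then show ?thesis using within_sucD 2(1) adj_sym mem_ball by blast
    qed
    obtain d d' where d: "d \<epsilon> ball k" "adj x d" "d' \<epsilon> ball k" "adj y d'" using down x(1) y(1) by blast
    \<comment> \<open>Here \<open>n = k + 2\<close>: an edge from \<open>ball k\<close> to
      \<open>c\<close> would put \<open>c\<close> within \<open>suc k\<close>.\<close>
    have far: "\<not> within (suc k) c" "\<not> within k c" if "c \<epsilon> ?C" for c
      using C[OF that] x(2) 2(2) by (auto simp: level_def)
    show ?thesis
    proof (rule separator_clique[OF conn_comp[OF A(2)] conn_ball[OF 2(1)],
          where c = c and c' = c' and d = d and d' = d'])
      show "\<not> c \<epsilon> ball k" if "c \<epsilon> ?C" for c using far[OF that] mem_ball by blast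
      show "\<not> adj c d" if "c \<epsilon> ?C" "d \<epsilon> ball k" for c d
        using that far[OF that(1)] within_step mem_ball adj_sym adj_V by blast
      show "\<not> x \<epsilon> ball k" "\<not> y \<epsilon> ball k" using x(1) y(1) 2(2) mem_ball by (auto simp: level_def)
    qed (use x y xy d level_dom in blast)+
  qed
qed

text \<open>With \<open>v\<close> last, the earlier vertices of all others stay the same, and those
  of \<open>v\<close> are the whole of \<open>L\<close> and \<open>A\<close>.\<close>

lemma good_insert:
  assumes good: "good L A r" and v: "\<not> v \<epsilon> A" "\<not> v \<epsilon> L"
    and simp: "\<And>x y. x \<epsilon> un L A \<Longrightarrow> y \<epsilon> un L A \<Longrightarrow> adj x v \<Longrightarrow> adj y v \<Longrightarrow> x \<noteq> y \<Longrightarrow> adj x y"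
  shows "good L (ins v A) (un r (prd A (upair v v)))"
proof -
  have app: "app (un r (prd A (upair v v))) x y \<longleftrightarrow> app r x y \<or> x \<epsilon> A \<and> y = v" for x y
    by (simp add: app_def)
  have dom: "x \<epsilon> A \<and> y \<epsilon> A" if "app r x y" for x y
    using good that unfolding good_def sub_def app_def by (metis pr_prd_iff)
  have g: "\<not> app r x x" "app r x y \<Longrightarrow> app r y z \<Longrightarrow> app r x z"
    "x \<epsilon> A \<Longrightarrow> y \<epsilon> A \<Longrightarrow> x \<noteq> y \<Longrightarrow> app r x y \<or> app r y x"
    "u \<epsilon> A \<Longrightarrow> x \<epsilon> L \<or> app r x u \<Longrightarrow> y \<epsilon> L \<or> app r y u \<Longrightarrow> adj x u \<Longrightarrow> adj y u \<Longrightarrow> x \<noteq> y \<Longrightarrow> adj x y"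
    for x y z u using good unfolding good_def by blast+
  show ?thesis
    unfolding good_def app
  proof (intro conjI HOL.allI HOL.impI)
    have "sub r (prd A A)" using good by (simp add: good_def)
    then show "sub (un r (prd A (upair v v))) (prd (ins v A) (ins v A))"
      unfolding sub_prd by (auto simp: prd_iff)
    show "\<not> (app r x x \<or> x \<epsilon> A \<and> x = v)" for x using g(1) v by blast
    show "app r x z \<or> x \<epsilon> A \<and> z = v"
      if "(app r x y \<or> x \<epsilon> A \<and> y = v) \<and> (app r y z \<or> y \<epsilon> A \<and> z = v)" for x y z
      using that g(2) dom v by blast
    show "(app r x y \<or> x \<epsilon> A \<and> y = v) \<or> app r y x \<or> y \<epsilon> A \<and> x = v"
      if "x \<epsilon> ins v A \<and> y \<epsilon> ins v A \<and> x \<noteq> y" for x y using that g(3) by auto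
    show "adj x y" if "u \<epsilon> ins v A \<and> (x \<epsilon> L \<or> app r x u \<or> x \<epsilon> A \<and> u = v) \<and>
      (y \<epsilon> L \<or> app r y u \<or> y \<epsilon> A \<and> u = v) \<and> adj x u \<and> adj y u \<and> x \<noteq> y" for u x y
    proof (cases "u = v")
      case True
      then have "x \<epsilon> un L A" "y \<epsilon> un L A" using that dom by auto
      then show ?thesis using simp True that by blast
    next
      case False
      then show ?thesis using that g(4)[of u x y] by auto
    qed
  qed
qed

text \<open>A minimal subset of the level without a good order takes the place of a recursion that
  strips off last vertices one at a time.\<close>

lemma good_exists:
  assumes n: "n \<epsilon> om"
  shows "\<exists>r. good (prev n) (lev n) r"
proof (rule ccontr)
  assume no: "\<not> ?thesis"
  have d: "dfn (\<lambda>e. \<not> (\<exists>r. good (prev n) (e 0) r))" by (intro dfn_intros)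
  have sub_refl: "sub (lev n) (lev n)" by (simp add: sub_def)
  obtain A where A: "\<not> (\<exists>r. good (prev n) A r)" "sub A (lev n)"
    and min: "\<And>D. \<not> (\<exists>r. good (prev n) D r) \<Longrightarrow> sub D A \<Longrightarrow> D = A"
    by (rule fin_minimal[where P = "\<lambda>A. \<not> (\<exists>r. good (prev n) A r)", OF fin_lev[OF n] d sub_refl no])
      (rule that)
  have "good (prev n) emp emp" by (simp add: good_def sub_def)
  then have "A \<noteq> emp" using A(1) by blast
  then obtain a where a: "a \<epsilon> A" using eq_emp by blast
  let ?U = "un (prev n) A"
  have lv: "level n x" if "x \<epsilon> A" for x using that A(2) mem_lev by (auto simp: sub_def)
  have comp: "sub (comp A a) A" "comp A a \<noteq> emp"
    using comp_refl[OF a] emp_iff mem_comp unfolding sub_def by metis+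
  have U: "sub A ?U" "sub ?U V" using lv level_dom mem_prev by (auto simp: sub_def)
  obtain v where v: "v \<epsilon> A"
    "\<And>x y. x \<epsilon> ?U \<Longrightarrow> y \<epsilon> ?U \<Longrightarrow> adj x v \<Longrightarrow> adj y v \<Longrightarrow> x \<noteq> y \<Longrightarrow> adj x y"
    by (rule simplicial_vertex[OF fin_sub[OF fin_lev[OF n] A(2)] U comp
          boundary_component_clique[OF A(2) a]]) (rule that)
  let ?A = "diff A (upair v v)"
  have "?A \<noteq> A" using v(1) by (metis diff_iff upair_iff)
  moreover have "sub ?A A" by (simp add: sub_def)
  ultimately obtain r where r: "good (prev n) ?A r" using min by blast
  have "\<not> v \<epsilon> prev n"
    using lv[OF v(1)] level_unique mem_prev n by (metis ins_iff level_dom om_irrefl)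
  then have "good (prev n) (ins v ?A) (un r (prd ?A (upair v v)))"
    using v(2) by (intro good_insert[OF r]) auto
  moreover have "ins v ?A = A" using v(1) by (intro extensionality) auto
  ultimately show False using A(1) by metis
qed

section \<open>The family of sets of good orders\<close>

definition orders :: "'a \<Rightarrow> 'a" where
  "orders n = sep (pow (prd (lev n) (lev n))) (good (prev n) (lev n))"

text \<open>Tagging with \<open>n\<close> makes the family injective even if several levels are empty.\<close>

definition tagged_orders :: "'a \<Rightarrow> 'a" where "tagged_orders n = prd (upair n n) (orders n)"

text \<open>The outer power set is what separation takes the family from;
  \<open>mem_order_family\<close> checks that it contains every member.\<close>

definition order_family :: 'a where
  "order_family = sep (pow (prd om (pow (prd V V)))) (\<lambda>A. \<exists>n. n \<epsilon> om \<and> A = tagged_orders n)"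

lemma mem_orders: "r \<epsilon> orders n \<longleftrightarrow> good (prev n) (lev n) r"
  unfolding orders_def by (subst mem_sep) (intro dfn_intros, auto simp: good_def)

lemma dfun_orders [dfn_intros]: "dfun s \<Longrightarrow> dfun (\<lambda>e. orders (s e))"
  by (rule dfun_app1[where f = orders], unfold orders_def) (intro dfn_intros)

lemma dfun_tagged_orders [dfn_intros]: "dfun s \<Longrightarrow> dfun (\<lambda>e. tagged_orders (s e))"
  unfolding tagged_orders_def by (intro dfn_intros)

lemma mem_tagged_orders:
  "p \<epsilon> tagged_orders n \<longleftrightarrow> (\<exists>r. p = pr n r \<and> good (prev n) (lev n) r)"
  by (auto simp: tagged_orders_def prd_iff mem_orders)

lemma mem_order_family: "A \<epsilon> order_family \<longleftrightarrow> (\<exists>n. n \<epsilon> om \<and> A = tagged_orders n)"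
proof -
  have "sub (tagged_orders n) (prd om (pow (prd V V)))" if "n \<epsilon> om" for n
  proof -
    have "sub r (prd V V)" if "good (prev n) (lev n) r" for r
    proof -
      have "sub r (prd (lev n) (lev n))" using that by (simp add: good_def)
      then show ?thesis using level_dom unfolding sub_prd mem_lev by blast
    qed
    then show ?thesis using that by (auto simp: sub_def mem_tagged_orders)
  qed
  then show ?thesis unfolding order_family_def
    by (subst mem_sep) (intro dfn_intros, auto)
qed

lemma tagged_orders_inject:
  assumes "m \<epsilon> om" "tagged_orders m = tagged_orders n"
  shows "m = n"
proof -
  obtain r where "good (prev m) (lev m) r" using good_exists[OF assms(1)] by blast
  then have "pr m r \<epsilon> tagged_orders n" using assms(2) mem_tagged_orders by metis
  then show ?thesis by (auto simp: mem_tagged_orders)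
qed

lemma denumerable_order_family: "\<exists>f. isbij f om order_family"
proof -
  define f where "f = sep (prd om order_family) (\<lambda>p. \<exists>n. p = pr n (tagged_orders n))"
  have mem: "p \<epsilon> f \<longleftrightarrow> p \<epsilon> prd om order_family \<and> (\<exists>n. p = pr n (tagged_orders n))" for p
    unfolding f_def by (subst mem_sep) (intro dfn_intros, rule refl)
  have app: "app f n A \<longleftrightarrow> n \<epsilon> om \<and> A = tagged_orders n" for n A
    unfolding app_def mem using mem_order_family by auto
  have "isfun f om order_family"
    by (rule isfunI) (auto simp: app, auto simp: sub_def mem)
  then have "isbij f om order_family"
    unfolding isbij_def isinj_def app using tagged_orders_inject mem_order_family by blast
  then show ?thesis by blast
qed

lemma order_family_members:
  assumes "A \<epsilon> order_family"
  shows "fin A \<and> A \<noteq> emp"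
proof -
  obtain n where n: "n \<epsilon> om" "A = tagged_orders n" using assms mem_order_family by blast
  have "fin (orders n)"
    by (rule fin_sub[OF fin_pow[OF fin_prd[OF fin_lev[OF n(1)] fin_lev[OF n(1)]]]])
      (auto simp: sub_def mem_orders good_def)
  moreover have "fin (upair n n)"
    by (rule fin_sub[OF fin_ins[OF fin_emp, of n]]) (simp add: sub_def)
  ultimately have "fin A" unfolding n(2) tagged_orders_def by (intro fin_prd)
  moreover have "A \<noteq> emp"
    using good_exists[OF n(1)] mem_tagged_orders emp_iff unfolding n(2) by metis
  ultimately show ?thesis by blast
qed

text \<open>An earlier neighbour of \<open>v\<close> lies on the level of \<open>v\<close> or on the preceding one.\<close>

lemma order_exists:
  assumes f: "isfun f order_family U" "\<And>A x. app f A x \<Longrightarrow> x \<epsilon> A"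
  shows "\<exists>r. good emp V r"
proof -
  \<comment> \<open>The value of \<open>f\<close> at a member of the family is a tagged pair; its
    second component \<open>s\<close> orders the level.\<close>
  define less where "less u v \<longleftrightarrow> (\<exists>m n. level m u \<and> level n v \<and>
    (m \<epsilon> n \<or> m = n \<and> (\<exists>s. app f (tagged_orders n) (pr n s) \<and> app s u v)))" for u v
  have dless: "dfun s \<Longrightarrow> dfun t \<Longrightarrow> dfn (\<lambda>e. less (s e) (t e))" for s t
    by (rule dfn_app2[where R = less], unfold less_def) (intro dfn_intros)
  define r where "r = sep (prd V V) (\<lambda>p. \<exists>u v. p = pr u v \<and> less u v)"
  have mem: "p \<epsilon> r \<longleftrightarrow> p \<epsilon> prd V V \<and> (\<exists>u v. p = pr u v \<and> less u v)" for p
    unfolding r_def by (subst mem_sep) (intro dfn_intros dless, rule refl)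
  have "u \<epsilon> V \<and> v \<epsilon> V" if "less u v" for u v using that level_dom by (auto simp: less_def)
  then have app: "app r u v \<longleftrightarrow> less u v" for u v unfolding app_def mem by auto
  have "\<exists>s. app f (tagged_orders n) (pr n s) \<and> good (prev n) (lev n) s" if n: "n \<epsilon> om" for n
  proof -
    obtain x where x: "app f (tagged_orders n) x"
      using isfun_total[OF f(1)] n mem_order_family by blast
    then show ?thesis using f(2)[OF x] unfolding mem_tagged_orders by blast
  qed
  \<comment> \<open>\<open>s\<close> is a function outside the model and only shortens the argument:
    definability of \<open>less\<close> rests on \<open>f\<close>, which is a set of the
    model.\<close>
  then obtain s where s: "\<And>n. n \<epsilon> om \<Longrightarrow> app f (tagged_orders n) (pr n (s n))"
    "\<And>n. n \<epsilon> om \<Longrightarrow> good (prev n) (lev n) (s n)" by metis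
  have less: "less u v \<longleftrightarrow> m \<epsilon> n \<or> m = n \<and> app (s n) u v" if "level m u" "level n v" for u v m n
  proof -
    have "t = s n" if "app f (tagged_orders n) (pr n t)" for t
      using isfun_unique[OF f(1) that s(1)] level_dom \<open>level n v\<close> by auto
    then show ?thesis unfolding less_def using that level_unique s(1) level_dom by metis
  qed
  have g: "\<not> app (s n) x x" "app (s n) x y \<Longrightarrow> app (s n) y z \<Longrightarrow> app (s n) x z"
    "level n x \<Longrightarrow> level n y \<Longrightarrow> x \<noteq> y \<Longrightarrow> app (s n) x y \<or> app (s n) y x"
    "level n u \<Longrightarrow> x \<epsilon> prev n \<or> app (s n) x u \<Longrightarrow> y \<epsilon> prev n \<or> app (s n) y u \<Longrightarrow>
      adj x u \<Longrightarrow> adj y u \<Longrightarrow> x \<noteq> y \<Longrightarrow> adj x y"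
    if "n \<epsilon> om" for n x y z u using s(2)[OF that] unfolding good_def mem_lev by blast+
  have lv: "\<exists>n. level n x \<and> n \<epsilon> om" if "less x y \<or> less y x \<or> x \<epsilon> V" for x y
    using that level_exists level_dom unfolding less_def by blast
  have "good emp V r"
    unfolding good_def app
  proof (intro conjI HOL.allI HOL.impI)
    show "sub r (prd V V)" by (simp add: sub_def mem)
    show "\<not> less x x" for x
      using lv[of x x] less[of _ x _ x] g(1) om_irrefl by blast
    show "less x z" if xyz: "less x y \<and> less y z" for x y z
    proof -
      obtain k m n where k: "level k x" "level m y" "level n z" "k \<epsilon> om" "m \<epsilon> om" "n \<epsilon> om"
        using lv xyz by meson
      then show ?thesis using xyz less g(2) om_trans by metis
    qed
    show "less x y \<or> less y x" if xy: "x \<epsilon> V \<and> y \<epsilon> V \<and> x \<noteq> y" for x y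
    proof -
      obtain m n where m: "level m x" "level n y" "m \<epsilon> om" "n \<epsilon> om" using lv xy by meson
      then show ?thesis using xy less g(3) om_linear by metis
    qed
    show "adj x y" if a: "v \<epsilon> V \<and> (x \<epsilon> emp \<or> less x v) \<and> (y \<epsilon> emp \<or> less y v) \<and>
        adj x v \<and> adj y v \<and> x \<noteq> y" for v x y
    proof -
      obtain n where n: "level n v" "n \<epsilon> om" using lv a by blast
      have "x \<epsilon> prev n \<or> app (s n) x v" if x: "less x v" "adj x v" for x
      proof -
        obtain m where m: "level m x" using lv x by blast
        then show ?thesis
          using less[OF m n(1)] x level_adj[OF m n(1) x(2)] mem_prev by blast
      qed
      then show ?thesis using g(4)[OF n(2,1)] a emp_iff by blast
    qed
  qed
  then show ?thesis by blast
qed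

end

section \<open>Translation of the formulas and the main theorem\<close>

context zf_model
begin

lemma sat_is_subset [simp]:
  "x < d \<Longrightarrow> y < d \<Longrightarrow> sat (\<epsilon>) (=) e (is_subset x y d) \<longleftrightarrow> sub (look e d x) (look e d y)"
  by (simp add: is_subset_def sub_def)

lemma sat_is_upair [simp]: "p < d \<Longrightarrow> x < d \<Longrightarrow> y < d \<Longrightarrow>
    sat (\<epsilon>) (=) e (is_upair p x y d) \<longleftrightarrow> look e d p = upair (look e d x) (look e d y)"
  using extensionality[of "look e d p" "upair (look e d x) (look e d y)"]
  by (auto simp: is_upair_def)

lemma sat_is_pair [simp]: "p < d \<Longrightarrow> x < d \<Longrightarrow> y < d \<Longrightarrow>
    sat (\<epsilon>) (=) e (is_pair p x y d) \<longleftrightarrow> look e d p = pr (look e d x) (look e d y)"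
  using extensionality[of "look e d p" "pr (look e d x) (look e d y)"]
  by (auto simp: is_pair_def pr_def)

lemma sat_is_union [simp]:
  "x < d \<Longrightarrow> y < d \<Longrightarrow> sat (\<epsilon>) (=) e (is_union x y d) \<longleftrightarrow> look e d x = cup (look e d y)"
  using extensionality[of "look e d x" "cup (look e d y)"] by (auto simp: is_union_def cup_iff)

text \<open>Two least inductive sets include each other, so the quantified \<open>w\<close> in
  \<open>is_finite\<close> and similar formulas can only be \<open>om\<close>.\<close>

lemma sat_is_omega [simp]: "x < d \<Longrightarrow> sat (\<epsilon>) (=) e (is_omega x d) \<longleftrightarrow> look e d x = om"
proof -
  have "indset om" by (simp add: indset_def suc_om)
  moreover have "sub om u" if "indset u" for u using that by (auto simp: sub_def om_iff)
  moreover assume "x < d"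
  ultimately show ?thesis by (auto simp: is_omega_def intro: sub_antisym)
qed

lemma sat_rel [simp]: "r < d \<Longrightarrow> x < d \<Longrightarrow> y < d \<Longrightarrow>
    sat (\<epsilon>) (=) e (rel r x y d) \<longleftrightarrow> app (look e d r) (look e d x) (look e d y)"
  by (simp add: rel_def app_def)

lemma sat_is_relation [simp]: "r < d \<Longrightarrow> x < d \<Longrightarrow> y < d \<Longrightarrow>
    sat (\<epsilon>) (=) e (is_relation r x y d) \<longleftrightarrow> sub (look e d r) (prd (look e d x) (look e d y))"
  by (simp add: is_relation_def sub_prd)

lemma sat_is_function [simp]: "f < d \<Longrightarrow> x < d \<Longrightarrow> y < d \<Longrightarrow>
    sat (\<epsilon>) (=) e (is_function f x y d) \<longleftrightarrow> isfun (look e d f) (look e d x) (look e d y)"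
  by (simp add: is_function_def isfun_def)

lemma sat_is_injection [simp]: "f < d \<Longrightarrow> x < d \<Longrightarrow> y < d \<Longrightarrow>
    sat (\<epsilon>) (=) e (is_injection f x y d) \<longleftrightarrow> isinj (look e d f) (look e d x) (look e d y)"
  by (simp add: is_injection_def isinj_def)

lemma sat_is_bijection [simp]: "f < d \<Longrightarrow> x < d \<Longrightarrow> y < d \<Longrightarrow>
    sat (\<epsilon>) (=) e (is_bijection f x y d) \<longleftrightarrow> isbij (look e d f) (look e d x) (look e d y)"
  by (simp add: is_bijection_def isbij_def)

lemma sat_is_finite [simp]: "x < d \<Longrightarrow> sat (\<epsilon>) (=) e (is_finite x d) \<longleftrightarrow> fin (look e d x)"
  by (simp add: is_finite_def fin_def)

lemma sat_is_denumerable [simp]: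
  "x < d \<Longrightarrow> sat (\<epsilon>) (=) e (is_denumerable x d) \<longleftrightarrow> (\<exists>f. isbij f om (look e d x))"
  by (simp add: is_denumerable_def)

lemma sat_edge [simp]: "X < d \<Longrightarrow> x < d \<Longrightarrow> y < d \<Longrightarrow>
    sat (\<epsilon>) (=) e (edge X x y d) \<longleftrightarrow> upair (look e d x) (look e d y) \<epsilon> look e d X"
  by (simp add: edge_def)

lemma sat_AC_fin_omega: "sat (\<epsilon>) (=) e (AC_fin_omega d) \<longleftrightarrow>
    (\<forall>F. (\<exists>f. isbij f om F) \<and> (\<forall>A. A \<epsilon> F \<longrightarrow> fin A \<and> A \<noteq> emp) \<longrightarrow>
      (\<exists>f. isfun f F (cup F) \<and> (\<forall>A x. app f A x \<longrightarrow> x \<epsilon> A)))"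
  by (simp add: AC_fin_omega_def)

lemma sat_is_graph: "V < d \<Longrightarrow> X < d \<Longrightarrow> sat (\<epsilon>) (=) e (is_graph V X d) \<longleftrightarrow>
    (\<forall>a. a \<epsilon> look e d X \<longrightarrow>
      (\<exists>v w. v \<epsilon> look e d V \<and> w \<epsilon> look e d V \<and> v \<noteq> w \<and> a = upair v w))"
  by (simp add: is_graph_def)

lemma sat_is_locally_finite: "V < d \<Longrightarrow> X < d \<Longrightarrow> sat (\<epsilon>) (=) e (is_locally_finite V X d) \<longleftrightarrow>
    (\<forall>v. v \<epsilon> look e d V \<longrightarrow>
      (\<exists>N. (\<forall>w. w \<epsilon> N \<longleftrightarrow> w \<epsilon> look e d V \<and> upair w v \<epsilon> look e d X) \<and> fin N))"
  by (simp add: is_locally_finite_def)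

lemma sat_is_connected: "V < d \<Longrightarrow> X < d \<Longrightarrow> sat (\<epsilon>) (=) e (is_connected V X d) \<longleftrightarrow>
    (\<forall>a b. a \<epsilon> look e d V \<and> b \<epsilon> look e d V \<longrightarrow>
      (\<exists>n p. n \<epsilon> om \<and> isinj p (suc n) (look e d V) \<and> app p emp a \<and> app p n b \<and>
        (\<forall>i v w. i \<epsilon> n \<and> app p i v \<and> app p (suc i) w \<longrightarrow> upair v w \<epsilon> look e d X)))"
  by (simp add: is_connected_def is_path_def)

lemma sat_is_chordal: "V < d \<Longrightarrow> X < d \<Longrightarrow> sat (\<epsilon>) (=) e (is_chordal V X d) \<longleftrightarrow>
    \<not> (\<exists>n c. n \<epsilon> om \<and> suc (suc (suc emp)) \<epsilon> n \<and> isinj c n (look e d V) \<and>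
      (\<forall>i j v w. i \<epsilon> n \<and> j \<epsilon> n \<and> app c i v \<and> app c j w \<longrightarrow> (upair v w \<epsilon> look e d X \<longleftrightarrow>
        i = suc j \<or> j = suc i \<or> i = emp \<and> n = suc j \<or> j = emp \<and> n = suc i)))"
  by (simp add: is_chordal_def at_least_four_def is_induced_circuit_def circuit_adjacent_def)

lemma sat_is_total_order: "V < d \<Longrightarrow> r < d \<Longrightarrow> sat (\<epsilon>) (=) e (is_total_order V r d) \<longleftrightarrow>
    sub (look e d r) (prd (look e d V) (look e d V)) \<and> (\<forall>x. \<not> app (look e d r) x x) \<and>
    (\<forall>x y z. app (look e d r) x y \<and> app (look e d r) y z \<longrightarrow> app (look e d r) x z) \<and>
    (\<forall>x y. x \<epsilon> look e d V \<and> y \<epsilon> look e d V \<and> x \<noteq> y \<longrightarrow>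
      app (look e d r) x y \<or> app (look e d r) y x)"
  by (simp add: is_total_order_def)

lemma sat_smaller_neighbours_cliques: "V < d \<Longrightarrow> X < d \<Longrightarrow> r < d \<Longrightarrow>
    sat (\<epsilon>) (=) e (smaller_neighbours_cliques V X r d) \<longleftrightarrow>
    (\<forall>v. v \<epsilon> look e d V \<longrightarrow> (\<exists>K. (\<forall>w. w \<epsilon> K \<longleftrightarrow>
        w \<epsilon> look e d V \<and> app (look e d r) w v \<and> upair w v \<epsilon> look e d X) \<and>
      sub K (look e d V) \<and> (\<forall>x y. x \<epsilon> K \<and> y \<epsilon> K \<and> x \<noteq> y \<longrightarrow> upair x y \<epsilon> look e d X)))"
  by (simp add: smaller_neighbours_cliques_def is_clique_def)

lemma elimination_order:
  assumes ac: "\<forall>F. (\<exists>f. isbij f om F) \<and> (\<forall>A. A \<epsilon> F \<longrightarrow> fin A \<and> A \<noteq> emp) \<longrightarrow>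
      (\<exists>f. isfun f F (cup F) \<and> (\<forall>A x. app f A x \<longrightarrow> x \<epsilon> A))"
    and graph: "\<forall>e. e \<epsilon> X \<longrightarrow> (\<exists>v w. v \<epsilon> V \<and> w \<epsilon> V \<and> v \<noteq> w \<and> e = upair v w)"
    and connected: "\<forall>a b. a \<epsilon> V \<and> b \<epsilon> V \<longrightarrow> (\<exists>n p. n \<epsilon> om \<and> isinj p (suc n) V \<and> app p emp a \<and>
      app p n b \<and> (\<forall>i v w. i \<epsilon> n \<and> app p i v \<and> app p (suc i) w \<longrightarrow> upair v w \<epsilon> X))"
    and locally_finite: "\<forall>v. v \<epsilon> V \<longrightarrow> (\<exists>N. (\<forall>w. w \<epsilon> N \<longleftrightarrow> w \<epsilon> V \<and> upair w v \<epsilon> X) \<and> fin N)"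
    and chordal: "\<not> (\<exists>n c. n \<epsilon> om \<and> suc (suc (suc emp)) \<epsilon> n \<and> isinj c n V \<and>
      (\<forall>i j v w. i \<epsilon> n \<and> j \<epsilon> n \<and> app c i v \<and> app c j w \<longrightarrow> (upair v w \<epsilon> X \<longleftrightarrow>
        i = suc j \<or> j = suc i \<or> i = emp \<and> n = suc j \<or> j = emp \<and> n = suc i)))"
  obtains r where "sub r (prd V V) \<and> (\<forall>x. \<not> app r x x) \<and>
      (\<forall>x y z. app r x y \<and> app r y z \<longrightarrow> app r x z) \<and>
      (\<forall>x y. x \<epsilon> V \<and> y \<epsilon> V \<and> x \<noteq> y \<longrightarrow> app r x y \<or> app r y x)"
    "\<forall>v. v \<epsilon> V \<longrightarrow> (\<exists>K. (\<forall>w. w \<epsilon> K \<longleftrightarrow> w \<epsilon> V \<and> app r w v \<and> upair w v \<epsilon> X) \<and> sub K V \<and>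
      (\<forall>x y. x \<epsilon> K \<and> y \<epsilon> K \<and> x \<noteq> y \<longrightarrow> upair x y \<epsilon> X))"
\<comment> \<open>Levels need a root, which the empty graph lacks; there the empty relation is the
  order.\<close>
proof (cases "V = emp")
  case True
  then show ?thesis by (intro that[of emp]) (simp_all add: sub_def)
next
  case False
  then obtain v0 where v0: "v0 \<epsilon> V" using eq_emp by blast
  interpret rooted_graph "(\<epsilon>)" V X v0
  proof unfold_locales
    show "\<exists>v w. v \<epsilon> V \<and> w \<epsilon> V \<and> v \<noteq> w \<and> e = upair v w" if "e \<epsilon> X" for e
      using graph that by blast
    show "\<not> (\<exists>n c. n \<epsilon> om \<and> suc (suc (suc emp)) \<epsilon> n \<and> isinj c n V \<and>
      (\<forall>i j v w. i \<epsilon> n \<and> j \<epsilon> n \<and> app c i v \<and> app c j w \<longrightarrow> (upair v w \<epsilon> X \<longleftrightarrow>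
        i = suc j \<or> j = suc i \<or> i = emp \<and> n = suc j \<or> j = emp \<and> n = suc i)))"
      by fact
    show "v0 \<epsilon> V" by fact
    show "\<exists>n p. n \<epsilon> om \<and> isinj p (suc n) V \<and> app p emp v0 \<and> app p n b \<and>
        (\<forall>i v w. i \<epsilon> n \<and> app p i v \<and> app p (suc i) w \<longrightarrow> upair v w \<epsilon> X)" if "b \<epsilon> V" for b
      using connected that v0 by simp
    show "\<exists>N. (\<forall>w. w \<epsilon> N \<longleftrightarrow> w \<epsilon> V \<and> upair w v \<epsilon> X) \<and> fin N" if "v \<epsilon> V" for v
      using locally_finite that by simp
  qed
  obtain f where "isfun f order_family (cup order_family)" "\<And>A x. app f A x \<Longrightarrow> x \<epsilon> A"
    using ac denumerable_order_family order_family_members by blast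
  then obtain r where r: "good emp V r" using order_exists by blast
  have "\<exists>K. (\<forall>w. w \<epsilon> K \<longleftrightarrow> w \<epsilon> V \<and> app r w v \<and> adj w v) \<and> sub K V \<and>
      (\<forall>x y. x \<epsilon> K \<and> y \<epsilon> K \<and> x \<noteq> y \<longrightarrow> adj x y)" if v: "v \<epsilon> V" for v
  proof -
    \<comment> \<open>The conclusion wants the smaller neighbours as a set of the model, which
      separation provides.\<close>
    have "dfn (\<lambda>e. app r (e 0) v \<and> adj (e 0) v)" by (intro dfn_intros)
    then obtain K where K: "\<And>w. w \<epsilon> K \<longleftrightarrow> w \<epsilon> V \<and> app r w v \<and> adj w v"
      using separation[of "\<lambda>w. app r w v \<and> adj w v" V] by blast
    moreover have "adj x y" if "x \<epsilon> K" "y \<epsilon> K" "x \<noteq> y" for x y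
      using that r v unfolding K good_def by blast
    ultimately show ?thesis unfolding sub_def by blast
  qed
  then show ?thesis using r unfolding good_def by (intro that[of r]) blast+
qed

end

theorem proposition3p8:
  shows "ZF \<turnstile> closed_form (AC_fin_omega \<^bold>\<longrightarrow>
    (\<^bold>\<forall>V X. is_graph V X \<^bold>\<and> is_connected V X \<^bold>\<and> is_locally_finite V X \<^bold>\<and> is_chordal V X \<^bold>\<longrightarrow>
      (\<^bold>\<exists>r. is_total_order V r \<^bold>\<and> smaller_neighbours_cliques V X r)))"
  (is "ZF \<turnstile> ?p")
proof (rule completeness[OF sentence_ZF _ ZF_models_infinite])
  show "sentence ?p"
    by (simp add: sentence_def closed_form_def AC_fin_omega_def is_graph_def is_connected_def
        is_locally_finite_def is_chordal_def is_total_order_def smaller_neighbours_cliques_def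
        is_clique_def circuit_adjacent_def is_induced_circuit_def at_least_four_def is_path_def
        edge_def is_denumerable_def is_finite_def is_bijection_def is_injection_def is_function_def
        is_relation_def rel_def is_omega_def is_inductive_def is_succ_def is_union_def is_pair_def
        is_upair_def is_empty_def is_subset_def fm_defs)
next
  fix E :: "nat \<Rightarrow> nat \<Rightarrow> bool" and e
  assume "\<And>q e. q \<in> ZF \<Longrightarrow> sat E (=) e q"
  then interpret zf_model E by unfold_locales
  show "sat E (=) e ?p"
    unfolding closed_form_def sat_fm
  proof (intro HOL.impI HOL.allI, elim conjE)
    fix V X
    \<comment> \<open>\<open>V\<close> is bound at level 0 and \<open>X\<close> at level 1, while
      the environment lists the innermost variable first.\<close>
    let ?e = "case_nat X (case_nat V e)" and ?d = "Suc (Suc 0)"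
    assume ac: "sat E (=) e (AC_fin_omega 0)" and graph: "sat E (=) ?e (is_graph 0 (Suc 0) ?d)"
      and connected: "sat E (=) ?e (is_connected 0 (Suc 0) ?d)"
      and locally_finite: "sat E (=) ?e (is_locally_finite 0 (Suc 0) ?d)"
      and chordal: "sat E (=) ?e (is_chordal 0 (Suc 0) ?d)"
    have d: "0 < ?d" "Suc 0 < ?d" and look: "look ?e ?d 0 = V" "look ?e ?d (Suc 0) = X" by simp_all
    obtain r where r: "sub r (prd V V) \<and> (\<forall>x. \<not> app r x x) \<and>
        (\<forall>x y z. app r x y \<and> app r y z \<longrightarrow> app r x z) \<and>
        (\<forall>x y. E x V \<and> E y V \<and> x \<noteq> y \<longrightarrow> app r x y \<or> app r y x)"
      "\<forall>v. E v V \<longrightarrow> (\<exists>K. (\<forall>w. E w K \<longleftrightarrow> E w V \<and> app r w v \<and> E (upair w v) X) \<and> sub K V \<and>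
        (\<forall>x y. E x K \<and> E y K \<and> x \<noteq> y \<longrightarrow> E (upair x y) X))"
      by (rule elimination_order[OF ac[unfolded sat_AC_fin_omega]
            graph[unfolded sat_is_graph[OF d] look] connected[unfolded sat_is_connected[OF d] look]
            locally_finite[unfolded sat_is_locally_finite[OF d] look]
            chordal[unfolded sat_is_chordal[OF d] look]]) (rule that)
    have d': "0 < Suc ?d" "Suc 0 < Suc ?d" "?d < Suc ?d"
      and look': "look (case_nat r ?e) (Suc ?d) 0 = V" "look (case_nat r ?e) (Suc ?d) (Suc 0) = X"
        "look (case_nat r ?e) (Suc ?d) ?d = r" by simp_all
    have "sat E (=) (case_nat r ?e) (is_total_order 0 ?d (Suc ?d))"
      unfolding sat_is_total_order[OF d'(1,3)] look' by (rule r(1))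
    moreover have "sat E (=) (case_nat r ?e) (smaller_neighbours_cliques 0 (Suc 0) ?d (Suc ?d))"
      unfolding sat_smaller_neighbours_cliques[OF d'] look' by (rule r(2))
    ultimately show "\<exists>a. sat E (=) (case_nat a ?e) (is_total_order 0 ?d (Suc ?d)) \<and>
        sat E (=) (case_nat a ?e) (smaller_neighbours_cliques 0 (Suc 0) ?d (Suc ?d))" by blast
  qed
qed

end
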